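(* Let $H$ be a regular multiplier Hopf algebra over $\mathbb{C}$ and let $(\delta,\sigma)$ be a modular pair in involution for $H$. Then, with the (extended) coface maps $\delta_i$ ($0\le i\le n+1$) and codegeneracy maps $\sigma_j$ defined in the context, both $\{M_0^n(H)\}_{n\ge 0}$ and $\{M^n(H)\}_{n\ge 0}$ are cosimplicial modules (i.e. cosimplicial $\mathbb{C}$-vector spaces).
   Context: All algebras are over $\mathbb{C}$, associative, possibly non-unital, with non-degenerate product. $M(A)$ denotes the multiplier algebra of $A$ (pairs $(\alpha_L,\alpha_R)$ of linear maps $A\to A$ with $\alpha_L(ab)=\alpha_L(a)b$, $\alpha_R(ab)=a\alpha_R(b)$, $a\,\alpha_L(b)=\alpha_R(a)\,b$); $A\subset M(A)$ canonically. A multiplier Hopf algebra is an algebra $H$ with a homomorphism $\Delta:H\to M(H\otimes H)$ such that $W_R(a\otimes b)=\Delta(a)(1\otimes b)$ and $W_L(a\otimes b)=(a\otimes 1)\Delta(b)$ are well-defined bijective maps $H\otimes H\to H\otimes H$, and $\Delta$ is coassociative: $(a\otimes1\otimes1)\,(\Delta\otimes\mathrm{id})(\Delta(b)(1\otimes c))=(\mathrm{id}\otimes\Delta)((a\otimes1)\Delta(b))\,(1\otimes1\otimes c)$. It is regular if $H$ with $\Delta$ composed with the flip is again a multiplier Hopf algebra. $\epsilon:H\to\mathbb{C}$ denotes the counit (a homomorphism) and $S:H\to H$ the (bijective) antipode. Non-degenerate homomorphisms such as $\Delta$, $\epsilon$ and characters are extended uniquely to multiplier algebras. A modular pair in involution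 is a pair $(\delta,\sigma)$ where $\delta$ is a character of $H$, $\sigma\in M(H)$ is group-like, $\Delta(\sigma)=\sigma\otimes\sigma$, $\delta(\sigma)=1$, and the map $S_{(\delta,\sigma)}:H\to H$ given by $\delta(a)S_{(\delta,\sigma)}(h)=(\delta\otimes S)W_L(a\otimes h)$ ($a,h\in H$) satisfies $S_{(\delta,\sigma)}^2(h)=\sigma h\sigma^{-1}$, where $\sigma^{-1}=S(\sigma)$. (Only $\sigma$ enters the maps below.) $M^n(H)=M(H^{\otimes n})$, with $M^0(H)=\mathbb{C}$. $N(H)$ is the subalgebra of $M(H)$ generated by $H$, $1$ and $\sigma$. $M_0^n(H)$ is the subspace of all $z\in M^n(H)$ such that for every $i=1,\dots,n$ and every $w_i=a_1\otimes\cdots\otimes a_{i-1}\otimes 1\otimes a_{i+1}\otimes\cdots\otimes a_n$ with $a_j\in H$, both $zw_i$ and $w_iz$ lie in $H\otimes\cdots\otimes N(H)\otimes\cdots\otimes H$ ($N(H)$ in the $i$-th place); $M_0^0(H)=\mathbb{C}$. Coface maps $\delta_i:M^n(H)\to M^{n+1}(H)$: $\delta_0(y)=1\otimes y$, $\delta_{n+1}(y)=y\otimes\sigma$ (for $n=0$: $\delta_0(1)=1$, $\delta_1(1)=\sigma$), and for $1\le i\le n$, $\delta_i$ is the canonical extension of $h^1\otimes\cdots\otimes h^n\mapsto h^1\otimes\cdots\otimes\Delta(h^i)\otimes\cdots\otimes h^n$, i.e. $\delta_i(y)\,(\delta_i(x)w)=\delta_i(yx)\,w$ and $(w\,\delta_i(x))\,\delta_i(y)=w\,\delta_i(xy)$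 for $x\in H^{\otimes n}$, $w\in H^{\otimes(n+1)}$. Codegeneracy maps $\sigma_i:M^n(H)\to M^{n-1}(H)$, $1\le i\le n$: the canonical extension of $h^1\otimes\cdots\otimes h^n\mapsto\epsilon(h^i)\,h^1\otimes\cdots\otimes h^{i-1}\otimes h^{i+1}\otimes\cdots\otimes h^n$, i.e. $\epsilon(a_i)\,\sigma_i(y)(a_1\otimes\cdots\otimes a_{i-1}\otimes a_{i+1}\otimes\cdots\otimes a_n)=\sigma_i(y(a_1\otimes\cdots\otimes a_n))$ for all $a_j\in H$, and analogously for multiplication from the other side. The same formulas give the maps on $M_0^n(H)$. Here $\sigma_i$ removes the $i$-th tensor factor, so in the standard numbering of a cosimplicial object (cofaces $d_i$, $0\le i\le n+1$; codegeneracies $s_j$ from level $n+1$ to level $n$, $0\le j\le n$) one has $d_i=\delta_i$ and $s_j=\sigma_{j+1}$. *)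

theory Defs
  imports Complex_Main "HOL-Library.Poly_Mapping" "HOL-Library.Function_Algebras"
    "HOL-Library.Product_Plus"
begin

section \<open>Complex vector spaces and algebras\<close>

class scaleC =
  fixes scaleC :: "complex \<Rightarrow> 'a \<Rightarrow> 'a" (infixr "*\<^sub>C" 75)

class complex_vector = scaleC + ab_group_add +
  assumes scaleC_add_right: "a *\<^sub>C (x + y) = a *\<^sub>C x + a *\<^sub>C y"
    and scaleC_add_left: "(a + b) *\<^sub>C x = a *\<^sub>C x + b *\<^sub>C x"
    and scaleC_scaleC: "a *\<^sub>C b *\<^sub>C x = (a * b) *\<^sub>C x"
    and scaleC_one: "1 *\<^sub>C x = x"

text \<open>Associative, possibly non-unital complex algebras.\<close>

class complex_algebra = complex_vector + ring +
  assumes mult_scaleC_left: "(a *\<^sub>C x) * y = a *\<^sub>C (x * y)"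
    and mult_scaleC_right: "x * (a *\<^sub>C y) = a *\<^sub>C (x * y)"

global_interpretation complex_vector:
  vector_space "scaleC :: complex \<Rightarrow> 'a \<Rightarrow> 'a::complex_vector"
  by unfold_locales (simp_all add: scaleC_add_right scaleC_add_left scaleC_scaleC scaleC_one)

abbreviation csubspace :: "'a::complex_vector set \<Rightarrow> bool"
  where "csubspace \<equiv> module.subspace scaleC"

abbreviation cspan :: "'a::complex_vector set \<Rightarrow> 'a set"
  where "cspan \<equiv> module.span scaleC"

definition linear_on :: "'a::complex_vector set \<Rightarrow> ('a \<Rightarrow> 'b::complex_vector) \<Rightarrow> bool" where
  "linear_on V f \<longleftrightarrow> (\<forall>x\<in>V. \<forall>y\<in>V. f (x + y) = f x + f y) \<and> (\<forall>c. \<forall>x\<in>V. f (c *\<^sub>C x) = c *\<^sub>C f x)"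

definition nondegenerate :: "'a::complex_algebra itself \<Rightarrow> bool" where
  "nondegenerate _ \<longleftrightarrow>
     (\<forall>a::'a. (\<forall>b. a * b = 0) \<longrightarrow> a = 0) \<and> (\<forall>a::'a. (\<forall>b. b * a = 0) \<longrightarrow> a = 0)"

instantiation complex :: complex_vector
begin
definition scaleC_complex :: "complex \<Rightarrow> complex \<Rightarrow> complex" where "scaleC_complex c x = c * x"
instance by standard (simp_all add: scaleC_complex_def algebra_simps)
end

instantiation "fun" :: (type, complex_vector) complex_vector
begin
definition scaleC_fun :: "complex \<Rightarrow> ('a \<Rightarrow> 'b) \<Rightarrow> 'a \<Rightarrow> 'b"
  where "scaleC_fun c f = (\<lambda>x. c *\<^sub>C f x)"
instance
  by standard (simp_all add: scaleC_fun_def fun_eq_iff scaleC_add_right scaleC_add_left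
      scaleC_scaleC scaleC_one)
end

instantiation prod :: (complex_vector, complex_vector) complex_vector
begin
definition scaleC_prod :: "complex \<Rightarrow> 'a \<times> 'b \<Rightarrow> 'a \<times> 'b"
  where "scaleC_prod c p = (c *\<^sub>C fst p, c *\<^sub>C snd p)"
instance
  by standard (simp_all add: scaleC_prod_def prod_eq_iff scaleC_add_right scaleC_add_left
      scaleC_scaleC scaleC_one)
end

lemma lookup_map_scaleC:
  "Poly_Mapping.lookup (Poly_Mapping.map (scaleC c) p) k = c *\<^sub>C (Poly_Mapping.lookup p k :: 'b::complex_vector)"
  by (simp add: Poly_Mapping.map.rep_eq when_def)

instantiation poly_mapping :: (type, complex_vector) complex_vector
begin
definition scaleC_poly_mapping :: "complex \<Rightarrow> ('a \<Rightarrow>\<^sub>0 'b) \<Rightarrow> ('a \<Rightarrow>\<^sub>0 'b)"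
  where "scaleC_poly_mapping c p = Poly_Mapping.map (scaleC c) p"
instance
  by standard (simp_all add: scaleC_poly_mapping_def poly_mapping_eq_iff fun_eq_iff
      lookup_map_scaleC lookup_add scaleC_add_right scaleC_add_left scaleC_scaleC scaleC_one)
end


section \<open>Tensor powers\<close>

text \<open>
  The type \<open>'a tensor\<close> is the direct sum over all \<open>n\<close> of the algebraic tensor powers of \<open>'a\<close>: the
  free vector space on lists modulo the relations of multilinearity in each entry.  The list
  \<open>[a\<^sub>1, \<dots>, a\<^sub>n]\<close> represents the elementary tensor \<open>a\<^sub>1 \<otimes> \<dots> \<otimes> a\<^sub>n\<close>, and the summand of degree \<open>n\<close> is
  \<open>tpow n\<close>; in particular \<open>tpow 0\<close> is the line spanned by the empty tensor \<open>pure []\<close>, and \<open>'a\<close>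
  itself is identified with \<open>tpow 1\<close> through \<open>a \<mapsto> pure [a]\<close>.
\<close>

definition multilinear_relations :: "('a::complex_vector list \<Rightarrow>\<^sub>0 complex) set" where
  "multilinear_relations =
     {Poly_Mapping.single (xs @ (a + b) # ys) 1 - Poly_Mapping.single (xs @ a # ys) 1
        - Poly_Mapping.single (xs @ b # ys) 1 | xs a b ys. True} \<union>
     {Poly_Mapping.single (xs @ (c *\<^sub>C a) # ys) 1 - c *\<^sub>C Poly_Mapping.single (xs @ a # ys) 1
        | xs c a ys. True}"

definition tensor_rel :: "('a::complex_vector list \<Rightarrow>\<^sub>0 complex) \<Rightarrow> ('a list \<Rightarrow>\<^sub>0 complex) \<Rightarrow> bool" where
  "tensor_rel p q \<longleftrightarrow> p - q \<in> cspan multilinear_relations"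

quotient_type (overloaded) 'a tensor = "'a::complex_vector list \<Rightarrow>\<^sub>0 complex" / tensor_rel
proof (rule equivpI)
  show "reflp (tensor_rel :: ('a list \<Rightarrow>\<^sub>0 complex) \<Rightarrow> _)"
    by (rule reflpI) (simp add: tensor_rel_def complex_vector.span_zero)
  show "symp (tensor_rel :: ('a list \<Rightarrow>\<^sub>0 complex) \<Rightarrow> _)"
  proof (rule sympI)
    fix p q :: "'a list \<Rightarrow>\<^sub>0 complex"
    assume "tensor_rel p q"
    then have "- (p - q) \<in> cspan multilinear_relations"
      unfolding tensor_rel_def by (rule complex_vector.span_neg)
    then show "tensor_rel q p" by (simp add: tensor_rel_def)
  qed
  show "transp (tensor_rel :: ('a list \<Rightarrow>\<^sub>0 complex) \<Rightarrow> _)"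
  proof (rule transpI)
    fix p q r :: "'a list \<Rightarrow>\<^sub>0 complex"
    assume "tensor_rel p q" "tensor_rel q r"
    then have "(p - q) + (q - r) \<in> cspan multilinear_relations"
      unfolding tensor_rel_def by (rule complex_vector.span_add)
    then show "tensor_rel p r" by (simp add: tensor_rel_def)
  qed
qed

instantiation tensor :: (complex_vector) complex_vector
begin

lift_definition zero_tensor :: "'a tensor" is 0 .

lift_definition plus_tensor :: "'a tensor \<Rightarrow> 'a tensor \<Rightarrow> 'a tensor" is "(+)"
proof -
  fix p p' q q' :: "'a list \<Rightarrow>\<^sub>0 complex"
  assume "tensor_rel p p'" "tensor_rel q q'"
  then have "(p - p') + (q - q') \<in> cspan multilinear_relations"
    unfolding tensor_rel_def by (rule complex_vector.span_add)
  then show "tensor_rel (p + q) (p' + q')" by (simp add: tensor_rel_def algebra_simps)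
qed

lift_definition uminus_tensor :: "'a tensor \<Rightarrow> 'a tensor" is uminus
proof -
  fix p q :: "'a list \<Rightarrow>\<^sub>0 complex"
  assume "tensor_rel p q"
  then have "- (p - q) \<in> cspan multilinear_relations"
    unfolding tensor_rel_def by (rule complex_vector.span_neg)
  then show "tensor_rel (- p) (- q)" by (simp add: tensor_rel_def)
qed

lift_definition minus_tensor :: "'a tensor \<Rightarrow> 'a tensor \<Rightarrow> 'a tensor" is "(-)"
proof -
  fix p p' q q' :: "'a list \<Rightarrow>\<^sub>0 complex"
  assume "tensor_rel p p'" "tensor_rel q q'"
  then have "(p - p') - (q - q') \<in> cspan multilinear_relations"
    unfolding tensor_rel_def by (rule complex_vector.span_diff)
  then show "tensor_rel (p - q) (p' - q')" by (simp add: tensor_rel_def algebra_simps)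
qed

lift_definition scaleC_tensor :: "complex \<Rightarrow> 'a tensor \<Rightarrow> 'a tensor" is scaleC
proof -
  fix c :: complex and p q :: "'a list \<Rightarrow>\<^sub>0 complex"
  assume "tensor_rel p q"
  then have "c *\<^sub>C (p - q) \<in> cspan multilinear_relations"
    unfolding tensor_rel_def by (rule complex_vector.span_scale)
  then show "tensor_rel (c *\<^sub>C p) (c *\<^sub>C q)"
    by (simp add: tensor_rel_def complex_vector.scale_right_diff_distrib)
qed

instance
proof
  fix a b :: complex and x y z :: "'a tensor"
  note [simp] = tensor_rel_def complex_vector.span_zero
  show "a *\<^sub>C (x + y) = a *\<^sub>C x + a *\<^sub>C y" by transfer (simp add: scaleC_add_right)
  show "(a + b) *\<^sub>C x = a *\<^sub>C x + b *\<^sub>C x" by transfer (simp add: scaleC_add_left)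
  show "a *\<^sub>C b *\<^sub>C x = (a * b) *\<^sub>C x" by transfer (simp add: scaleC_scaleC)
  show "1 *\<^sub>C x = x" by transfer (simp add: scaleC_one)
  show "x + y + z = x + (y + z)" by transfer (simp add: add.assoc)
  show "x + y = y + x" by transfer (simp add: add.commute)
  show "0 + x = x" by transfer simp
  show "- x + x = 0" by transfer simp
  show "x - y = x + - y" by transfer simp
qed

end

lift_definition pure :: "'a::complex_vector list \<Rightarrow> 'a tensor"
  is "\<lambda>xs. Poly_Mapping.single xs (1::complex)" .

definition tpow :: "nat \<Rightarrow> 'a::complex_vector tensor set" where
  "tpow n = cspan {pure xs | xs. length xs = n}"

text \<open>
  \<open>tlift n f\<close> is the linear map on \<open>tpow n\<close> induced by \<open>f\<close>, where \<open>f\<close> is multilinear on lists of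
  length \<open>n\<close>.  Maps on a subspace are always extended by \<open>0\<close> outside it, so that they are determined
  by their restriction and are added and scaled pointwise.
\<close>

definition tlift :: "nat \<Rightarrow> ('a::complex_vector list \<Rightarrow> 'b::complex_vector) \<Rightarrow> 'a tensor \<Rightarrow> 'b" where
  "tlift n f = (THE g. linear_on (tpow n) g \<and> (\<forall>xs. length xs = n \<longrightarrow> g (pure xs) = f xs) \<and>
                       (\<forall>t. t \<notin> tpow n \<longrightarrow> g t = 0))"

text \<open>The product of the algebra \<open>tpow n\<close> and the concatenation \<open>tpow m \<times> tpow n \<rightarrow> tpow (m + n)\<close>.\<close>

definition tmult :: "nat \<Rightarrow> 'a::complex_algebra tensor \<Rightarrow> 'a tensor \<Rightarrow> 'a tensor" where
  "tmult n s t = tlift n (\<lambda>xs. tlift n (\<lambda>ys. pure (map2 (*) xs ys)) t) s"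

definition tconcat :: "nat \<Rightarrow> nat \<Rightarrow> 'a::complex_algebra tensor \<Rightarrow> 'a tensor \<Rightarrow> 'a tensor" where
  "tconcat m n s t = tlift m (\<lambda>xs. tlift n (\<lambda>ys. pure (xs @ ys)) t) s"

definition tval :: "'a::complex_vector tensor \<Rightarrow> 'a" where
  "tval = tlift 1 hd"


section \<open>Multipliers\<close>

text \<open>
  A multiplier \<open>\<alpha>\<close> is the pair of the maps \<open>t \<mapsto> \<alpha> t\<close> and \<open>t \<mapsto> t \<alpha>\<close>.  In degree \<open>0\<close>, where
  \<open>tpow 0\<close> is the ground field, all multipliers are scalar multiples of \<open>mone 0\<close>.
\<close>

type_synonym 'a multiplier = "('a tensor \<Rightarrow> 'a tensor) \<times> ('a tensor \<Rightarrow> 'a tensor)"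

definition multipliers :: "nat \<Rightarrow> 'a::complex_algebra multiplier set" where
  "multipliers n = {(L, R).
     linear_on (tpow n) L \<and> L ` tpow n \<subseteq> tpow n \<and> (\<forall>t. t \<notin> tpow n \<longrightarrow> L t = 0) \<and>
     linear_on (tpow n) R \<and> R ` tpow n \<subseteq> tpow n \<and> (\<forall>t. t \<notin> tpow n \<longrightarrow> R t = 0) \<and>
     (\<forall>a\<in>tpow n. \<forall>b\<in>tpow n. L (tmult n a b) = tmult n (L a) b \<and>
        R (tmult n a b) = tmult n a (R b) \<and> tmult n a (L b) = tmult n (R a) b)}"

definition mmult :: "'a::complex_algebra multiplier \<Rightarrow> 'a multiplier \<Rightarrow> 'a multiplier" where
  "mmult x y = (fst x \<circ> fst y, snd y \<circ> snd x)"

definition mone :: "nat \<Rightarrow> 'a::complex_algebra multiplier" where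
  "mone n = (\<lambda>t. if t \<in> tpow n then t else 0, \<lambda>t. if t \<in> tpow n then t else 0)"

definition membed :: "nat \<Rightarrow> 'a::complex_algebra tensor \<Rightarrow> 'a multiplier" where
  "membed n t = (\<lambda>s. tmult n t s, \<lambda>s. tmult n s t)"

text \<open>\<open>x \<otimes> y\<close> for \<open>x \<in> multipliers m\<close>, \<open>y \<in> multipliers n\<close>.\<close>

definition mtensor :: "nat \<Rightarrow> nat \<Rightarrow> 'a::complex_algebra multiplier \<Rightarrow> 'a multiplier \<Rightarrow> 'a multiplier"
  where "mtensor m n x y =
    (tlift (m + n) (\<lambda>zs. tconcat m n (fst x (pure (take m zs))) (fst y (pure (drop m zs)))),
     tlift (m + n) (\<lambda>zs. tconcat m n (snd x (pure (take m zs))) (snd y (pure (drop m zs)))))"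

text \<open>\<open>a\<^sub>1 \<otimes> \<dots> \<otimes> a\<^sub>p \<otimes> x \<otimes> b\<^sub>1 \<otimes> \<dots> \<otimes> b\<^sub>q\<close> for \<open>x \<in> multipliers k\<close>.\<close>

definition mbetween :: "nat \<Rightarrow> 'a::complex_algebra list \<Rightarrow> 'a multiplier \<Rightarrow> 'a list \<Rightarrow> 'a multiplier"
  where "mbetween k as x bs =
    mtensor (length as) (k + length bs) (membed (length as) (pure as))
      (mtensor k (length bs) x (membed (length bs) (pure bs)))"


section \<open>Multiplier Hopf algebras\<close>

definition W_R :: "('a::complex_algebra \<Rightarrow> 'a multiplier) \<Rightarrow> 'a tensor \<Rightarrow> 'a tensor" where
  "W_R \<Delta> = tlift 2 (\<lambda>xs. THE t. t \<in> tpow 2 \<and>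
     membed 2 t = mmult (\<Delta> (xs ! 0)) (mtensor 1 1 (mone 1) (membed 1 (pure [xs ! 1]))))"

definition W_L :: "('a::complex_algebra \<Rightarrow> 'a multiplier) \<Rightarrow> 'a tensor \<Rightarrow> 'a tensor" where
  "W_L \<Delta> = tlift 2 (\<lambda>xs. THE t. t \<in> tpow 2 \<and>
     membed 2 t = mmult (mtensor 1 1 (membed 1 (pure [xs ! 0])) (mone 1)) (\<Delta> (xs ! 1)))"

text \<open>\<open>\<Delta>\<close> applied to the \<open>i\<close>-th tensor factor, \<open>1 \<le> i \<le> n\<close>, as a map \<open>tpow n \<rightarrow> multipliers (n + 1)\<close>.\<close>

definition coprod_at ::
  "('a::complex_algebra \<Rightarrow> 'a multiplier) \<Rightarrow> nat \<Rightarrow> nat \<Rightarrow> 'a tensor \<Rightarrow> 'a multiplier" where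
  "coprod_at \<Delta> n i = tlift n (\<lambda>xs. mbetween 2 (take (i - 1) xs) (\<Delta> (xs ! (i - 1))) (drop i xs))"

definition multiplier_hopf_algebra :: "('a::complex_algebra \<Rightarrow> 'a multiplier) \<Rightarrow> bool" where
  "multiplier_hopf_algebra \<Delta> \<longleftrightarrow>
     nondegenerate TYPE('a) \<and>
     (\<forall>a. \<Delta> a \<in> multipliers 2) \<and> linear_on UNIV \<Delta> \<and> (\<forall>a b. \<Delta> (a * b) = mmult (\<Delta> a) (\<Delta> b)) \<and>
     (\<forall>a b. \<exists>t\<in>tpow 2. membed 2 t = mmult (\<Delta> a) (mtensor 1 1 (mone 1) (membed 1 (pure [b])))) \<and>
     (\<forall>a b. \<exists>t\<in>tpow 2. membed 2 t = mmult (mtensor 1 1 (membed 1 (pure [a])) (mone 1)) (\<Delta> b)) \<and>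
     bij_betw (W_R \<Delta>) (tpow 2) (tpow 2) \<and>
     bij_betw (W_L \<Delta>) (tpow 2) (tpow 2) \<and>
     (\<forall>a b c.
        mmult (mtensor 1 2 (membed 1 (pure [a])) (mone 2)) (coprod_at \<Delta> 2 1 (W_R \<Delta> (pure [b, c]))) =
        mmult (coprod_at \<Delta> 2 2 (W_L \<Delta> (pure [a, b]))) (mtensor 2 1 (mone 2) (membed 1 (pure [c]))))"

definition tflip :: "'a::complex_vector tensor \<Rightarrow> 'a tensor" where
  "tflip = tlift 2 (\<lambda>xs. pure [xs ! 1, xs ! 0])"

definition mflip :: "'a::complex_algebra multiplier \<Rightarrow> 'a multiplier" where
  "mflip x = (tflip \<circ> fst x \<circ> tflip, tflip \<circ> snd x \<circ> tflip)"

definition regular_multiplier_hopf_algebra :: "('a::complex_algebra \<Rightarrow> 'a multiplier) \<Rightarrow> bool" where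
  "regular_multiplier_hopf_algebra \<Delta> \<longleftrightarrow>
     multiplier_hopf_algebra \<Delta> \<and> multiplier_hopf_algebra (mflip \<circ> \<Delta>)"

text \<open>
  Counit: the homomorphism with \<open>(\<epsilon> \<otimes> id)(\<Delta>(a)(1 \<otimes> b)) = a b = (id \<otimes> \<epsilon>)((a \<otimes> 1)\<Delta>(b))\<close>.
  Antipode: the linear map with \<open>m(S \<otimes> id)(\<Delta>(a)(1 \<otimes> b)) = \<epsilon>(a) b\<close> and
  \<open>m(id \<otimes> S)((a \<otimes> 1)\<Delta>(b)) = \<epsilon>(b) a\<close>; it takes values in the algebra itself and is bijective
  in the regular case.  Both are unique when they exist.
\<close>

definition is_counit :: "('a::complex_algebra \<Rightarrow> 'a multiplier) \<Rightarrow> ('a \<Rightarrow> complex) \<Rightarrow> bool" where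
  "is_counit \<Delta> \<epsilon> \<longleftrightarrow>
     linear_on UNIV \<epsilon> \<and> (\<forall>a b. \<epsilon> (a * b) = \<epsilon> a * \<epsilon> b) \<and>
     (\<forall>a b. tlift 2 (\<lambda>xs. \<epsilon> (xs ! 0) *\<^sub>C (xs ! 1)) (W_R \<Delta> (pure [a, b])) = a * b) \<and>
     (\<forall>a b. tlift 2 (\<lambda>xs. \<epsilon> (xs ! 1) *\<^sub>C (xs ! 0)) (W_L \<Delta> (pure [a, b])) = a * b)"

definition counit :: "('a::complex_algebra \<Rightarrow> 'a multiplier) \<Rightarrow> 'a \<Rightarrow> complex" where
  "counit \<Delta> = (THE \<epsilon>. is_counit \<Delta> \<epsilon>)"

definition is_antipode :: "('a::complex_algebra \<Rightarrow> 'a multiplier) \<Rightarrow> ('a \<Rightarrow> 'a) \<Rightarrow> bool" where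
  "is_antipode \<Delta> S \<longleftrightarrow>
     linear_on UNIV S \<and>
     (\<forall>a b. tlift 2 (\<lambda>xs. S (xs ! 0) * (xs ! 1)) (W_R \<Delta> (pure [a, b])) = counit \<Delta> a *\<^sub>C b) \<and>
     (\<forall>a b. tlift 2 (\<lambda>xs. (xs ! 0) * S (xs ! 1)) (W_L \<Delta> (pure [a, b])) = counit \<Delta> b *\<^sub>C a)"

definition antipode :: "('a::complex_algebra \<Rightarrow> 'a multiplier) \<Rightarrow> 'a \<Rightarrow> 'a" where
  "antipode \<Delta> = (THE S. is_antipode \<Delta> S)"

text \<open>The extension of the antipode to \<open>multipliers 1\<close>: \<open>S(x) S(a) = S(a x)\<close>, \<open>S(a) S(x) = S(x a)\<close>.\<close>

definition antipode_ext :: "('a::complex_algebra \<Rightarrow> 'a multiplier) \<Rightarrow> 'a multiplier \<Rightarrow> 'a multiplier"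
  where "antipode_ext \<Delta> x = (THE z. z \<in> multipliers 1 \<and>
    (\<forall>a. fst z (pure [antipode \<Delta> a]) = pure [antipode \<Delta> (tval (snd x (pure [a])))] \<and>
         snd z (pure [antipode \<Delta> a]) = pure [antipode \<Delta> (tval (fst x (pure [a])))]))"

text \<open>
  The canonical extension \<open>\<Delta>\<^sub>i\<close> of \<open>coprod_at \<Delta> n i\<close> to multipliers:
  \<open>\<Delta>\<^sub>i(y) (\<Delta>\<^sub>i(x) w) = \<Delta>\<^sub>i(y x) w\<close> and \<open>(w \<Delta>\<^sub>i(x)) \<Delta>\<^sub>i(y) = w \<Delta>\<^sub>i(x y)\<close>.
\<close>

definition coprod_at_ext ::
  "('a::complex_algebra \<Rightarrow> 'a multiplier) \<Rightarrow> nat \<Rightarrow> nat \<Rightarrow> 'a multiplier \<Rightarrow> 'a multiplier" where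
  "coprod_at_ext \<Delta> n i y = (THE z. z \<in> multipliers (n + 1) \<and>
     (\<forall>x\<in>tpow n. \<forall>w\<in>tpow (n + 1).
        fst z (fst (coprod_at \<Delta> n i x) w) = fst (coprod_at \<Delta> n i (fst y x)) w \<and>
        snd z (snd (coprod_at \<Delta> n i x) w) = snd (coprod_at \<Delta> n i (snd y x)) w))"


section \<open>Modular pairs in involution\<close>

definition is_character :: "('a::complex_algebra \<Rightarrow> complex) \<Rightarrow> bool" where
  "is_character \<delta> \<longleftrightarrow>
     linear_on UNIV \<delta> \<and> (\<forall>a b. \<delta> (a * b) = \<delta> a * \<delta> b) \<and> (\<exists>a. \<delta> a \<noteq> 0)"

definition character_ext :: "('a::complex_algebra \<Rightarrow> complex) \<Rightarrow> 'a multiplier \<Rightarrow> complex" where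
  "character_ext \<delta> y = (THE c.
     \<forall>a. c * \<delta> a = \<delta> (tval (fst y (pure [a]))) \<and> \<delta> a * c = \<delta> (tval (snd y (pure [a]))))"

text \<open>\<open>\<delta>(a) S\<^sub>\<delta>(h) = (\<delta> \<otimes> S)(W_L(a \<otimes> h))\<close>; the formula does not involve \<open>\<sigma>\<close>.\<close>

definition twisted_antipode ::
  "('a::complex_algebra \<Rightarrow> 'a multiplier) \<Rightarrow> ('a \<Rightarrow> complex) \<Rightarrow> 'a \<Rightarrow> 'a" where
  "twisted_antipode \<Delta> \<delta> = (THE T. \<forall>a h.
     \<delta> a *\<^sub>C T h = tlift 2 (\<lambda>xs. \<delta> (xs ! 0) *\<^sub>C antipode \<Delta> (xs ! 1)) (W_L \<Delta> (pure [a, h])))"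

text \<open>The inverse of \<open>\<sigma>\<close> in the last condition is \<open>S(\<sigma>)\<close>.\<close>

definition modular_pair_in_involution ::
  "('a::complex_algebra \<Rightarrow> 'a multiplier) \<Rightarrow> ('a \<Rightarrow> complex) \<Rightarrow> 'a multiplier \<Rightarrow> bool" where
  "modular_pair_in_involution \<Delta> \<delta> \<sigma> \<longleftrightarrow>
     is_character \<delta> \<and>
     \<sigma> \<in> multipliers 1 \<and> coprod_at_ext \<Delta> 1 1 \<sigma> = mtensor 1 1 \<sigma> \<sigma> \<and>
     character_ext \<delta> \<sigma> = 1 \<and>
     (\<forall>h. membed 1 (pure [twisted_antipode \<Delta> \<delta> (twisted_antipode \<Delta> \<delta> h)]) =
          mmult (mmult \<sigma> (membed 1 (pure [h]))) (antipode_ext \<Delta> \<sigma>))"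


section \<open>The cosimplicial structure\<close>

definition coface ::
  "('a::complex_algebra \<Rightarrow> 'a multiplier) \<Rightarrow> 'a multiplier \<Rightarrow> nat \<Rightarrow> nat \<Rightarrow> 'a multiplier \<Rightarrow> 'a multiplier"
  where "coface \<Delta> \<sigma> n i y =
    (if i = 0 then mtensor 1 n (mone 1) y
     else if i = n + 1 then mtensor n 1 y \<sigma>
     else coprod_at_ext \<Delta> n i y)"

definition remove_at :: "nat \<Rightarrow> 'a list \<Rightarrow> 'a list" where
  "remove_at i xs = take (i - 1) xs @ drop i xs"

definition counit_at ::
  "('a::complex_algebra \<Rightarrow> 'a multiplier) \<Rightarrow> nat \<Rightarrow> nat \<Rightarrow> 'a tensor \<Rightarrow> 'a tensor" where
  "counit_at \<Delta> n i = tlift n (\<lambda>xs. counit \<Delta> (xs ! (i - 1)) *\<^sub>C pure (remove_at i xs))"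

text \<open>\<open>codegeneracy \<Delta> n i\<close>, \<open>1 \<le> i \<le> n\<close>, maps \<open>multipliers n\<close> to \<open>multipliers (n - 1)\<close>.\<close>

definition codegeneracy ::
  "('a::complex_algebra \<Rightarrow> 'a multiplier) \<Rightarrow> nat \<Rightarrow> nat \<Rightarrow> 'a multiplier \<Rightarrow> 'a multiplier" where
  "codegeneracy \<Delta> n i y = (THE z. z \<in> multipliers (n - 1) \<and>
     (\<forall>as. length as = n \<longrightarrow>
        counit \<Delta> (as ! (i - 1)) *\<^sub>C fst z (pure (remove_at i as)) = counit_at \<Delta> n i (fst y (pure as)) \<and>
        counit \<Delta> (as ! (i - 1)) *\<^sub>C snd z (pure (remove_at i as)) = counit_at \<Delta> n i (snd y (pure as))))"

text \<open>The subalgebra \<open>N(H)\<close> of \<open>M(H)\<close> generated by \<open>H\<close>, \<open>1\<close> and \<open>\<sigma>\<close>.\<close>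

inductive_set N_alg :: "'a::complex_algebra multiplier \<Rightarrow> 'a multiplier set" for \<sigma> where
  N_embed: "membed 1 (pure [h]) \<in> N_alg \<sigma>"
| N_one: "mone 1 \<in> N_alg \<sigma>"
| N_sigma: "\<sigma> \<in> N_alg \<sigma>"
| N_add: "x \<in> N_alg \<sigma> \<Longrightarrow> y \<in> N_alg \<sigma> \<Longrightarrow> x + y \<in> N_alg \<sigma>"
| N_scale: "x \<in> N_alg \<sigma> \<Longrightarrow> c *\<^sub>C x \<in> N_alg \<sigma>"
| N_mult: "x \<in> N_alg \<sigma> \<Longrightarrow> y \<in> N_alg \<sigma> \<Longrightarrow> mmult x y \<in> N_alg \<sigma>"

text \<open>
  \<open>N_at \<sigma> n i\<close> is \<open>H \<otimes> \<dots> \<otimes> N(H) \<otimes> \<dots> \<otimes> H\<close>, with \<open>N(H)\<close> in place \<open>i\<close>, as a subspace of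
  \<open>multipliers n\<close>.
\<close>

definition N_at :: "'a::complex_algebra multiplier \<Rightarrow> nat \<Rightarrow> nat \<Rightarrow> 'a multiplier set" where
  "N_at \<sigma> n i = cspan {mbetween 1 as \<nu> bs | as \<nu> bs.
     length as = i - 1 \<and> length bs = n - i \<and> \<nu> \<in> N_alg \<sigma>}"

definition multipliers0 :: "'a::complex_algebra multiplier \<Rightarrow> nat \<Rightarrow> 'a multiplier set" where
  "multipliers0 \<sigma> n = {z \<in> multipliers n. \<forall>i\<in>{1..n}. \<forall>as bs.
     length as = i - 1 \<longrightarrow> length bs = n - i \<longrightarrow>
       mmult z (mbetween 1 as (mone 1) bs) \<in> N_at \<sigma> n i \<and>
       mmult (mbetween 1 as (mone 1) bs) z \<in> N_at \<sigma> n i}"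

text \<open>
  A cosimplicial vector space whose terms \<open>X n\<close> are subspaces of a common space, with cofaces
  \<open>d n i : X n \<rightarrow> X (n + 1)\<close>, \<open>0 \<le> i \<le> n + 1\<close>, and codegeneracies \<open>s n j : X (n + 1) \<rightarrow> X n\<close>,
  \<open>0 \<le> j \<le> n\<close>.
\<close>

definition cosimplicial_vector_space ::
  "(nat \<Rightarrow> 'b::complex_vector set) \<Rightarrow> (nat \<Rightarrow> nat \<Rightarrow> 'b \<Rightarrow> 'b) \<Rightarrow> (nat \<Rightarrow> nat \<Rightarrow> 'b \<Rightarrow> 'b) \<Rightarrow> bool" where
  "cosimplicial_vector_space X d s \<longleftrightarrow>
     (\<forall>n. csubspace (X n)) \<and>
     (\<forall>n. \<forall>i\<le>n + 1. linear_on (X n) (d n i) \<and> d n i ` X n \<subseteq> X (n + 1)) \<and>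
     (\<forall>n. \<forall>j\<le>n. linear_on (X (n + 1)) (s n j) \<and> s n j ` X (n + 1) \<subseteq> X n) \<and>
     (\<forall>n i j. i < j \<and> j \<le> n + 2 \<longrightarrow>
        (\<forall>x\<in>X n. d (n + 1) j (d n i x) = d (n + 1) i (d n (j - 1) x))) \<and>
     (\<forall>n i j. i < j \<and> j \<le> n + 1 \<longrightarrow>
        (\<forall>x\<in>X (n + 1). s (n + 1) j (d (n + 1) i x) = d n i (s n (j - 1) x))) \<and>
     (\<forall>n j. j \<le> n \<longrightarrow> (\<forall>x\<in>X n. s n j (d n j x) = x \<and> s n j (d n (j + 1) x) = x)) \<and>
     (\<forall>n i j. j + 1 < i \<and> i \<le> n + 2 \<longrightarrow>
        (\<forall>x\<in>X (n + 1). s (n + 1) j (d (n + 1) i x) = d n (i - 1) (s n j x))) \<and>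
     (\<forall>n i j. i \<le> j \<and> j \<le> n \<longrightarrow>
        (\<forall>x\<in>X (n + 2). s n j (s (n + 1) i x) = s n i (s (n + 1) (j + 1) x)))"

end

theory Submission
  imports Defs
begin

text \<open>
  \<open>\<Delta>\<close> and the counit \<open>\<epsilon>\<close> are nondegenerate homomorphisms from \<open>H\<close> to \<open>M(H \<otimes> H)\<close> and to
  \<open>\<complex> = M\<^sup>0(H)\<close>.  Such a homomorphism may act on one factor of \<open>H \<otimes> \<dots> \<otimes> H\<close> and extends to multipliers, and
  the extension is determined by its values on elementary tensors.  So a cosimplicial identity has
  to be checked on elementary tensors only, where it says that operations on different factors commute,
  or is coassociativity, the counit property, \<open>\<Delta>(\<sigma>) = \<sigma> \<otimes> \<sigma>\<close> or \<open>\<epsilon>(\<sigma>) = 1\<close>.  The last equation follows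
  from \<open>(\<epsilon> \<otimes> id)\<Delta>(\<sigma>) = \<sigma>\<close>, because \<open>\<delta>(\<sigma>) = 1\<close> implies \<open>\<sigma> \<noteq> 0\<close>.

  The existence of the counit is Van Daele's theorem: let \<open>\<kappa>\<close> be the product of \<open>H\<close> composed with the
  inverse of \<open>W\<^sub>R\<close>.  Coassociativity gives \<open>(id \<otimes> \<kappa>)(W\<^sub>L(a \<otimes> b) \<otimes> c) = a b \<otimes> c\<close>, and since \<open>W\<^sub>L\<close> is
  surjective this forces \<open>\<kappa>(y \<otimes> c) = \<epsilon>(y) c\<close> for a linear functional \<open>\<epsilon>\<close>.

  The spaces \<open>M\<^sub>0\<^sup>n(H)\<close> are preserved: if the distinguished factor is not the one on which \<open>\<Delta>\<close> or \<open>\<epsilon>\<close> acts,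
  by nondegeneracy on the other factors; if it is, because
  \<open>\<Delta>(N(H))(1 \<otimes> H) \<subseteq> N(H) \<otimes> H\<close> and likewise for the other three products.
\<close>

section \<open>Tensor powers\<close>

text \<open>Degrees are not part of the types: all tensor powers live in the one type
  \<open>'a tensor\<close>, and every operation carries its degree as a number. Hence sums keep
  shapes such as \<open>p + (1 + q)\<close>, and linearity is always relative to a subspace.

  The structure maps are \<open>THE\<close> terms, meaningful only after existence and uniqueness
  are known. Uniqueness of the multipliers involved rests on nondegeneracy of the powers of H. This
  is not formal: it takes a basis of some factors and linear functionals on another. Existence of
  extensions needs \<Delta> and \<epsilon> to be nondegenerate in the presence of further factors,
  hence H H = H. That is no axiom; it is derived from surjectivity of \<open>W_R\<close> and the
  counit. So the counit has to be built before any map is extended, and coassociativity is first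
  used as an equation inside the third power of H.

  Cofaces and codegeneracies are then two instances of one operation, \<open>leg_ext\<close>, which
  reduces the commutation of inner maps on different factors to the single lemma
  \<open>leg_ext_commute\<close>.\<close>

lemma linear_onI:
  assumes "\<And>x y. x \<in> V \<Longrightarrow> y \<in> V \<Longrightarrow> f (x + y) = f x + f y"
    and "\<And>c x. x \<in> V \<Longrightarrow> f (c *\<^sub>C x) = c *\<^sub>C f x"
  shows "linear_on V f"
  using assms by (simp add: linear_on_def)

lemma linear_on_add: "linear_on V f \<Longrightarrow> x \<in> V \<Longrightarrow> y \<in> V \<Longrightarrow> f (x + y) = f x + f y"
  and linear_on_scale: "linear_on V f \<Longrightarrow> x \<in> V \<Longrightarrow> f (c *\<^sub>C x) = c *\<^sub>C f x"
  by (simp_all add: linear_on_def)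

lemma linear_on_zero: "linear_on V f \<Longrightarrow> csubspace V \<Longrightarrow> f 0 = 0"
  using linear_on_scale[of V f 0 0] complex_vector.subspace_0 by fastforce

lemma linear_on_diff:
  assumes "linear_on V f" "csubspace V" "x \<in> V" "y \<in> V"
  shows "f (x - y) = f x - f y"
proof -
  have "f (x + (-1) *\<^sub>C y) = f x + (-1) *\<^sub>C f y"
    using assms by (simp add: linear_on_add linear_on_scale complex_vector.subspace_scale
        del: complex_vector.scale_minus_left)
  then show ?thesis by simp
qed

lemma linear_on_sum:
  assumes "linear_on V f" "csubspace V" "\<And>i. i \<in> I \<Longrightarrow> g i \<in> V"
  shows "f (\<Sum>i\<in>I. g i) = (\<Sum>i\<in>I. f (g i))"
proof (cases "finite I")
  case True
  then show ?thesis using assms(3)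
  proof (induction I rule: finite_induct)
    case empty
    show ?case using assms by (simp add: linear_on_zero)
  next
    case (insert i I)
    have "(\<Sum>i\<in>I. g i) \<in> V"
      using insert.prems by (intro complex_vector.subspace_sum[OF assms(2)]) auto
    then show ?case using insert by (simp add: linear_on_add[OF assms(1)])
  qed
next
  case False
  then show ?thesis using assms by (simp add: linear_on_zero)
qed

lemma linear_on_comp:
  "linear_on V f \<Longrightarrow> linear_on W g \<Longrightarrow> f ` V \<subseteq> W \<Longrightarrow> linear_on V (\<lambda>x. g (f x))"
  unfolding linear_on_def by (simp add: image_subset_iff)

lemma span_linear_induct:
  assumes "x \<in> cspan S" "linear_on UNIV f" "csubspace W" "\<And>y. y \<in> S \<Longrightarrow> f y \<in> W"
  shows "f x \<in> W"
proof (rule complex_vector.span_induct[OF assms(1)])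
  show "csubspace {x. f x \<in> W}"
    using assms(2,3) linear_on_zero[OF assms(2)]
    by (auto simp: complex_vector.subspace_def linear_on_def)
qed (use assms in auto)

section \<open>Multilinear maps and the universal property of the tensor powers\<close>

definition multilinear :: "nat \<Rightarrow> ('a::complex_vector list \<Rightarrow> 'b::complex_vector) \<Rightarrow> bool" where
  "multilinear n f \<longleftrightarrow>
    (\<forall>xs ys a b. Suc (length xs + length ys) = n \<longrightarrow>
       f (xs @ (a + b) # ys) = f (xs @ a # ys) + f (xs @ b # ys)) \<and>
    (\<forall>xs ys c a. Suc (length xs + length ys) = n \<longrightarrow>
       f (xs @ (c *\<^sub>C a) # ys) = c *\<^sub>C f (xs @ a # ys))"

lemma multilinearI:
  assumes "\<And>xs ys a b. Suc (length xs + length ys) = n \<Longrightarrow>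
       f (xs @ (a + b) # ys) = f (xs @ a # ys) + f (xs @ b # ys)"
    and "\<And>xs ys c a. Suc (length xs + length ys) = n \<Longrightarrow>
       f (xs @ (c *\<^sub>C a) # ys) = c *\<^sub>C f (xs @ a # ys)"
  shows "multilinear n f"
  using assms by (simp add: multilinear_def)

lemma multilinear_add: "multilinear n f \<Longrightarrow> Suc (length xs + length ys) = n \<Longrightarrow>
       f (xs @ (a + b) # ys) = f (xs @ a # ys) + f (xs @ b # ys)"
  and multilinear_scale: "multilinear n f \<Longrightarrow> Suc (length xs + length ys) = n \<Longrightarrow>
       f (xs @ (c *\<^sub>C a) # ys) = c *\<^sub>C f (xs @ a # ys)"
  by (auto simp: multilinear_def)

lemma pure_add: "pure (xs @ (a + b) # ys) = pure (xs @ a # ys) + pure (xs @ b # ys)"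
proof (transfer, unfold tensor_rel_def)
  fix xs ys :: "'a list" and a b
  have "Poly_Mapping.single (xs @ (a + b) # ys) 1 - Poly_Mapping.single (xs @ a # ys) 1
        - Poly_Mapping.single (xs @ b # ys) (1::complex) \<in> multilinear_relations"
    unfolding multilinear_relations_def by blast
  from complex_vector.span_base[OF this]
  show "Poly_Mapping.single (xs @ (a + b) # ys) 1 -
       (Poly_Mapping.single (xs @ a # ys) 1 + Poly_Mapping.single (xs @ b # ys) 1)
       \<in> cspan multilinear_relations" by (simp add: algebra_simps)
qed

lemma pure_scale: "pure (xs @ (c *\<^sub>C a) # ys) = c *\<^sub>C pure (xs @ a # ys)"
proof (transfer, unfold tensor_rel_def)
  fix xs ys :: "'a list" and a c
  have "Poly_Mapping.single (xs @ (c *\<^sub>C a) # ys) 1 - c *\<^sub>C Poly_Mapping.single (xs @ a # ys) 1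
        \<in> multilinear_relations"
    unfolding multilinear_relations_def by blast
  from complex_vector.span_base[OF this]
  show "Poly_Mapping.single (xs @ (c *\<^sub>C a) # ys) 1 - c *\<^sub>C Poly_Mapping.single (xs @ a # ys) 1
        \<in> cspan multilinear_relations" .
qed

lemma multilinear_pure [simp]: "multilinear n pure"
  by (rule multilinearI) (rule pure_add pure_scale)+

lemma pure_single_add: "pure [a + b] = pure [a] + pure [b]"
  and pure_single_scale: "pure [c *\<^sub>C a] = c *\<^sub>C pure [a]"
  using pure_add[of "[]" a b "[]"] pure_scale[of "[]" c a "[]"] by simp_all

lemma subspace_tpow [simp]: "csubspace (tpow n)"
  by (simp add: tpow_def)

lemma pure_tpow [simp]: "length xs = n \<Longrightarrow> pure xs \<in> tpow n"
  unfolding tpow_def by (rule complex_vector.span_base) auto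

lemma tpow_closed [simp]:
  "0 \<in> tpow n"
  "s \<in> tpow n \<Longrightarrow> t \<in> tpow n \<Longrightarrow> s + t \<in> tpow n"
  "s \<in> tpow n \<Longrightarrow> t \<in> tpow n \<Longrightarrow> s - t \<in> tpow n"
  "s \<in> tpow n \<Longrightarrow> c *\<^sub>C s \<in> tpow n"
  by (simp_all add: complex_vector.subspace_0 complex_vector.subspace_add
      complex_vector.subspace_diff complex_vector.subspace_scale)

lemma tpow_sum [simp]: "(\<And>i. i \<in> I \<Longrightarrow> f i \<in> tpow n) \<Longrightarrow> (\<Sum>i\<in>I. f i) \<in> tpow n"
  by (rule complex_vector.subspace_sum) auto

text \<open>The induction steps carry membership in \<open>tpow n\<close>, because the maps to be
  compared are linear only there.\<close>

lemma tpow_induct [consumes 1, case_names pure zero add scale]: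
  assumes "t \<in> tpow n"
    and "\<And>xs. length xs = n \<Longrightarrow> P (pure xs)"
    and "P 0"
    and "\<And>s t. s \<in> tpow n \<Longrightarrow> t \<in> tpow n \<Longrightarrow> P s \<Longrightarrow> P t \<Longrightarrow> P (s + t)"
    and "\<And>c s. s \<in> tpow n \<Longrightarrow> P s \<Longrightarrow> P (c *\<^sub>C s)"
  shows "P t"
proof -
  have "t \<in> tpow n \<and> P t"
  proof (rule complex_vector.span_induct[OF assms(1)[unfolded tpow_def], where P = "\<lambda>t. t \<in> tpow n \<and> P t"])
    show "csubspace {t. t \<in> tpow n \<and> P t}"
      using assms by (auto simp: complex_vector.subspace_def)
  qed (use assms in auto)
  then show ?thesis by simp
qed

lemma linear_on_tpow_eq:
  assumes "linear_on (tpow n) f" "linear_on (tpow n) g"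
    and "\<And>xs. length xs = n \<Longrightarrow> f (pure xs) = g (pure xs)" "t \<in> tpow n"
  shows "f t = g t"
  using assms(4)
proof (induction rule: tpow_induct)
  case zero
  then show ?case using assms by (metis linear_on_zero subspace_tpow)
qed (use assms in \<open>auto simp: linear_on_def\<close>)

lemma linear_on_tpow_mem:
  assumes "linear_on (tpow n) f" "csubspace W"
    and "\<And>xs. length xs = n \<Longrightarrow> f (pure xs) \<in> W" "t \<in> tpow n"
  shows "f t \<in> W"
  using assms(4)
proof (induction rule: tpow_induct)
  case zero
  then show ?case using assms by (metis linear_on_zero subspace_tpow complex_vector.subspace_0)
qed (use assms in \<open>auto simp: linear_on_def complex_vector.subspace_add complex_vector.subspace_scale\<close>)

text \<open>This is the universal property of the tensor power. The linear extension of f to formal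
  sums of lists kills the relations, hence descends to the quotient, where it is computed on a
  representative.\<close>

lemma multilinear_linear_ex:
  fixes f :: "'a::complex_vector list \<Rightarrow> 'b::complex_vector"
  assumes "multilinear n f"
  shows "\<exists>g. linear_on UNIV g \<and> (\<forall>xs. length xs = n \<longrightarrow> g (pure xs) = f xs)"
proof -
  \<comment> \<open>Lists of other lengths go to 0. Then \<open>f'\<close> respects the relations of
    all degrees at once, as it must, since the quotient is taken over the direct sum of all
    degrees.\<close>
  define f' where "f' xs = (if length xs = n then f xs else 0)" for xs
  define G :: "('a list \<Rightarrow>\<^sub>0 complex) \<Rightarrow> 'b"
    where "G p = (\<Sum>k\<in>Poly_Mapping.keys p. Poly_Mapping.lookup p k *\<^sub>C f' k)" for p
  \<comment> \<open>Any finite set containing the support may serve as index set, so that the sums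
    for p and q can both run over the union of their supports.\<close>
  have G: "G p = (\<Sum>k\<in>K. Poly_Mapping.lookup p k *\<^sub>C f' k)"
    if "finite K" "Poly_Mapping.keys p \<subseteq> K" for p K
    unfolding G_def using that
    by (intro sum.mono_neutral_left) (auto simp: Poly_Mapping.in_keys_iff)
  have G_add: "G (p + q) = G p + G q" for p q
  proof -
    let ?K = "Poly_Mapping.keys p \<union> Poly_Mapping.keys q"
    have "G (p + q) = (\<Sum>k\<in>?K. Poly_Mapping.lookup (p + q) k *\<^sub>C f' k)"
      by (rule G) (auto simp: Poly_Mapping.keys_add)
    also have "\<dots> = (\<Sum>k\<in>?K. Poly_Mapping.lookup p k *\<^sub>C f' k) + (\<Sum>k\<in>?K. Poly_Mapping.lookup q k *\<^sub>C f' k)"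
      by (simp add: lookup_add scaleC_add_left sum.distrib)
    also have "\<dots> = G p + G q" by (subst (1 2) G[of ?K]) auto
    finally show ?thesis .
  qed
  have lookup_scale: "Poly_Mapping.lookup (c *\<^sub>C p) k = c * Poly_Mapping.lookup p k"
    for c and p :: "'a list \<Rightarrow>\<^sub>0 complex" and k
    by (simp add: scaleC_poly_mapping_def lookup_map_scaleC scaleC_complex_def)
  have G_scale: "G (c *\<^sub>C p) = c *\<^sub>C G p" for c p
  proof -
    have "G (c *\<^sub>C p) = (\<Sum>k\<in>Poly_Mapping.keys p. Poly_Mapping.lookup (c *\<^sub>C p) k *\<^sub>C f' k)"
      by (rule G) (auto simp: Poly_Mapping.in_keys_iff lookup_scale)
    then show ?thesis
      by (simp add: G_def lookup_scale complex_vector.scale_sum_right scaleC_scaleC)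
  qed
  have G_lin: "linear_on UNIV G" by (simp add: linear_on_def G_add G_scale)
  have G_diff: "G (p - q) = G p - G q" for p q
    by (rule linear_on_diff[OF G_lin]) auto
  have G_single: "G (Poly_Mapping.single xs 1) = f' xs" for xs
    by (simp add: G_def scaleC_one)
  have f'_add: "f' (xs @ (a + b) # ys) = f' (xs @ a # ys) + f' (xs @ b # ys)" for xs a b ys
    using multilinear_add[OF assms] by (simp add: f'_def)
  have f'_scale: "f' (xs @ (c *\<^sub>C a) # ys) = c *\<^sub>C f' (xs @ a # ys)" for xs a c ys
    using multilinear_scale[OF assms] by (simp add: f'_def)
  have rel: "G r = 0" if "r \<in> cspan multilinear_relations" for r
  proof -
    have "G r \<in> {0}"
    proof (rule span_linear_induct[OF that G_lin])
      fix y :: "'a list \<Rightarrow>\<^sub>0 complex" assume "y \<in> multilinear_relations"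
      then show "G y \<in> {0}"
        unfolding multilinear_relations_def
        by (auto simp: G_diff G_scale G_single f'_add f'_scale)
    qed simp
    then show ?thesis by simp
  qed
  define g where "g t = G (rep_tensor t)" for t
  have abs: "g (abs_tensor p) = G p" for p
  proof -
    have "tensor_rel (rep_tensor (abs_tensor p)) p"
      using Quotient3_rep_abs[OF Quotient3_tensor] by (simp add: tensor_rel_def complex_vector.span_zero)
    then show ?thesis using rel[of "rep_tensor (abs_tensor p) - p"]
      by (simp add: tensor_rel_def G_diff g_def)
  qed
  have "g (s + t) = g s + g t" for s t
    by (induct s, induct t) (simp add: plus_tensor.abs_eq abs G_add)
  moreover have "g (c *\<^sub>C t) = c *\<^sub>C g t" for c t
    by (induct t) (simp add: scaleC_tensor.abs_eq abs G_scale)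
  moreover have "g (pure xs) = f xs" if "length xs = n" for xs
    using that by (simp add: pure.abs_eq abs G_single f'_def)
  ultimately show ?thesis by (auto simp: linear_on_def)
qed

text \<open>The description in \<open>tlift_def\<close> has a solution, namely the map from the
  universal property cut off outside \<open>tpow n\<close>. It has only one, since elementary
  tensors span \<open>tpow n\<close> and the values elsewhere are prescribed.\<close>

lemma tlift:
  fixes f :: "'a::complex_vector list \<Rightarrow> 'b::complex_vector"
  assumes "multilinear n f"
  shows linear_on_tlift: "linear_on (tpow n) (tlift n f)"
    and tlift_pure: "length xs = n \<Longrightarrow> tlift n f (pure xs) = f xs"
    and tlift_outside: "t \<notin> tpow n \<Longrightarrow> tlift n f t = 0"
proof -
  let ?P = "\<lambda>g. linear_on (tpow n) g \<and> (\<forall>xs. length xs = n \<longrightarrow> g (pure xs) = f xs) \<and>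
                       (\<forall>t. t \<notin> tpow n \<longrightarrow> g t = 0)"
  from multilinear_linear_ex[OF assms] obtain g where
    g: "linear_on UNIV g" "\<And>xs. length xs = n \<Longrightarrow> g (pure xs) = f xs" by blast
  define h where "h t = (if t \<in> tpow n then g t else 0)" for t
  have h: "?P h" using g by (auto simp: h_def linear_on_def)
  have "?P (tlift n f)" unfolding tlift_def
  proof (rule theI[of ?P, OF h])
    fix k assume k: "?P k"
    have "k t = h t" for t
    proof (cases "t \<in> tpow n")
      case True
      then show ?thesis using linear_on_tpow_eq[of n k h t] h k by simp
    qed (use h k in simp)
    then show "k = h" by auto
  qed
  then show "linear_on (tpow n) (tlift n f)" "length xs = n \<Longrightarrow> tlift n f (pure xs) = f xs"
    "t \<notin> tpow n \<Longrightarrow> tlift n f t = 0" by auto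
qed

lemma tlift_mem:
  assumes "multilinear n f" "csubspace W" "\<And>xs. length xs = n \<Longrightarrow> f xs \<in> W"
  shows "tlift n f t \<in> W"
proof (cases "t \<in> tpow n")
  case True
  then show ?thesis
    by (rule linear_on_tpow_mem[OF linear_on_tlift[OF assms(1)] assms(2), rotated])
      (simp add: tlift_pure[OF assms(1)] assms(3))
qed (simp add: tlift_outside[OF assms(1)] complex_vector.subspace_0 assms(2))

lemma tlift_cong:
  assumes "\<And>xs. length xs = n \<Longrightarrow> f xs = g xs"
  shows "tlift n f = tlift n g"
proof -
  have "(\<forall>xs. length xs = n \<longrightarrow> h (pure xs) = f xs) = (\<forall>xs. length xs = n \<longrightarrow> h (pure xs) = g xs)"
    for h :: "'a tensor \<Rightarrow> 'b"
    using assms by simp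
  then show ?thesis by (simp only: tlift_def)
qed

lemma multilinear_linear:
  assumes "linear_on (tpow n) f"
  shows "multilinear n (\<lambda>xs. f (pure xs))"
  using assms by (auto simp: multilinear_def pure_add pure_scale linear_on_def)

definition bilinear_on ::
  "'a::complex_vector set \<Rightarrow> 'b::complex_vector set \<Rightarrow> ('a \<Rightarrow> 'b \<Rightarrow> 'c::complex_vector) \<Rightarrow> bool" where
  "bilinear_on V W B \<longleftrightarrow> (\<forall>y\<in>W. linear_on V (\<lambda>x. B x y)) \<and> (\<forall>x\<in>V. linear_on W (B x))"

lemma bilinear_on_left: "bilinear_on V W B \<Longrightarrow> y \<in> W \<Longrightarrow> linear_on V (\<lambda>x. B x y)"
  and bilinear_on_right: "bilinear_on V W B \<Longrightarrow> x \<in> V \<Longrightarrow> linear_on W (B x)"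
  by (auto simp: bilinear_on_def)

lemma bilinear_onD:
  assumes "bilinear_on V W B"
  shows "x \<in> V \<Longrightarrow> x' \<in> V \<Longrightarrow> y \<in> W \<Longrightarrow> B (x + x') y = B x y + B x' y"
    and "x \<in> V \<Longrightarrow> y \<in> W \<Longrightarrow> y' \<in> W \<Longrightarrow> B x (y + y') = B x y + B x y'"
    and "x \<in> V \<Longrightarrow> y \<in> W \<Longrightarrow> B (c *\<^sub>C x) y = c *\<^sub>C B x y"
    and "x \<in> V \<Longrightarrow> y \<in> W \<Longrightarrow> B x (c *\<^sub>C y) = c *\<^sub>C B x y"
  using assms by (auto simp: bilinear_on_def linear_on_def)

text \<open>The varied entry lies either among the first m entries or behind them, and only one
  argument of B depends on it. This gives multilinearity of every expression that treats an initial
  and a final segment of a list separately.\<close>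

lemma multilinear_split:
  fixes f :: "'a::complex_vector list \<Rightarrow> 'b::complex_vector" and g :: "'a list \<Rightarrow> 'c::complex_vector"
    and B :: "'b \<Rightarrow> 'c \<Rightarrow> 'd::complex_vector"
  assumes B: "bilinear_on V W B" and f: "multilinear m f" and g: "multilinear n g"
    and fV: "\<And>xs. length xs = m \<Longrightarrow> f xs \<in> V" and gW: "\<And>ys. length ys = n \<Longrightarrow> g ys \<in> W"
  shows "multilinear (m + n) (\<lambda>zs. B (f (take m zs)) (g (drop m zs)))"
proof (rule multilinearI)
  fix xs ys :: "'a list" and a b c
  assume len: "Suc (length xs + length ys) = m + n"
  show "B (f (take m (xs @ (a + b) # ys))) (g (drop m (xs @ (a + b) # ys))) =
    B (f (take m (xs @ a # ys))) (g (drop m (xs @ a # ys))) + B (f (take m (xs @ b # ys))) (g (drop m (xs @ b # ys)))"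
  proof (cases "length xs < m")
    case True
    then obtain k where "m = Suc (length xs + k)" by (metis less_imp_Suc_add)
    then show ?thesis using len
      by (simp add: take_Cons' drop_Cons' multilinear_add[OF f] bilinear_onD[OF B] fV gW)
  next
    case False
    then obtain k where "length xs = m + k" by (metis le_iff_add not_le)
    then show ?thesis using len
      by (simp add: take_Cons' drop_Cons' multilinear_add[OF g] bilinear_onD[OF B] fV gW)
  qed
  show "B (f (take m (xs @ (c *\<^sub>C a) # ys))) (g (drop m (xs @ (c *\<^sub>C a) # ys))) =
    c *\<^sub>C B (f (take m (xs @ a # ys))) (g (drop m (xs @ a # ys)))"
  proof (cases "length xs < m")
    case True
    then obtain k where "m = Suc (length xs + k)" by (metis less_imp_Suc_add)
    then show ?thesis using len
      by (simp add: take_Cons' drop_Cons' multilinear_scale[OF f] bilinear_onD[OF B] fV gW)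
  next
    case False
    then obtain k where "length xs = m + k" by (metis le_iff_add not_le)
    then show ?thesis using len
      by (simp add: take_Cons' drop_Cons' multilinear_scale[OF g] bilinear_onD[OF B] fV gW)
  qed
qed

text \<open>For nested lifts the inner lift at a fixed tensor t has to be multilinear in the outer
  list. This is clear for elementary t and passes to linear combinations.\<close>

lemma tlift2:
  fixes f :: "'a::complex_vector list \<Rightarrow> 'b::complex_vector list \<Rightarrow> 'c::complex_vector"
  assumes l: "\<And>ys. length ys = n \<Longrightarrow> multilinear m (\<lambda>xs. f xs ys)"
    and r: "\<And>xs. length xs = m \<Longrightarrow> multilinear n (f xs)"
  defines "B \<equiv> \<lambda>s t. tlift m (\<lambda>xs. tlift n (f xs) t) s"
  shows bilinear_on_tlift2: "bilinear_on (tpow m) (tpow n) B"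
    and tlift2_pure: "length xs = m \<Longrightarrow> length ys = n \<Longrightarrow> B (pure xs) (pure ys) = f xs ys"
proof -
  have ml: "multilinear m (\<lambda>xs. tlift n (f xs) t)" if "t \<in> tpow n" for t
    using that
  proof (induction rule: tpow_induct)
    case (pure ys)
    then show ?case using l[OF pure] by (auto simp: multilinear_def tlift_pure[OF r])
  next
    case zero
    then show ?case by (auto simp: multilinear_def linear_on_zero[OF linear_on_tlift[OF r]])
  next
    case (add s t)
    then show ?case by (auto simp: multilinear_def linear_on_add[OF linear_on_tlift[OF r]] scaleC_add_right)
  next
    case (scale c s)
    then show ?case by (auto simp: multilinear_def linear_on_scale[OF linear_on_tlift[OF r]]
          scaleC_add_right scaleC_scaleC mult.commute)
  qed
  have left: "linear_on (tpow m) (\<lambda>s. B s t)" if "t \<in> tpow n" for t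
    unfolding B_def by (rule linear_on_tlift[OF ml[OF that]])
  have B_pure: "B (pure xs) t = tlift n (f xs) t" if "length xs = m" "t \<in> tpow n" for xs t
    unfolding B_def by (rule tlift_pure[OF ml[OF that(2)] that(1)])
  have right: "linear_on (tpow n) (B s)" if "s \<in> tpow m" for s
    using that
  proof (induction rule: tpow_induct)
    case (pure xs)
    then show ?case using linear_on_tlift[OF r[OF pure]] by (auto simp: linear_on_def B_pure)
  next
    case zero
    then show ?case by (auto simp: linear_on_def linear_on_zero[OF left])
  next
    case (add s s')
    then show ?case by (auto simp: linear_on_def linear_on_add[OF left] scaleC_add_right)
  next
    case (scale c s)
    then show ?case by (auto simp: linear_on_def linear_on_scale[OF left] scaleC_add_right scaleC_scaleC mult.commute)
  qed
  show "bilinear_on (tpow m) (tpow n) B" using left right by (simp add: bilinear_on_def)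
  show "length xs = m \<Longrightarrow> length ys = n \<Longrightarrow> B (pure xs) (pure ys) = f xs ys"
    by (simp add: B_pure tlift_pure[OF r])
qed

lemma bilinear_on_tpow_mem:
  assumes B: "bilinear_on (tpow m) (tpow n) B" and W: "csubspace W"
    and p: "\<And>xs ys. length xs = m \<Longrightarrow> length ys = n \<Longrightarrow> B (pure xs) (pure ys) \<in> W"
    and s: "s \<in> tpow m" and t: "t \<in> tpow n"
  shows "B s t \<in> W"
proof (rule linear_on_tpow_mem[OF bilinear_on_left[OF B t] W _ s])
  fix xs :: "'a list" assume "length xs = m"
  then show "B (pure xs) t \<in> W"
    by (intro linear_on_tpow_mem[OF bilinear_on_right[OF B] W _ t] p) auto
qed

lemma bilinear_on_tpow_eq:
  assumes B: "bilinear_on (tpow m) (tpow n) B" and C: "bilinear_on (tpow m) (tpow n) C"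
    and p: "\<And>xs ys. length xs = m \<Longrightarrow> length ys = n \<Longrightarrow> B (pure xs) (pure ys) = C (pure xs) (pure ys)"
    and s: "s \<in> tpow m" and t: "t \<in> tpow n"
  shows "B s t = C s t"
proof (rule linear_on_tpow_eq[OF bilinear_on_left[OF B t] bilinear_on_left[OF C t] _ s])
  fix xs :: "'a list" assume "length xs = m"
  then show "B (pure xs) t = C (pure xs) t"
    by (intro linear_on_tpow_eq[OF bilinear_on_right[OF B] bilinear_on_right[OF C] _ t] p) auto
qed

section \<open>Products and concatenation of tensors\<close>

lemma map2_split_left:
  fixes xs :: "'a::complex_algebra list"
  assumes "Suc (length xs + length ys) = length zs"
  shows "\<exists>us c vs. (\<forall>a. map2 (*) (xs @ a # ys) zs = us @ (a * c) # vs)"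
proof -
  from assms obtain us c vs where "zs = us @ c # vs" "length us = length xs"
    by (metis append_take_drop_id Cons_nth_drop_Suc length_take less_add_Suc1 min_absorb2 less_imp_le)
  then show ?thesis by (intro exI[of _ "map2 (*) xs us"] exI[of _ c] exI[of _ "map2 (*) ys vs"]) simp
qed

lemma map2_split_right:
  fixes xs :: "'a::complex_algebra list"
  assumes "Suc (length xs + length ys) = length zs"
  shows "\<exists>us c vs. (\<forall>a. map2 (*) zs (xs @ a # ys) = us @ (c * a) # vs)"
proof -
  from assms obtain us c vs where "zs = us @ c # vs" "length us = length xs"
    by (metis append_take_drop_id Cons_nth_drop_Suc length_take less_add_Suc1 min_absorb2 less_imp_le)
  then show ?thesis by (intro exI[of _ "map2 (*) us xs"] exI[of _ c] exI[of _ "map2 (*) vs ys"]) simp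
qed

lemma multilinear_map2:
  fixes zs :: "'a::complex_algebra list"
  assumes "length zs = n"
  shows "multilinear n (\<lambda>xs. pure (map2 (*) xs zs))" "multilinear n (\<lambda>xs. pure (map2 (*) zs xs))"
proof -
  show "multilinear n (\<lambda>xs. pure (map2 (*) xs zs))"
  proof (rule multilinearI)
    fix xs ys :: "'a list" and a b c
    assume "Suc (length xs + length ys) = n"
    with map2_split_left[of xs ys zs] assms obtain us d vs where
      *: "\<And>a. map2 (*) (xs @ a # ys) zs = us @ (a * d) # vs" by blast
    show "pure (map2 (*) (xs @ (a + b) # ys) zs) = pure (map2 (*) (xs @ a # ys) zs) + pure (map2 (*) (xs @ b # ys) zs)"
      by (simp only: * distrib_right pure_add)
    show "pure (map2 (*) (xs @ (c *\<^sub>C a) # ys) zs) = c *\<^sub>C pure (map2 (*) (xs @ a # ys) zs)"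
      by (simp only: * mult_scaleC_left pure_scale)
  qed
  show "multilinear n (\<lambda>xs. pure (map2 (*) zs xs))"
  proof (rule multilinearI)
    fix xs ys :: "'a list" and a b c
    assume "Suc (length xs + length ys) = n"
    with map2_split_right[of xs ys zs] assms obtain us d vs where
      *: "\<And>a. map2 (*) zs (xs @ a # ys) = us @ (d * a) # vs" by blast
    show "pure (map2 (*) zs (xs @ (a + b) # ys)) = pure (map2 (*) zs (xs @ a # ys)) + pure (map2 (*) zs (xs @ b # ys))"
      by (simp only: * distrib_left pure_add)
    show "pure (map2 (*) zs (xs @ (c *\<^sub>C a) # ys)) = c *\<^sub>C pure (map2 (*) zs (xs @ a # ys))"
      by (simp only: * mult_scaleC_right pure_scale)
  qed
qed

lemma bilinear_tmult: "bilinear_on (tpow n) (tpow n) (tmult n)"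
  and tmult_pure [simp]: "length xs = n \<Longrightarrow> length ys = n \<Longrightarrow> tmult n (pure xs) (pure ys) = pure (map2 (*) xs ys)"
  unfolding tmult_def[abs_def]
  by (rule bilinear_on_tlift2 tlift2_pure; simp add: multilinear_map2)+

lemma multilinear_append:
  "multilinear n (\<lambda>xs. pure (zs @ xs))" "multilinear n (\<lambda>xs. pure (xs @ zs))"
  using pure_add[of "zs @ _"] pure_scale[of "zs @ _"]
  by (auto simp: multilinear_def pure_add pure_scale)

lemma bilinear_tconcat: "bilinear_on (tpow m) (tpow n) (tconcat m n)"
  and tconcat_pure [simp]: "length xs = m \<Longrightarrow> length ys = n \<Longrightarrow> tconcat m n (pure xs) (pure ys) = pure (xs @ ys)"
  unfolding tconcat_def[abs_def]
  by (rule bilinear_on_tlift2 tlift2_pure; simp add: multilinear_append)+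

lemma tmult_tpow [simp]: "s \<in> tpow n \<Longrightarrow> t \<in> tpow n \<Longrightarrow> tmult n s t \<in> tpow n"
  by (rule bilinear_on_tpow_mem[OF bilinear_tmult]) auto

lemma tconcat_tpow [simp]: "s \<in> tpow m \<Longrightarrow> t \<in> tpow n \<Longrightarrow> tconcat m n s t \<in> tpow (m + n)"
  by (rule bilinear_on_tpow_mem[OF bilinear_tconcat]) auto

lemmas tmult_linear = bilinear_onD[OF bilinear_tmult]
lemmas tconcat_linear = bilinear_onD[OF bilinear_tconcat]

text \<open>Multipliers must vanish outside \<open>tpow n\<close>, and this provides that property
  for \<open>membed\<close>. The two cases differ: for s outside it is the outer lift that vanishes,
  for t outside the inner one, for every list.\<close>

lemma tmult_outside: "s \<notin> tpow n \<Longrightarrow> t \<in> tpow n \<Longrightarrow> tmult n s t = 0"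
  "t \<notin> tpow n \<Longrightarrow> s \<in> tpow n \<Longrightarrow> tmult n s t = 0"
proof -
  assume "s \<notin> tpow n" "t \<in> tpow n"
  have "multilinear n (\<lambda>xs. tlift n (\<lambda>ys. pure (map2 (*) xs ys)) t)"
  proof -
    have "multilinear n (\<lambda>xs. tmult n (pure xs) t)"
      by (rule multilinear_linear[OF bilinear_on_left[OF bilinear_tmult \<open>t \<in> tpow n\<close>]])
    moreover have "tmult n (pure xs) t = tlift n (\<lambda>ys. pure (map2 (*) xs ys)) t" if "length xs = n" for xs
      by (rule linear_on_tpow_eq[OF bilinear_on_right[OF bilinear_tmult] linear_on_tlift _ \<open>t \<in> tpow n\<close>])
         (use that in \<open>auto simp: multilinear_map2 tlift_pure[OF multilinear_map2(2)]\<close>)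
    ultimately show ?thesis by (simp add: multilinear_def)
  qed
  from tlift_outside[OF this \<open>s \<notin> tpow n\<close>] show "tmult n s t = 0" by (simp add: tmult_def)
next
  assume t: "t \<notin> tpow n" and s: "s \<in> tpow n"
  have "tlift n (\<lambda>ys. pure (map2 (*) xs ys)) t = 0" if "length xs = n" for xs
    by (rule tlift_outside[OF multilinear_map2(2)[OF that] t])
  then have "tmult n s t = tlift n (\<lambda>_. 0) s"
    unfolding tmult_def by (simp cong: tlift_cong)
  also have "\<dots> = 0" 
    by (rule linear_on_tpow_eq[OF linear_on_tlift _ _ s])
      (auto simp: multilinear_def linear_on_def tlift_pure)
  finally show "tmult n s t = 0" .
qed

text \<open>Degrees such as \<open>1 + n\<close> have to stay as they are: they index \<^const>\<open>mtensor\<close> and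
  \<^const>\<open>tconcat\<close>.\<close>

declare One_nat_def [simp del] One_nat_def [symmetric, simp]

lemma tmult_zero [simp]: "t \<in> tpow n \<Longrightarrow> tmult n 0 t = 0" "s \<in> tpow n \<Longrightarrow> tmult n s 0 = 0"
  using linear_on_zero[OF bilinear_on_left[OF bilinear_tmult]]
    linear_on_zero[OF bilinear_on_right[OF bilinear_tmult]] by simp_all

lemma tconcat_zero [simp]: "t \<in> tpow n \<Longrightarrow> tconcat m n 0 t = 0" "s \<in> tpow m \<Longrightarrow> tconcat m n s 0 = 0"
  using linear_on_zero[OF bilinear_on_left[OF bilinear_tconcat]]
    linear_on_zero[OF bilinear_on_right[OF bilinear_tconcat]] by simp_all

lemma map2_assoc:
  "map2 (*) (map2 (*) xs ys) zs = map2 (*) xs (map2 (*) ys (zs :: 'a::complex_algebra list))"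
  by (rule nth_equalityI) (auto simp: mult.assoc)

lemma tmult_assoc:
  assumes "a \<in> tpow n" "b \<in> tpow n" "c \<in> tpow n"
  shows "tmult n (tmult n a b) c = tmult n a (tmult n b c)"
  using assms(1)
proof (induction rule: tpow_induct)
  case (pure xs)
  from assms(2) show ?case
  proof (induction rule: tpow_induct)
    case (pure ys)
    from assms(3) show ?case
      by (induction rule: tpow_induct)
        (use pure \<open>length xs = n\<close> in \<open>simp_all add: map2_assoc tmult_linear\<close>)
  qed (use pure assms in \<open>simp_all add: tmult_linear\<close>)
qed (use assms in \<open>simp_all add: tmult_linear\<close>)

lemma tconcat_assoc:
  assumes "a \<in> tpow m" "b \<in> tpow n" "c \<in> tpow k"
  shows "tconcat (m + n) k (tconcat m n a b) c = tconcat m (n + k) a (tconcat n k b c)"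
  using assms(1)
proof (induction rule: tpow_induct)
  case (pure xs)
  from assms(2) show ?case
  proof (induction rule: tpow_induct)
    case (pure ys)
    from assms(3) show ?case
      by (induction rule: tpow_induct)
        (use pure \<open>length xs = m\<close> in \<open>simp_all add: tconcat_linear\<close>)
  qed (use pure assms in \<open>simp_all add: tconcat_linear\<close>)
qed (use assms in \<open>simp_all add: tconcat_linear\<close>)

lemma tmult_tconcat:
  assumes "a \<in> tpow m" "b \<in> tpow n" "c \<in> tpow m" "d \<in> tpow n"
  shows "tmult (m + n) (tconcat m n a b) (tconcat m n c d) = tconcat m n (tmult m a c) (tmult n b d)"
  using assms(1)
proof (induction rule: tpow_induct)
  case (pure xs)
  from assms(2) show ?case
  proof (induction rule: tpow_induct)
    case (pure ys)
    from assms(3) show ?case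
    proof (induction rule: tpow_induct)
      case (pure us)
      from assms(4) show ?case
      by (induction rule: tpow_induct)
        (use pure \<open>length xs = m\<close> \<open>length ys = n\<close> in \<open>simp_all add: tconcat_linear tmult_linear\<close>)
    qed (use pure \<open>length xs = m\<close> assms in \<open>simp_all add: tconcat_linear tmult_linear\<close>)
  qed (use pure assms in \<open>simp_all add: tconcat_linear tmult_linear\<close>)
qed (use assms in \<open>simp_all add: tconcat_linear tmult_linear\<close>)

lemma tconcat_unit [simp]:
  assumes "t \<in> tpow n"
  shows "tconcat 0 n (pure []) t = t" "tconcat n 0 t (pure []) = t"
  using assms by (induction rule: tpow_induct) (simp_all add: tconcat_linear)

lemma tpow_split_induct [consumes 1, case_names tconcat zero add scale]:
  assumes "t \<in> tpow (m + n)"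
    and "\<And>xs ys. length xs = m \<Longrightarrow> length ys = n \<Longrightarrow> P (tconcat m n (pure xs) (pure ys))"
    and "P 0"
    and "\<And>s t. s \<in> tpow (m + n) \<Longrightarrow> t \<in> tpow (m + n) \<Longrightarrow> P s \<Longrightarrow> P t \<Longrightarrow> P (s + t)"
    and "\<And>c s. s \<in> tpow (m + n) \<Longrightarrow> P s \<Longrightarrow> P (c *\<^sub>C s)"
  shows "P t"
  using assms(1)
proof (induction rule: tpow_induct)
  case (pure zs)
  then show ?case using assms(2)[of "take m zs" "drop m zs"] by simp
qed (use assms in auto)

lemma tpow_0_cases:
  assumes "t \<in> tpow 0"
  obtains c where "t = c *\<^sub>C pure []"
proof -
  have "\<exists>c. t = c *\<^sub>C pure []" using assms
  proof (induction rule: tpow_induct)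
    case (pure xs)
    then show ?case by (auto intro!: exI[of _ 1] simp: scaleC_one)
  next
    case zero
    then show ?case by (auto intro!: exI[of _ 0])
  next
    case (add s t)
    then show ?case by (metis scaleC_add_left)
  next
    case (scale c s)
    then show ?case by (metis scaleC_scaleC)
  qed
  then show ?thesis using that by blast
qed

lemma tpow_1_cases:
  assumes "t \<in> tpow 1"
  obtains a where "t = pure [a]"
proof -
  have "\<exists>a. t = pure [a]" using assms
  proof (induction rule: tpow_induct)
    case (pure xs)
    then show ?case by (cases xs) auto
  next
    case zero
    have "pure [0 *\<^sub>C 0 :: 'a] = 0" by (simp only: pure_single_scale) simp
    then show ?case by (metis complex_vector.scale_zero_left)
  next
    case (add s t)
    then show ?case by (metis pure_single_add)
  next
    case (scale c s)
    then show ?case by (metis pure_single_scale)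
  qed
  then show ?thesis using that by blast
qed

lemma multilinear_hd: "multilinear 1 hd"
  by (rule multilinearI) auto

lemma tval_pure [simp]: "tval (pure [a]) = a"
  by (simp add: tval_def tlift_pure[OF multilinear_hd])

lemma pure_zero [simp]: "pure [0] = 0"
  using pure_single_scale[of 0 0] by simp

lemma pure_single_inject [simp]: "pure [a] = pure [b] \<longleftrightarrow> a = b"
  by (metis tval_pure)

section \<open>Nondegeneracy of the tensor powers\<close>

lemma functional_ex:
  fixes x :: "'a::complex_vector"
  assumes "x \<noteq> 0"
  obtains f :: "'a \<Rightarrow> complex" where "linear_on UNIV f" "f x = 1"
proof -
  interpret vector_space_pair "scaleC :: complex \<Rightarrow> 'a \<Rightarrow> 'a" "scaleC :: complex \<Rightarrow> complex \<Rightarrow> complex" ..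
  have "complex_vector.independent {x}" using assms by simp
  from linear_independent_extend[OF this, of "\<lambda>_. 1"]
  obtain f where "Vector_Spaces.linear scaleC scaleC f" "f x = (1::complex)" by auto
  then have "linear_on UNIV f" by (simp add: linear_on_def linear_add linear_scale)
  then show thesis using that \<open>f x = 1\<close> by blast
qed

lemma multilinear_functional_slice:
  assumes "linear_on UNIV (f :: 'a::complex_vector \<Rightarrow> complex)"
  shows "multilinear (1 + n) (\<lambda>zs. f (hd zs) *\<^sub>C pure (tl zs))"
proof (rule multilinearI)
  fix xs ys :: "'a list" and a b c
  show "f (hd (xs @ (a + b) # ys)) *\<^sub>C pure (tl (xs @ (a + b) # ys)) =
     f (hd (xs @ a # ys)) *\<^sub>C pure (tl (xs @ a # ys)) + f (hd (xs @ b # ys)) *\<^sub>C pure (tl (xs @ b # ys))"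
    by (cases xs) (simp_all add: pure_add scaleC_add_right scaleC_add_left linear_on_add[OF assms])
  show "f (hd (xs @ (c *\<^sub>C a) # ys)) *\<^sub>C pure (tl (xs @ (c *\<^sub>C a) # ys)) =
     c *\<^sub>C f (hd (xs @ a # ys)) *\<^sub>C pure (tl (xs @ a # ys))"
    by (cases xs) (simp_all add: pure_scale scaleC_scaleC mult.commute linear_on_scale[OF assms]
        scaleC_complex_def)
qed

text \<open>The map f \<otimes> id on 1 + n factors, with the scalar value of f absorbed into the
  remaining tensor.\<close>

definition slice :: "nat \<Rightarrow> ('a::complex_vector \<Rightarrow> complex) \<Rightarrow> 'a tensor \<Rightarrow> 'a tensor" where
  "slice n f = tlift (1 + n) (\<lambda>zs. f (hd zs) *\<^sub>C pure (tl zs))"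

lemma linear_on_slice: "linear_on UNIV f \<Longrightarrow> linear_on (tpow (1 + n)) (slice n f)"
  unfolding slice_def by (rule linear_on_tlift[OF multilinear_functional_slice])

lemma slice_tconcat:
  assumes "linear_on UNIV f" "t \<in> tpow n"
  shows "slice n f (tconcat 1 n (pure [a]) t) = f a *\<^sub>C t"
  using assms(2)
proof (induction rule: tpow_induct)
  case (pure xs)
  then show ?case by (simp add: slice_def tlift_pure[OF multilinear_functional_slice[OF assms(1)]])
next
  case zero
  show ?case using linear_on_zero[OF linear_on_slice[OF assms(1)]] by simp
next
  case (add s t)
  moreover have "tconcat 1 n (pure [a]) u \<in> tpow (1 + n)" if "u \<in> tpow n" for u
    using tconcat_tpow[of "pure [a]" 1 u n] that by simp
  ultimately show ?case
    using linear_on_add[OF linear_on_slice[OF assms(1)]] by (simp add: tconcat_linear scaleC_add_right)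
next
  case (scale c s)
  moreover have "tconcat 1 n (pure [a]) u \<in> tpow (1 + n)" if "u \<in> tpow n" for u
    using tconcat_tpow[of "pure [a]" 1 u n] that by simp
  ultimately show ?case
    using linear_on_scale[OF linear_on_slice[OF assms(1)]]
    by (simp add: tconcat_linear scaleC_scaleC mult.commute)
qed

text \<open>Expanding the last n factors in a basis B brings every tensor into the form of a sum of
  x_b \<otimes> b with x_b in H. Independence of the b will allow the coefficients to be examined
  one at a time.\<close>

lemma tpow_Suc_representation:
  assumes "complex_vector.independent B" "tpow n \<subseteq> cspan B" "B \<subseteq> tpow n" "t \<in> tpow (1 + n)"
  obtains F and x :: "'a::complex_algebra tensor \<Rightarrow> 'a"
  where "finite F" "F \<subseteq> B" "t = (\<Sum>b\<in>F. tconcat 1 n (pure [x b]) b)"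
proof -
  have B_tpow [simp]: "b \<in> tpow n" if "b \<in> B" for b using that assms(3) by blast
  have "\<exists>F x. finite F \<and> F \<subseteq> B \<and> t = (\<Sum>b\<in>F. tconcat 1 n (pure [x b :: 'a]) b)"
    using assms(4)
  proof (induction rule: tpow_induct)
    case (pure zs)
    then obtain a xs where zs: "zs = a # xs" "length xs = n" by (cases zs) auto
    then have "pure xs \<in> cspan B" using assms(2) by (meson pure_tpow subsetD)
    then obtain F r where F: "finite F" "F \<subseteq> B" "pure xs = (\<Sum>b\<in>F. r b *\<^sub>C b)"
      unfolding complex_vector.span_explicit by blast
    have "pure zs = tconcat 1 n (pure [a]) (pure xs)" using zs by simp
    also have "\<dots> = (\<Sum>b\<in>F. tconcat 1 n (pure [a]) (r b *\<^sub>C b))" unfolding F(3)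
      by (rule linear_on_sum[OF bilinear_on_right[OF bilinear_tconcat]]) (use F in auto)
    also have "\<dots> = (\<Sum>b\<in>F. tconcat 1 n (pure [r b *\<^sub>C a]) b)"
      by (rule sum.cong) (use F in \<open>auto simp: tconcat_linear pure_single_scale subset_iff\<close>)
    finally show ?case using F(1,2) by (intro exI[of _ F] exI[of _ "\<lambda>b. r b *\<^sub>C a"]) simp
  next
    case zero
    show ?case by (rule exI[of _ "{}"]) simp
  next
    case (add s t)
    then obtain F x G y where F: "finite F" "F \<subseteq> B" "s = (\<Sum>b\<in>F. tconcat 1 n (pure [x b]) b)"
      and G: "finite G" "G \<subseteq> B" "t = (\<Sum>b\<in>G. tconcat 1 n (pure [y b]) b)" by blast
    \<comment> \<open>Both representations are extended by zero coefficients to the union of their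
      index sets.\<close>
    define x' where "x' b = (if b \<in> F then x b else 0)" for b
    define y' where "y' b = (if b \<in> G then y b else 0)" for b
    have "s = (\<Sum>b\<in>F \<union> G. tconcat 1 n (pure [x' b]) b)" unfolding F(3)
      by (rule sum.mono_neutral_cong_left) (use F G in \<open>auto simp: x'_def\<close>)
    moreover have "t = (\<Sum>b\<in>F \<union> G. tconcat 1 n (pure [y' b]) b)" unfolding G(3)
      by (rule sum.mono_neutral_cong_left) (use F G in \<open>auto simp: y'_def\<close>)
    ultimately have "s + t = (\<Sum>b\<in>F \<union> G. tconcat 1 n (pure [x' b + y' b]) b)"
      using F G by (simp add: sum.distrib[symmetric] pure_single_add)
        (rule sum.cong, auto simp: tconcat_linear)
    then show ?case using F G by (intro exI[of _ "F \<union> G"] exI[of _ "\<lambda>b. x' b + y' b"]) auto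
  next
    case (scale c s)
    then obtain F x where F: "finite F" "F \<subseteq> B" "s = (\<Sum>b\<in>F. tconcat 1 n (pure [x b]) b)" by blast
    then have "c *\<^sub>C s = (\<Sum>b\<in>F. tconcat 1 n (pure [c *\<^sub>C x b]) b)"
      by (auto simp: complex_vector.scale_sum_right pure_single_scale tconcat_linear subset_iff
          intro!: sum.cong)
    then show ?case using F by (intro exI[of _ F] exI[of _ "\<lambda>b. c *\<^sub>C x b"]) simp
  qed
  then show thesis using that by blast
qed

lemma zero_if_functionals_zero:
  assumes "\<And>f. linear_on UNIV f \<Longrightarrow> f (x :: 'a::complex_vector) = (0::complex)"
  shows "x = 0"
  by (metis assms functional_ex one_neq_zero)

locale nondegenerate_algebra =
  fixes ty :: "'a::complex_algebra itself"
  assumes nondegenerate: "nondegenerate ty"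
begin

lemma nondegenerate_left: "(\<And>b. (a :: 'a) * b = 0) \<Longrightarrow> a = 0"
  and nondegenerate_right: "(\<And>b. b * (a :: 'a) = 0) \<Longrightarrow> a = 0"
  by (rule nondegenerate[unfolded nondegenerate_def, THEN conjunct1, rule_format], blast)
    (rule nondegenerate[unfolded nondegenerate_def, THEN conjunct2, rule_format], blast)

text \<open>Induction on n. Write t as a sum of x_b \<otimes> b over independent b. If t (c
  \<otimes> y) = 0 for all y, a functional f on the first factor gives (sum of f(x_b c) b) y = 0.
  The induction hypothesis and independence yield f(x_b c) = 0 for all f and c, and nondegeneracy of
  H yields x_b = 0.\<close>

lemma tpow_nondegenerate:
  assumes "t \<in> tpow n"
  shows tpow_nondegenerate_left:
      "(\<And>xs. length xs = n \<Longrightarrow> tmult n t (pure (xs :: 'a list)) = 0) \<Longrightarrow> t = 0"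
    and tpow_nondegenerate_right:
      "(\<And>xs. length xs = n \<Longrightarrow> tmult n (pure (xs :: 'a list)) t = 0) \<Longrightarrow> t = 0"
proof -
  have "((\<forall>xs. length xs = n \<longrightarrow> tmult n t (pure (xs :: 'a list)) = 0) \<longrightarrow> t = 0) \<and>
     ((\<forall>xs. length xs = n \<longrightarrow> tmult n (pure (xs :: 'a list)) t = 0) \<longrightarrow> t = 0)"
    using assms
  proof (induction n arbitrary: t)
    case 0
    then obtain c where "t = c *\<^sub>C pure []" by (elim tpow_0_cases)
    then show ?case by (auto simp: tmult_linear)
  next
    case (Suc n)
    note Suc_eq = Suc_eq_plus1_left[of n]
    obtain B where B: "complex_vector.independent B" "tpow n \<subseteq> cspan B" "B \<subseteq> (tpow n :: 'a tensor set)"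
      using complex_vector.maximal_independent_subset[of "tpow n :: 'a tensor set"] by metis
    obtain F and x :: "'a tensor \<Rightarrow> 'a" where F: "finite F" "F \<subseteq> B"
      and t: "t = (\<Sum>b\<in>F. tconcat 1 n (pure [x b]) b)"
      using tpow_Suc_representation[OF B Suc.prems[unfolded Suc_eq]] by blast
    have b [simp]: "b \<in> tpow n" if "b \<in> F" for b using that F B by blast
    have indep: "r b = 0" if "(\<Sum>b\<in>F. r b *\<^sub>C b) = 0" "b \<in> F" for r b
      using complex_vector.independentD[OF B(1) F that] .
    have pure_Cons: "pure (c # xs) = tconcat 1 n (pure [c]) (pure xs)" if "length xs = n" for c :: 'a and xs
      using that by simp
    have "x b = 0" if z: "\<And>xs. length xs = 1 + n \<Longrightarrow> tmult (1 + n) t (pure (xs :: 'a list)) = 0"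
      and "b \<in> F" for b
    proof (rule nondegenerate_left, rule zero_if_functionals_zero)
      fix c f assume f: "linear_on UNIV (f :: 'a \<Rightarrow> complex)"
      have "(\<Sum>b\<in>F. f (x b * c) *\<^sub>C b) = 0"
      proof (rule Suc.IH[THEN conjunct1, rule_format])
        fix xs :: "'a list" assume xs: "length xs = n"
        have "0 = slice n f (tmult (1 + n) t (pure (c # xs)))"
          using z xs linear_on_zero[OF linear_on_slice[OF f]] by simp
        also have "tmult (1 + n) t (pure (c # xs)) = 
            (\<Sum>b\<in>F. tmult (1 + n) (tconcat 1 n (pure [x b]) b) (tconcat 1 n (pure [c]) (pure xs)))"
          unfolding t pure_Cons[OF xs]
          by (rule linear_on_sum[OF bilinear_on_left[OF bilinear_tmult, of _ "1 + n"]])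
            (use xs tconcat_tpow[of "pure [_]" 1 _ n] in simp_all)
        also have "\<dots> = (\<Sum>b\<in>F. tconcat 1 n (pure [x b * c]) (tmult n b (pure xs)))"
          by (rule sum.cong) (use xs in \<open>simp_all only: tmult_tconcat b pure_tpow list.size One_nat_def, simp\<close>)
        also have "slice n f \<dots> = (\<Sum>b\<in>F. f (x b * c) *\<^sub>C tmult n b (pure xs))"
          using xs tconcat_tpow[of "pure [_]" 1 _ n]
          by (subst linear_on_sum[OF linear_on_slice[OF f]]) (auto simp: slice_tconcat[OF f])
        also have "\<dots> = tmult n (\<Sum>b\<in>F. f (x b * c) *\<^sub>C b) (pure xs)"
          using xs by (subst linear_on_sum[OF bilinear_on_left[OF bilinear_tmult]]) (auto simp: tmult_linear)
        finally show "tmult n (\<Sum>b\<in>F. f (x b * c) *\<^sub>C b) (pure xs) = 0" ..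
      qed simp
      from indep[OF this \<open>b \<in> F\<close>] show "f (x b * c) = 0" .
    qed
    moreover have "x b = 0" if z: "\<And>xs. length xs = 1 + n \<Longrightarrow> tmult (1 + n) (pure (xs :: 'a list)) t = 0"
      and "b \<in> F" for b
    proof (rule nondegenerate_right, rule zero_if_functionals_zero)
      fix c f assume f: "linear_on UNIV (f :: 'a \<Rightarrow> complex)"
      have "(\<Sum>b\<in>F. f (c * x b) *\<^sub>C b) = 0"
      proof (rule Suc.IH[THEN conjunct2, rule_format])
        fix xs :: "'a list" assume xs: "length xs = n"
        have "0 = slice n f (tmult (1 + n) (pure (c # xs)) t)"
          using z xs linear_on_zero[OF linear_on_slice[OF f]] by simp
        also have "tmult (1 + n) (pure (c # xs)) t =
            (\<Sum>b\<in>F. tmult (1 + n) (tconcat 1 n (pure [c]) (pure xs)) (tconcat 1 n (pure [x b]) b))"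
          unfolding t pure_Cons[OF xs]
          by (rule linear_on_sum[OF bilinear_on_right[OF bilinear_tmult, of _ "1 + n"]])
            (use xs tconcat_tpow[of "pure [_]" 1 _ n] in simp_all)
        also have "\<dots> = (\<Sum>b\<in>F. tconcat 1 n (pure [c * x b]) (tmult n (pure xs) b))"
          by (rule sum.cong) (use xs in \<open>simp_all only: tmult_tconcat b pure_tpow list.size One_nat_def, simp\<close>)
        also have "slice n f \<dots> = (\<Sum>b\<in>F. f (c * x b) *\<^sub>C tmult n (pure xs) b)"
          using xs tconcat_tpow[of "pure [_]" 1 _ n]
          by (subst linear_on_sum[OF linear_on_slice[OF f]]) (auto simp: slice_tconcat[OF f])
        also have "\<dots> = tmult n (pure xs) (\<Sum>b\<in>F. f (c * x b) *\<^sub>C b)"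
          using xs by (subst linear_on_sum[OF bilinear_on_right[OF bilinear_tmult]]) (auto simp: tmult_linear)
        finally show "tmult n (pure xs) (\<Sum>b\<in>F. f (c * x b) *\<^sub>C b) = 0" ..
      qed simp
      from indep[OF this \<open>b \<in> F\<close>] show "f (c * x b) = 0" .
    qed
    moreover have "t = 0" if "\<And>b. b \<in> F \<Longrightarrow> x b = 0" using that by (simp add: t)
    ultimately show ?case unfolding Suc_eq by meson
  qed
  note * = this
  show "t = 0" if "\<And>xs. length xs = n \<Longrightarrow> tmult n t (pure (xs :: 'a list)) = 0"
    by (rule conjunct1[OF *, THEN mp]) (simp add: that)
  show "t = 0" if "\<And>xs. length xs = n \<Longrightarrow> tmult n (pure (xs :: 'a list)) t = 0"
    by (rule conjunct2[OF *, THEN mp]) (simp add: that)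
qed

end

section \<open>Multipliers of tensor powers\<close>

lemma tmult_diff:
  assumes "s \<in> tpow n" "t \<in> tpow n" "u \<in> tpow n"
  shows "tmult n (s - t) u = tmult n s u - tmult n t u" "tmult n u (s - t) = tmult n u s - tmult n u t"
  using assms linear_on_diff[OF bilinear_on_left[OF bilinear_tmult]]
    linear_on_diff[OF bilinear_on_right[OF bilinear_tmult]] by simp_all

lemma mmult_assoc: "mmult (mmult x y) z = mmult x (mmult y z)"
  by (simp add: mmult_def comp_assoc)

lemma fst_mmult: "fst (mmult x y) t = fst x (fst y t)"
  and snd_mmult: "snd (mmult x y) t = snd y (snd x t)"
  by (simp_all add: mmult_def)

lemma fst_plus_apply [simp]: "fst (x + y) t = fst x t + fst y t"
  "snd (x + y) u = snd x u + snd y u"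
  for x y :: "('a \<Rightarrow> 'b::ab_group_add) \<times> ('c \<Rightarrow> 'd::ab_group_add)"
  by (simp_all add: plus_fun_def)

lemma fst_scaleC_apply [simp]: "fst (c *\<^sub>C x) t = c *\<^sub>C fst x t" "snd (c *\<^sub>C x) u = c *\<^sub>C snd x u"
  for x :: "('a \<Rightarrow> 'b::complex_vector) \<times> ('c \<Rightarrow> 'd::complex_vector)"
  by (simp_all add: scaleC_prod_def scaleC_fun_def)

lemma fst_zero_apply [simp]: "fst (0 :: ('a \<Rightarrow> 'b::ab_group_add) \<times> ('c \<Rightarrow> 'd::ab_group_add)) t = 0"
  "snd (0 :: ('a \<Rightarrow> 'b::ab_group_add) \<times> ('c \<Rightarrow> 'd::ab_group_add)) u = 0"
  by (simp_all add: zero_fun_def)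

lemma multipliersI:
  assumes "linear_on (tpow n) (fst x)" "\<And>t. t \<in> tpow n \<Longrightarrow> fst x t \<in> tpow n" "\<And>t. t \<notin> tpow n \<Longrightarrow> fst x t = 0"
    and "linear_on (tpow n) (snd x)" "\<And>t. t \<in> tpow n \<Longrightarrow> snd x t \<in> tpow n" "\<And>t. t \<notin> tpow n \<Longrightarrow> snd x t = 0"
    and "\<And>a b. a \<in> tpow n \<Longrightarrow> b \<in> tpow n \<Longrightarrow> fst x (tmult n a b) = tmult n (fst x a) b"
    and "\<And>a b. a \<in> tpow n \<Longrightarrow> b \<in> tpow n \<Longrightarrow> snd x (tmult n a b) = tmult n a (snd x b)"
    and "\<And>a b. a \<in> tpow n \<Longrightarrow> b \<in> tpow n \<Longrightarrow> tmult n a (fst x b) = tmult n (snd x a) b"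
  shows "x \<in> multipliers n"
  using assms by (cases x) (auto simp: multipliers_def)

lemma multipliersD:
  assumes "x \<in> multipliers n"
  shows multiplier_linear: "linear_on (tpow n) (fst x)" "linear_on (tpow n) (snd x)"
    and multiplier_tpow [simp]: "t \<in> tpow n \<Longrightarrow> fst x t \<in> tpow n" "t \<in> tpow n \<Longrightarrow> snd x t \<in> tpow n"
    and multiplier_outside: "t \<notin> tpow n \<Longrightarrow> fst x t = 0" "t \<notin> tpow n \<Longrightarrow> snd x t = 0"
    and multiplier_fst_tmult: "a \<in> tpow n \<Longrightarrow> b \<in> tpow n \<Longrightarrow> fst x (tmult n a b) = tmult n (fst x a) b"
    and multiplier_snd_tmult: "a \<in> tpow n \<Longrightarrow> b \<in> tpow n \<Longrightarrow> snd x (tmult n a b) = tmult n a (snd x b)"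
    and multiplier_middle: "a \<in> tpow n \<Longrightarrow> b \<in> tpow n \<Longrightarrow> tmult n a (fst x b) = tmult n (snd x a) b"
  using assms by (auto simp: multipliers_def)

lemma multiplier_add: "x \<in> multipliers n \<Longrightarrow> s \<in> tpow n \<Longrightarrow> t \<in> tpow n \<Longrightarrow> fst x (s + t) = fst x s + fst x t"
    "x \<in> multipliers n \<Longrightarrow> s \<in> tpow n \<Longrightarrow> t \<in> tpow n \<Longrightarrow> snd x (s + t) = snd x s + snd x t"
  and multiplier_scale: "x \<in> multipliers n \<Longrightarrow> t \<in> tpow n \<Longrightarrow> fst x (c *\<^sub>C t) = c *\<^sub>C fst x t"
    "x \<in> multipliers n \<Longrightarrow> t \<in> tpow n \<Longrightarrow> snd x (c *\<^sub>C t) = c *\<^sub>C snd x t"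
  and multiplier_zero: "x \<in> multipliers n \<Longrightarrow> fst x 0 = 0" "x \<in> multipliers n \<Longrightarrow> snd x 0 = 0"
  by (auto dest: multiplier_linear simp: linear_on_add linear_on_scale intro: linear_on_zero)

lemma subspace_multipliers [simp]: "csubspace (multipliers n)"
  unfolding complex_vector.subspace_def
proof (intro conjI ballI allI)
  show "0 \<in> multipliers n" by (rule multipliersI) (auto simp: linear_on_def)
  show "x + y \<in> multipliers n" if "x \<in> multipliers n" "y \<in> multipliers n" for x y :: "'a multiplier"
    by (rule multipliersI)
      (use that in \<open>auto simp: linear_on_def multiplier_outside multiplier_fst_tmult multiplier_snd_tmult
        multiplier_middle multiplier_add multiplier_scale scaleC_add_right tmult_linear\<close>)
  show "c *\<^sub>C x \<in> multipliers n" if "x \<in> multipliers n" for c and x :: "'a multiplier"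
    by (rule multipliersI)
      (use that in \<open>auto simp: linear_on_def multiplier_outside multiplier_fst_tmult multiplier_snd_tmult
        multiplier_middle multiplier_add multiplier_scale scaleC_add_right scaleC_scaleC mult.commute tmult_linear\<close>)
qed

lemma multipliers_closed [simp]:
  "0 \<in> multipliers n"
  "x \<in> multipliers n \<Longrightarrow> y \<in> multipliers n \<Longrightarrow> x + y \<in> multipliers n"
  "x \<in> multipliers n \<Longrightarrow> c *\<^sub>C x \<in> multipliers n"
  by (simp_all add: complex_vector.subspace_0 complex_vector.subspace_add complex_vector.subspace_scale)

lemma mmult_multipliers [simp]:
  assumes "x \<in> multipliers n" "y \<in> multipliers n"
  shows "mmult x y \<in> multipliers n"
  by (rule multipliersI)
    (use assms in \<open>simp_all add: linear_on_def fst_mmult snd_mmult multiplier_outside multiplier_fst_tmult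
      multiplier_snd_tmult multiplier_middle multiplier_add multiplier_scale multiplier_zero\<close>)

lemma mone_multipliers [simp]: "mone n \<in> multipliers n"
  by (rule multipliersI) (auto simp: mone_def linear_on_def)

lemma membed_multipliers [simp]:
  assumes "t \<in> tpow n" shows "membed n t \<in> multipliers n"
  by (rule multipliersI)
    (use assms in \<open>auto simp: membed_def linear_on_def tmult_linear tmult_outside tmult_assoc\<close>)

lemma fst_membed: "fst (membed n t) s = tmult n t s" and snd_membed: "snd (membed n t) s = tmult n s t"
  by (simp_all add: membed_def)

lemma multiplier_eq_outsideI:
  assumes "x \<in> multipliers n" "y \<in> multipliers n" "\<And>t. t \<in> tpow n \<Longrightarrow> fst x t = fst y t"
    "\<And>t. t \<in> tpow n \<Longrightarrow> snd x t = snd y t"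
  shows "x = y"
proof (rule prod_eqI)
  show "fst x = fst y" using assms by (metis (no_types, opaque_lifting) ext multiplier_outside(1))
  show "snd x = snd y" using assms by (metis (no_types, opaque_lifting) ext multiplier_outside(2))
qed

lemma fst_mone: "fst (mone n) t = (if t \<in> tpow n then t else 0)"
  and snd_mone: "snd (mone n) t = (if t \<in> tpow n then t else 0)"
  by (simp_all add: mone_def)

lemma mmult_mone [simp]:
  assumes "x \<in> multipliers n"
  shows "mmult (mone n) x = x" "mmult x (mone n) = x"
  by (rule multiplier_eq_outsideI[of _ n]; use assms in \<open>simp add: fst_mmult snd_mmult fst_mone snd_mone\<close>)+

lemma bilinear_mmult: "bilinear_on (multipliers n) (multipliers n) mmult"
  unfolding bilinear_on_def
  by (intro conjI ballI linear_onI; rule multiplier_eq_outsideI[of _ n])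
    (simp_all add: fst_mmult snd_mmult multiplier_add multiplier_scale)

lemmas mmult_linear = bilinear_onD[OF bilinear_mmult]

text \<open>The n-th power of H is an ideal of its multiplier algebra, and \<open>fst x t\<close> is
  the product of x and t there. Later equations between actions are mostly computed as equations
  between such products.\<close>

lemma mmult_membed_right:
  assumes "x \<in> multipliers n" "t \<in> tpow n" shows "mmult x (membed n t) = membed n (fst x t)"
  by (rule multiplier_eq_outsideI[of _ n])
    (use assms in \<open>simp_all add: fst_mmult snd_mmult fst_membed snd_membed multiplier_fst_tmult multiplier_middle\<close>)

lemma mmult_membed_left:
  assumes "x \<in> multipliers n" "t \<in> tpow n" shows "mmult (membed n t) x = membed n (snd x t)"
  by (rule multiplier_eq_outsideI[of _ n])
    (use assms in \<open>simp_all add: fst_mmult snd_mmult fst_membed snd_membed multiplier_snd_tmult multiplier_middle\<close>)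

lemma linear_on_membed: "linear_on (tpow n) (membed n)"
  by (intro linear_onI; rule multiplier_eq_outsideI[of _ n]) (simp_all add: fst_membed snd_membed tmult_linear)

lemma membed_linear:
  "s \<in> tpow n \<Longrightarrow> t \<in> tpow n \<Longrightarrow> membed n (s + t) = membed n s + membed n t"
  "t \<in> tpow n \<Longrightarrow> membed n (c *\<^sub>C t) = c *\<^sub>C membed n t"
  by (simp_all add: linear_on_add[OF linear_on_membed] linear_on_scale[OF linear_on_membed])

lemma mmult_membed: "s \<in> tpow n \<Longrightarrow> t \<in> tpow n \<Longrightarrow> mmult (membed n s) (membed n t) = membed n (tmult n s t)"
  by (simp add: mmult_membed_right fst_membed)

section \<open>Tensor products of multipliers\<close>

lemma multilinear_mtensor:
  assumes x: "linear_on (tpow m) f" "\<And>t. t \<in> tpow m \<Longrightarrow> f t \<in> tpow m"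
    and y: "linear_on (tpow n) g" "\<And>t. t \<in> tpow n \<Longrightarrow> g t \<in> tpow n"
  shows "multilinear (m + n) (\<lambda>zs. tconcat m n (f (pure (take m zs))) (g (pure (drop m zs))))"
  by (rule multilinear_split[where f = "\<lambda>xs. f (pure xs)" and g = "\<lambda>ys. g (pure ys)",
        OF bilinear_tconcat multilinear_linear[OF x(1)] multilinear_linear[OF y(1)]])
     (use x y in auto)

lemma tlift_tconcat:
  assumes x: "linear_on (tpow m) f" "\<And>t. t \<in> tpow m \<Longrightarrow> f t \<in> tpow m"
    and y: "linear_on (tpow n) g" "\<And>t. t \<in> tpow n \<Longrightarrow> g t \<in> tpow n"
    and s: "s \<in> tpow m" and t: "t \<in> tpow n"
  shows "tlift (m + n) (\<lambda>zs. tconcat m n (f (pure (take m zs))) (g (pure (drop m zs)))) (tconcat m n s t)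
    = tconcat m n (f s) (g t)"
proof -
  note ml = multilinear_mtensor[OF x y]
  note lin = linear_on_tlift[OF ml]
  show ?thesis
  proof (rule bilinear_on_tpow_eq[OF _ _ _ s t])
    show "bilinear_on (tpow m) (tpow n) (\<lambda>s t. tlift (m + n)
      (\<lambda>zs. tconcat m n (f (pure (take m zs))) (g (pure (drop m zs)))) (tconcat m n s t))"
      by (auto simp: bilinear_on_def linear_on_def tconcat_linear linear_on_add[OF lin] linear_on_scale[OF lin])
    show "bilinear_on (tpow m) (tpow n) (\<lambda>s t. tconcat m n (f s) (g t))"
      using x y by (auto simp: bilinear_on_def linear_on_def tconcat_linear)
  qed (simp add: tlift_pure[OF ml])
qed

lemma mtensor:
  assumes x: "x \<in> multipliers m" and y: "y \<in> multipliers n"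
  shows fst_mtensor: "s \<in> tpow m \<Longrightarrow> t \<in> tpow n \<Longrightarrow>
      fst (mtensor m n x y) (tconcat m n s t) = tconcat m n (fst x s) (fst y t)"
    and snd_mtensor: "s \<in> tpow m \<Longrightarrow> t \<in> tpow n \<Longrightarrow>
      snd (mtensor m n x y) (tconcat m n s t) = tconcat m n (snd x s) (snd y t)"
    and mtensor_multipliers: "mtensor m n x y \<in> multipliers (m + n)"
proof -
  note xy = x y multiplier_linear[OF x] multiplier_linear[OF y]
  show f: "fst (mtensor m n x y) (tconcat m n s t) = tconcat m n (fst x s) (fst y t)"
    if "s \<in> tpow m" "t \<in> tpow n" for s t
    using tlift_tconcat[of m "fst x" n "fst y" s t] xy that by (simp add: mtensor_def)
  show s: "snd (mtensor m n x y) (tconcat m n s t) = tconcat m n (snd x s) (snd y t)"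
    if "s \<in> tpow m" "t \<in> tpow n" for s t
    using tlift_tconcat[of m "snd x" n "snd y" s t] xy that by (simp add: mtensor_def)
  have mlf: "multilinear (m + n) (\<lambda>zs. tconcat m n (fst x (pure (take m zs))) (fst y (pure (drop m zs))))"
    and mls: "multilinear (m + n) (\<lambda>zs. tconcat m n (snd x (pure (take m zs))) (snd y (pure (drop m zs))))"
    using multilinear_mtensor[of m "fst x" n "fst y"] multilinear_mtensor[of m "snd x" n "snd y"] xy by simp_all
  have lf: "linear_on (tpow (m + n)) (fst (mtensor m n x y))"
    and ls: "linear_on (tpow (m + n)) (snd (mtensor m n x y))"
    unfolding mtensor_def fst_conv snd_conv by (rule linear_on_tlift[OF mlf] linear_on_tlift[OF mls])+
  note [simp] = linear_on_add[OF lf] linear_on_add[OF ls] linear_on_scale[OF lf] linear_on_scale[OF ls]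
    linear_on_zero[OF lf subspace_tpow] linear_on_zero[OF ls subspace_tpow]
  have cf: "fst (mtensor m n x y) t \<in> tpow (m + n)" and cs: "snd (mtensor m n x y) t \<in> tpow (m + n)" for t
    unfolding mtensor_def fst_conv snd_conv
    by (rule tlift_mem[OF mlf subspace_tpow] tlift_mem[OF mls subspace_tpow]; use x y in simp)+
  note [simp] = cf cs
  \<comment> \<open>The three laws are proved in one induction: each is bilinear in a and b and
    holds factorwise once both are elementary tensors cut after m factors.\<close>
  have law: "fst (mtensor m n x y) (tmult (m + n) a b) = tmult (m + n) (fst (mtensor m n x y) a) b \<and>
     snd (mtensor m n x y) (tmult (m + n) a b) = tmult (m + n) a (snd (mtensor m n x y) b) \<and>
     tmult (m + n) a (fst (mtensor m n x y) b) = tmult (m + n) (snd (mtensor m n x y) a) b"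
    if "a \<in> tpow (m + n)" "b \<in> tpow (m + n)" for a b
    using that(1)
  proof (induction rule: tpow_split_induct)
    case (tconcat xs ys)
    from that(2) show ?case
    proof (induction rule: tpow_split_induct)
      case (tconcat us vs)
      then show ?case using \<open>length xs = m\<close> \<open>length ys = n\<close> x y
        by (simp only: pure_tpow multiplier_tpow tmult_tconcat f s tmult_tpow multiplier_fst_tmult
            multiplier_snd_tmult multiplier_middle simp_thms)
    qed (use tconcat in \<open>simp_all add: tmult_linear del: tconcat_pure\<close>)
  qed (use that in \<open>simp_all add: tmult_linear\<close>)
  show "mtensor m n x y \<in> multipliers (m + n)"
  proof (rule multipliersI)
    show "fst (mtensor m n x y) t = 0" "snd (mtensor m n x y) t = 0" if "t \<notin> tpow (m + n)" for t
      using that by (simp_all add: mtensor_def tlift_outside[OF mlf] tlift_outside[OF mls])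
  qed (use lf ls law in auto)
qed

lemma mtensor_multipliers' [simp]:
  "x \<in> multipliers m \<Longrightarrow> y \<in> multipliers n \<Longrightarrow> N = m + n \<Longrightarrow> mtensor m n x y \<in> multipliers N"
  by (simp add: mtensor_multipliers)

lemma tconcat_tpow' [simp]: "s \<in> tpow m \<Longrightarrow> t \<in> tpow n \<Longrightarrow> N = m + n \<Longrightarrow> tconcat m n s t \<in> tpow N"
  by simp

lemma tpow_split_eqI:
  assumes "linear_on (tpow (m + n)) f" "linear_on (tpow (m + n)) g" "t \<in> tpow (m + n)"
    and "\<And>a b. a \<in> tpow m \<Longrightarrow> b \<in> tpow n \<Longrightarrow> f (tconcat m n a b) = g (tconcat m n a b)"
  shows "f t = g t"
proof (rule linear_on_tpow_eq[OF assms(1,2) _ assms(3)])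
  fix xs :: "'a list" assume "length xs = m + n"
  with assms(4)[of "pure (take m xs)" "pure (drop m xs)"] show "f (pure xs) = g (pure xs)" by simp
qed

lemma multiplier_split_eqI:
  assumes x: "x \<in> multipliers (m + n)" and y: "y \<in> multipliers (m + n)"
    and "\<And>s t. s \<in> tpow m \<Longrightarrow> t \<in> tpow n \<Longrightarrow> fst x (tconcat m n s t) = fst y (tconcat m n s t)"
    and "\<And>s t. s \<in> tpow m \<Longrightarrow> t \<in> tpow n \<Longrightarrow> snd x (tconcat m n s t) = snd y (tconcat m n s t)"
  shows "x = y"
  by (rule multiplier_eq_outsideI[OF x y]; rule tpow_split_eqI[of m n])
    (use multiplier_linear[OF x] multiplier_linear[OF y] assms(3,4) in simp_all)

lemma bilinear_mtensor: "bilinear_on (multipliers m) (multipliers n) (mtensor m n)"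
  unfolding bilinear_on_def
  by (intro conjI ballI linear_onI; rule multiplier_split_eqI[of _ m n])
    (simp_all add: fst_mtensor snd_mtensor tconcat_linear)

lemmas mtensor_linear = bilinear_onD[OF bilinear_mtensor]

lemma mtensor_mmult:
  assumes "x \<in> multipliers m" "x' \<in> multipliers m" "y \<in> multipliers n" "y' \<in> multipliers n"
  shows "mmult (mtensor m n x y) (mtensor m n x' y') = mtensor m n (mmult x x') (mmult y y')"
  by (rule multiplier_split_eqI[of _ m n])
    (use assms in \<open>simp_all add: fst_mtensor snd_mtensor fst_mmult snd_mmult\<close>)

lemma mtensor_membed:
  assumes "s \<in> tpow m" "t \<in> tpow n"
  shows "mtensor m n (membed m s) (membed n t) = membed (m + n) (tconcat m n s t)"
  by (rule multiplier_split_eqI[of _ m n])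
    (use assms in \<open>simp_all add: fst_mtensor snd_mtensor fst_membed snd_membed tmult_tconcat\<close>)

lemma mtensor_mone: "mtensor m n (mone m) (mone n) = mone (m + n)"
  by (rule multiplier_split_eqI[of _ m n])
    (simp_all add: fst_mtensor snd_mtensor fst_mone snd_mone)

text \<open>This is an equality and not merely an isomorphism because concatenation of lists is
  associative. Both sides are compared on tensors cut into three pieces.\<close>

lemma mtensor_assoc:
  assumes "x \<in> multipliers m" "y \<in> multipliers n" "z \<in> multipliers k"
  shows "mtensor (m + n) k (mtensor m n x y) z = mtensor m (n + k) x (mtensor n k y z)"
proof -
  note [simp] = assms
  show ?thesis
  proof (rule multiplier_split_eqI[of _ m "n + k"])
    fix s t :: "'a tensor" assume st: "s \<in> tpow m" "t \<in> tpow (n + k)"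
    let ?l = "mtensor (m + n) k (mtensor m n x y) z" and ?r = "mtensor m (n + k) x (mtensor n k y z)"
    have M: "?l \<in> multipliers (m + (n + k))" "?r \<in> multipliers (m + (n + k))" by simp_all
    have eq: "fst ?l (tconcat m (n + k) s (tconcat n k (pure xs) (pure ys))) =
        fst ?r (tconcat m (n + k) s (tconcat n k (pure xs) (pure ys))) \<and>
        snd ?l (tconcat m (n + k) s (tconcat n k (pure xs) (pure ys))) =
        snd ?r (tconcat m (n + k) s (tconcat n k (pure xs) (pure ys)))"
      if len: "length xs = n" "length ys = k" for xs ys
    proof -
      have "fst ?l (tconcat (m + n) k (tconcat m n s (pure xs)) (pure ys)) =
          tconcat m (n + k) (fst x s) (tconcat n k (fst y (pure xs)) (fst z (pure ys)))"
        "snd ?l (tconcat (m + n) k (tconcat m n s (pure xs)) (pure ys)) =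
          tconcat m (n + k) (snd x s) (tconcat n k (snd y (pure xs)) (snd z (pure ys)))"
        using st len
        by (simp_all add: fst_mtensor snd_mtensor del: tconcat_pure) (simp_all add: tconcat_assoc)
      then show ?thesis using st(1) len
        by (simp add: fst_mtensor snd_mtensor tconcat_assoc del: tconcat_pure)
    qed
    have "fst ?l (tconcat m (n + k) s t) = fst ?r (tconcat m (n + k) s t) \<and>
       snd ?l (tconcat m (n + k) s t) = snd ?r (tconcat m (n + k) s t)"
      using st(2)
    proof (induction rule: tpow_split_induct)
      case (tconcat xs ys)
      then show ?case by (rule eq)
    next
      case zero
      then show ?case using st by (simp add: multiplier_zero[OF M(1)] multiplier_zero[OF M(2)])
    next
      case (add u v)
      then show ?case using st
        by (simp add: tconcat_linear multiplier_add[OF M(1)] multiplier_add[OF M(2)])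
    next
      case (scale c u)
      then show ?case using st
        by (simp add: tconcat_linear multiplier_scale[OF M(1)] multiplier_scale[OF M(2)])
    qed
    then show "fst ?l (tconcat m (n + k) s t) = fst ?r (tconcat m (n + k) s t)"
       "snd ?l (tconcat m (n + k) s t) = snd ?r (tconcat m (n + k) s t)" by auto
  qed simp_all
qed

lemma membed_unit: "membed 0 (pure []) = mone 0"
  by (rule multiplier_eq_outsideI[of _ 0]; simp add: fst_membed snd_membed fst_mone snd_mone;
      auto elim!: tpow_0_cases simp: tmult_linear)

lemma mtensor_unit [simp]:
  assumes "x \<in> multipliers n"
  shows "mtensor 0 n (mone 0) x = x" "mtensor n 0 x (mone 0) = x"
proof -
  have "mtensor 0 n (mone 0) x \<in> multipliers n" "mtensor n 0 x (mone 0) \<in> multipliers n"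
    using assms by simp_all
  moreover have "fst (mtensor 0 n (mone 0) x) t = fst x t \<and> snd (mtensor 0 n (mone 0) x) t = snd x t
     \<and> fst (mtensor n 0 x (mone 0)) t = fst x t \<and> snd (mtensor n 0 x (mone 0)) t = snd x t" if "t \<in> tpow n" for t
    using fst_mtensor[of "mone 0" 0 x n "pure []" t] snd_mtensor[of "mone 0" 0 x n "pure []" t]
      fst_mtensor[of x n "mone 0" 0 t "pure []"] snd_mtensor[of x n "mone 0" 0 t "pure []"] assms that
    by (simp add: fst_mone snd_mone)
  ultimately show "mtensor 0 n (mone 0) x = x" "mtensor n 0 x (mone 0) = x"
    using assms by (auto intro: multiplier_eq_outsideI[of _ n])
qed

text \<open>On the line \<open>tpow 0\<close> both actions are scalars, and the middle law at the
  unit makes the left and the right scalar agree.\<close>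

lemma multipliers_0_cases:
  assumes "x \<in> multipliers 0"
  obtains c where "x = c *\<^sub>C mone 0"
proof -
  obtain c where c: "fst x (pure []) = c *\<^sub>C pure []"
    using multiplier_tpow(1)[OF assms, of "pure []"] by (auto elim: tpow_0_cases)
  obtain d where d: "snd x (pure []) = d *\<^sub>C pure []"
    using multiplier_tpow(2)[OF assms, of "pure []"] by (auto elim: tpow_0_cases)
  have "c *\<^sub>C pure [] = d *\<^sub>C (pure [] :: 'a tensor)"
    using multiplier_middle[OF assms, of "pure []" "pure []"] by (simp add: c d tmult_linear)
  then have "x = c *\<^sub>C mone 0"
    using assms c d by (intro multiplier_eq_outsideI[of _ 0])
      (auto elim!: tpow_0_cases simp: multiplier_scale fst_mone snd_mone)
  then show thesis using that by blast
qed

section \<open>Multipliers determined by one of their two actions\<close>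

context nondegenerate_algebra
begin

text \<open>The left action determines the right one: (t x) s = t (x s) for all s, and s can be
  cancelled by nondegeneracy.\<close>

lemma multiplier_eqI:
  assumes x: "x \<in> multipliers n" and y: "y \<in> multipliers n"
    and eq: "\<And>xs. length xs = n \<Longrightarrow> fst x (pure (xs :: 'a list)) = fst y (pure xs)"
  shows "x = y"
proof (rule multiplier_eq_outsideI[OF x y])
  fix t :: "'a tensor" assume t: "t \<in> tpow n"
  show "fst x t = fst y t"
    by (rule linear_on_tpow_eq[OF multiplier_linear(1)[OF x] multiplier_linear(1)[OF y] eq t])
  have "tmult n (snd x t - snd y t) (pure xs) = 0" if xs: "length xs = n" for xs
    using x y t xs by (simp add: tmult_diff multiplier_middle[OF x, symmetric] multiplier_middle[OF y, symmetric] eq)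
  moreover have "snd x t - snd y t \<in> tpow n" by (intro tpow_closed multiplier_tpow[OF x] multiplier_tpow[OF y] t)
  ultimately have "snd x t - snd y t = 0" by (metis tpow_nondegenerate_left)
  then show "snd x t = snd y t" by simp
qed

lemma multiplier_eqI':
  assumes x: "x \<in> multipliers n" and y: "y \<in> multipliers n"
    and eq: "\<And>xs. length xs = n \<Longrightarrow> snd x (pure (xs :: 'a list)) = snd y (pure xs)"
  shows "x = y"
proof (rule multiplier_eq_outsideI[OF x y])
  fix t :: "'a tensor" assume t: "t \<in> tpow n"
  show "snd x t = snd y t"
    by (rule linear_on_tpow_eq[OF multiplier_linear(2)[OF x] multiplier_linear(2)[OF y] eq t])
  have "tmult n (pure xs) (fst x t - fst y t) = 0" if xs: "length xs = n" for xs
    using x y t xs by (simp add: tmult_diff multiplier_middle[OF x] multiplier_middle[OF y] eq)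
  moreover have "fst x t - fst y t \<in> tpow n" by (intro tpow_closed multiplier_tpow[OF x] multiplier_tpow[OF y] t)
  ultimately have "fst x t - fst y t = 0" by (metis tpow_nondegenerate_right)
  then show "fst x t = fst y t" by simp
qed

text \<open>This makes the \<open>THE\<close> terms in \<open>W_R\<close> and \<open>W_L\<close>
  well-defined, and it lets equations computed with multipliers descend to tensors.\<close>

lemma membed_inject:
  assumes s: "s \<in> tpow n" and t: "t \<in> tpow n" and eq: "membed n s = membed n (t :: 'a tensor)"
  shows "s = t"
proof -
  have "tmult n (s - t) (pure xs) = 0" if xs: "length xs = n" for xs
  proof -
    have "tmult n s (pure xs) = tmult n t (pure xs)" using eq by (metis fst_membed)
    then show ?thesis using s t xs by (simp add: tmult_diff)
  qed
  moreover have "s - t \<in> tpow n" by (intro tpow_closed s t)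
  ultimately have "s - t = 0" by (metis tpow_nondegenerate_left)
  then show ?thesis by simp
qed

end

section \<open>Extension of nondegenerate homomorphisms\<close>

text \<open>The case m = 0 is included, where all multipliers are scalars; thus the counit falls
  under the same notion as \<Delta>. Spans are taken because the set of products f(s) w need not be
  closed under addition.\<close>

definition nd_hom :: "nat \<Rightarrow> nat \<Rightarrow> ('a::complex_algebra tensor \<Rightarrow> 'a multiplier) \<Rightarrow> bool" where
  "nd_hom n m f \<longleftrightarrow> linear_on (tpow n) f \<and> (\<forall>s\<in>tpow n. f s \<in> multipliers m) \<and>
     (\<forall>s\<in>tpow n. \<forall>t\<in>tpow n. f (tmult n s t) = mmult (f s) (f t)) \<and>
     tpow m \<subseteq> cspan {fst (f s) w | s w. s \<in> tpow n \<and> w \<in> tpow m} \<and>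
     tpow m \<subseteq> cspan {snd (f s) w | s w. s \<in> tpow n \<and> w \<in> tpow m}"

lemma nd_homD:
  assumes "nd_hom n m f"
  shows nd_hom_linear: "linear_on (tpow n) f"
    and nd_hom_multipliers [simp]: "s \<in> tpow n \<Longrightarrow> f s \<in> multipliers m"
    and nd_hom_tmult: "s \<in> tpow n \<Longrightarrow> t \<in> tpow n \<Longrightarrow> f (tmult n s t) = mmult (f s) (f t)"
  using assms by (auto simp: nd_hom_def)

text \<open>Nondegeneracy in the form of an induction rule: a linear statement about w need only be
  proved for w of the form f(s) w', or of the form w' f(s).\<close>

lemma nd_hom_induct:
  assumes f: "nd_hom n m f" and w: "w \<in> tpow m" and P: "P 0"
    "\<And>s t. s \<in> tpow m \<Longrightarrow> t \<in> tpow m \<Longrightarrow> P s \<Longrightarrow> P t \<Longrightarrow> P (s + t)"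
    "\<And>c s. s \<in> tpow m \<Longrightarrow> P s \<Longrightarrow> P (c *\<^sub>C s)"
  shows nd_hom_induct_fst: "(\<And>s w. s \<in> tpow n \<Longrightarrow> w \<in> tpow m \<Longrightarrow> P (fst (f s) w)) \<Longrightarrow> P w"
    and nd_hom_induct_snd: "(\<And>s w. s \<in> tpow n \<Longrightarrow> w \<in> tpow m \<Longrightarrow> P (snd (f s) w)) \<Longrightarrow> P w"
proof -
  have sub: "csubspace {t. t \<in> tpow m \<and> P t}" using P by (auto simp: complex_vector.subspace_def)
  show "P w" if *: "\<And>s w. s \<in> tpow n \<Longrightarrow> w \<in> tpow m \<Longrightarrow> P (fst (f s) w)"
  proof -
    have "w \<in> cspan {fst (f s) w | s w. s \<in> tpow n \<and> w \<in> tpow m}" using f w by (auto simp: nd_hom_def)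
    then have "w \<in> tpow m \<and> P w"
      by (rule complex_vector.span_induct[OF _ sub]) (use * f in auto)
    then show ?thesis by simp
  qed
  show "P w" if *: "\<And>s w. s \<in> tpow n \<Longrightarrow> w \<in> tpow m \<Longrightarrow> P (snd (f s) w)"
  proof -
    have "w \<in> cspan {snd (f s) w | s w. s \<in> tpow n \<and> w \<in> tpow m}" using f w by (auto simp: nd_hom_def)
    then have "w \<in> tpow m \<and> P w"
      by (rule complex_vector.span_induct[OF _ sub]) (use * f in auto)
    then show ?thesis by simp
  qed
qed

lemma nd_hom_cong:
  assumes f: "nd_hom n m f" and eq: "\<And>t. t \<in> tpow n \<Longrightarrow> f t = g t"
  shows "nd_hom n m g"
proof -
  have "{h (g s) w | s w. s \<in> tpow n \<and> w \<in> tpow m} = {h (f s) w | s w. s \<in> tpow n \<and> w \<in> tpow m}"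
    for h :: "'a multiplier \<Rightarrow> 'a tensor \<Rightarrow> 'a tensor"
    by (rule Collect_cong, intro ex_cong1 rev_conj_cong refl) (simp add: eq)
  moreover have "linear_on (tpow n) g"
    using nd_hom_linear[OF f] by (simp add: linear_on_def eq[symmetric])
  moreover have "\<forall>s\<in>tpow n. g s \<in> multipliers m"
    "\<forall>s\<in>tpow n. \<forall>t\<in>tpow n. g (tmult n s t) = mmult (g s) (g t)"
    using nd_homD[OF f] by (simp_all add: eq[symmetric])
  ultimately show ?thesis using f unfolding nd_hom_def by simp
qed

definition hom_ext :: "nat \<Rightarrow> nat \<Rightarrow> ('a::complex_algebra tensor \<Rightarrow> 'a multiplier) \<Rightarrow> 'a multiplier \<Rightarrow> 'a multiplier"
  where "hom_ext n m f y = (THE z. z \<in> multipliers m \<and>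
    (\<forall>x\<in>tpow n. mmult z (f x) = f (fst y x) \<and> mmult (f x) z = f (snd y x)))"

context nondegenerate_algebra
begin

lemma tpow_eqI_left:
  assumes "s \<in> tpow n" "t \<in> tpow n" "\<And>a. a \<in> tpow n \<Longrightarrow> tmult n a s = tmult n a (t :: 'a tensor)"
  shows "s = t"
proof -
  have "s - t = 0" by (rule tpow_nondegenerate_right[of _ n]) (use assms in \<open>auto simp: tmult_diff\<close>)
  then show ?thesis by simp
qed

lemma tpow_eqI_right:
  assumes "s \<in> tpow n" "t \<in> tpow n" "\<And>a. a \<in> tpow n \<Longrightarrow> tmult n s a = tmult n (t :: 'a tensor) a"
  shows "s = t"
proof -
  have "s - t = 0" by (rule tpow_nondegenerate_left[of _ n]) (use assms in \<open>auto simp: tmult_diff\<close>)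
  then show ?thesis by simp
qed

text \<open>Multiply by a from the other side: a is a sum of elements a' f(x), and a' f(x) v depends
  on f(x) v only. So a v = a v' for all a, and nondegeneracy applies.\<close>

lemma nd_hom_separating:
  assumes f: "nd_hom n m f" and v: "v \<in> tpow m" "v' \<in> tpow m"
  shows nd_hom_separating_fst:
      "(\<And>x. x \<in> tpow n \<Longrightarrow> fst (f x) v = fst (f x) (v' :: 'a tensor)) \<Longrightarrow> v = v'"
    and nd_hom_separating_snd:
      "(\<And>x. x \<in> tpow n \<Longrightarrow> snd (f x) v = snd (f x) (v' :: 'a tensor)) \<Longrightarrow> v = v'"
proof -
  show "v = v'" if *: "\<And>x. x \<in> tpow n \<Longrightarrow> fst (f x) v = fst (f x) v'"
  proof (rule tpow_eqI_left[OF v])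
    fix a :: "'a tensor" assume "a \<in> tpow m"
    then show "tmult m a v = tmult m a v'"
      by (rule nd_hom_induct_snd[OF f])
        (use v f * in \<open>auto simp: tmult_linear multiplier_middle[of _ m, symmetric]\<close>)
  qed
  show "v = v'" if *: "\<And>x. x \<in> tpow n \<Longrightarrow> snd (f x) v = snd (f x) v'"
  proof (rule tpow_eqI_right[OF v])
    fix a :: "'a tensor" assume "a \<in> tpow m"
    then show "tmult m v a = tmult m v' a"
      by (rule nd_hom_induct_fst[OF f])
        (use v f * in \<open>auto simp: tmult_linear multiplier_middle[of _ m]\<close>)
  qed
qed

lemma nd_hom_eqI:
  assumes f: "nd_hom n m f" and z: "z \<in> multipliers m" "z' \<in> multipliers m"
    and eq: "\<And>xs. length xs = n \<Longrightarrow> mmult z (f (pure (xs :: 'a list))) = mmult z' (f (pure xs))"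
  shows "z = z'"
proof (rule multiplier_eq_outsideI[OF z])
  have lin: "linear_on (tpow n) (\<lambda>x. mmult u (f x))" if "u \<in> multipliers m" for u
    using that f nd_hom_linear[OF f] by (auto simp: linear_on_def mmult_linear[of _ m])
  have eq': "mmult z (f x) = mmult z' (f x)" if "x \<in> tpow n" for x
    by (rule linear_on_tpow_eq[OF lin[OF z(1)] lin[OF z(2)] eq that])
  show fst: "fst z t = fst z' t" if "t \<in> tpow m" for t
    using that
  proof (rule nd_hom_induct_fst[OF f])
    fix s w :: "'a tensor" assume "s \<in> tpow n" "w \<in> tpow m"
    then show "fst z (fst (f s) w) = fst z' (fst (f s) w)" using eq'[of s] by (metis fst_mmult)
  qed (use z in \<open>auto simp: multiplier_add multiplier_scale multiplier_zero\<close>)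
  have "z = z'" by (rule multiplier_eqI[OF z]) (simp add: fst)
  then show "snd z t = snd z' t" for t by simp
qed

text \<open>Solvability in v of a family of linear equations whose right side is linear in w is a
  linear condition on w. To construct an extension it therefore suffices to solve the equations on a
  spanning set.\<close>

lemma subspace_solvable:
  assumes W: "csubspace W" and V: "csubspace V"
    and F: "\<And>x. x \<in> X \<Longrightarrow> linear_on V (F x)" and G: "\<And>x. x \<in> X \<Longrightarrow> linear_on W (G x)"
  shows "csubspace {w \<in> W. \<exists>v\<in>V. \<forall>x\<in>X. F x v = G x w}"
  unfolding complex_vector.subspace_def mem_Collect_eq
proof (intro conjI ballI allI; (elim CollectE conjE bexE)?)
  show "0 \<in> W" using W by (rule complex_vector.subspace_0)
  show "\<exists>v\<in>V. \<forall>x\<in>X. F x v = G x 0"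
    using V by (intro bexI[of _ 0]) (simp_all add: linear_on_zero[OF F V] linear_on_zero[OF G W] complex_vector.subspace_0)
next
  fix s t u v assume *: "s \<in> W" "t \<in> W" "u \<in> V" "v \<in> V" "\<forall>x\<in>X. F x u = G x s" "\<forall>x\<in>X. F x v = G x t"
  then show "s + t \<in> W" using W by (simp add: complex_vector.subspace_add)
  show "\<exists>v\<in>V. \<forall>x\<in>X. F x v = G x (s + t)"
    using * V by (intro bexI[of _ "u + v"])
      (simp_all add: linear_on_add[OF F] linear_on_add[OF G] complex_vector.subspace_add)
next
  fix c s u assume *: "s \<in> W" "u \<in> V" "\<forall>x\<in>X. F x u = G x s"
  then show "c *\<^sub>C s \<in> W" using W by (simp add: complex_vector.subspace_scale)
  show "\<exists>v\<in>V. \<forall>x\<in>X. F x v = G x (c *\<^sub>C s)"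
    using * V by (intro bexI[of _ "c *\<^sub>C u"])
      (simp_all add: linear_on_scale[OF F] linear_on_scale[OF G] complex_vector.subspace_scale)
qed

text \<open>The product \<open>z w\<close> is found as the unique \<open>v\<close> with \<open>f(x) v = f(x y) w\<close> for all \<open>x\<close>; this avoids checking that
  \<open>f(x) w \<mapsto> f(y x) w\<close> is well-defined on sums.\<close>

lemma hom_ext_exists:
  assumes f: "nd_hom n m f" and y: "(y :: 'a multiplier) \<in> multipliers n"
  shows "\<exists>z. z \<in> multipliers m \<and>
    (\<forall>x\<in>tpow n. mmult z (f x) = f (fst y x) \<and> mmult (f x) z = f (snd y x))"
proof -
  note [simp] = nd_hom_multipliers[OF f] multiplier_tpow[OF y]
  have ff: "fst (f x) (fst (f x') w) = fst (f (tmult n x x')) w"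
    and ss: "snd (f x') (snd (f x) w) = snd (f (tmult n x x')) w"
    if "x \<in> tpow n" "x' \<in> tpow n" for x x' w
    using that by (simp_all add: nd_hom_tmult[OF f] fst_mmult snd_mmult)
  \<comment> \<open>The candidate for the product of z with f(x') w is f(y x') w. It solves the
    equations, since f(x) f(y x') = f(x y x') = f(x y) f(x') by the middle law of y.\<close>
  have fL: "fst (f x) (fst (f (fst y x')) w) = fst (f (snd y x)) (fst (f x') w)"
    and fR: "snd (f x') (snd (f (snd y x)) w) = snd (f (fst y x')) (snd (f x) w)"
    if "x \<in> tpow n" "x' \<in> tpow n" for x x' w
    using that by (simp_all add: ff ss multiplier_middle[OF y])
  have sub: "csubspace {w \<in> tpow m. \<exists>v\<in>tpow m. \<forall>x\<in>tpow n. fst (f x) v = fst (f (snd y x)) w}"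
    by (rule subspace_solvable) (auto intro: multiplier_linear)
  have "w \<in> {w \<in> tpow m. \<exists>v\<in>tpow m. \<forall>x\<in>tpow n. fst (f x) v = fst (f (snd y x)) w}" if "w \<in> tpow m" for w
  proof (rule nd_hom_induct_fst[OF f that])
    fix s w :: "'a tensor" assume "s \<in> tpow n" "w \<in> tpow m"
    then show "fst (f s) w \<in> {w \<in> tpow m. \<exists>v\<in>tpow m. \<forall>x\<in>tpow n. fst (f x) v = fst (f (snd y x)) w}"
      by (auto simp: fL intro!: bexI[of _ "fst (f (fst y s)) w"])
  qed (rule complex_vector.subspace_0[OF sub] complex_vector.subspace_add[OF sub]
      complex_vector.subspace_scale[OF sub]; assumption)+
  then obtain L where L: "\<And>w. w \<in> tpow m \<Longrightarrow> L w \<in> tpow m"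
    "\<And>w x. w \<in> tpow m \<Longrightarrow> x \<in> tpow n \<Longrightarrow> fst (f x) (L w) = fst (f (snd y x)) w" by (simp only: mem_Collect_eq) metis
  have sub: "csubspace {w \<in> tpow m. \<exists>v\<in>tpow m. \<forall>x\<in>tpow n. snd (f x) v = snd (f (fst y x)) w}"
    by (rule subspace_solvable) (auto intro: multiplier_linear)
  have "w \<in> {w \<in> tpow m. \<exists>v\<in>tpow m. \<forall>x\<in>tpow n. snd (f x) v = snd (f (fst y x)) w}" if "w \<in> tpow m" for w
  proof (rule nd_hom_induct_snd[OF f that])
    fix s w :: "'a tensor" assume "s \<in> tpow n" "w \<in> tpow m"
    then show "snd (f s) w \<in> {w \<in> tpow m. \<exists>v\<in>tpow m. \<forall>x\<in>tpow n. snd (f x) v = snd (f (fst y x)) w}"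
      by (auto simp: fR intro!: bexI[of _ "snd (f (snd y s)) w"])
  qed (rule complex_vector.subspace_0[OF sub] complex_vector.subspace_add[OF sub]
      complex_vector.subspace_scale[OF sub]; assumption)+
  then obtain R where R: "\<And>w. w \<in> tpow m \<Longrightarrow> R w \<in> tpow m"
    "\<And>w x. w \<in> tpow m \<Longrightarrow> x \<in> tpow n \<Longrightarrow> snd (f x) (R w) = snd (f (fst y x)) w" by (simp only: mem_Collect_eq) metis
  note [simp] = L(1) R(1)
  \<comment> \<open>Solutions are unique. Linearity and the one-sided multiplier laws of L and R
    follow by checking that the expected value solves the equations.\<close>
  have L_eqI: "L w = v" if "w \<in> tpow m" "v \<in> tpow m"
    "\<And>x. x \<in> tpow n \<Longrightarrow> fst (f x) v = fst (f (snd y x)) w" for v w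
    by (rule nd_hom_separating_fst[OF f]) (use that L in auto)
  have R_eqI: "R w = v" if "w \<in> tpow m" "v \<in> tpow m"
    "\<And>x. x \<in> tpow n \<Longrightarrow> snd (f x) v = snd (f (fst y x)) w" for v w
    by (rule nd_hom_separating_snd[OF f]) (use that R in auto)
  have Lf: "L (fst (f x) w) = fst (f (fst y x)) w" and Rf: "R (snd (f x) w) = snd (f (snd y x)) w"
    if "x \<in> tpow n" "w \<in> tpow m" for x w
    by (rule L_eqI R_eqI; use that fL fR in simp)+
  have L_add: "L (s + t) = L s + L t" and R_add: "R (s + t) = R s + R t" if "s \<in> tpow m" "t \<in> tpow m" for s t
    by (rule L_eqI R_eqI; use that in \<open>simp add: multiplier_add[of _ m] L R\<close>)+
  have L_scale: "L (c *\<^sub>C s) = c *\<^sub>C L s" and R_scale: "R (c *\<^sub>C s) = c *\<^sub>C R s" if "s \<in> tpow m" for c s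
    by (rule L_eqI R_eqI; use that in \<open>simp add: multiplier_scale[of _ m] L R\<close>)+
  have L_mult: "L (tmult m a b) = tmult m (L a) b" and R_mult: "R (tmult m a b) = tmult m a (R b)"
    if "a \<in> tpow m" "b \<in> tpow m" for a b
    by (rule L_eqI R_eqI; use that in \<open>simp add: multiplier_fst_tmult[of _ m] multiplier_snd_tmult[of _ m] L R\<close>)+
  \<comment> \<open>The middle law ties L to R and is no uniqueness statement. It is checked for a
    of the form w f(s), where R is known: the value is w f(s y).\<close>
  have mid: "tmult m a (L b) = tmult m (R a) b" if a: "a \<in> tpow m" and b: "b \<in> tpow m" for a b
  proof (rule nd_hom_induct_snd[OF f a])
    show "tmult m 0 (L b) = tmult m (R 0) b" using R_scale[of 0 0] b by simp
    show "tmult m (snd (f s) w) (L b) = tmult m (R (snd (f s) w)) b" if "s \<in> tpow n" "w \<in> tpow m" for s w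
      using that b by (simp add: Rf multiplier_middle[of _ m, symmetric] L)
  qed (use b in \<open>simp_all add: tmult_linear R_add R_scale\<close>)
  define z where "z = (\<lambda>w. if w \<in> tpow m then L w else 0, \<lambda>w. if w \<in> tpow m then R w else 0)"
  have zM: "z \<in> multipliers m"
    by (rule multipliersI)
      (auto simp: z_def linear_on_def L_add L_scale R_add R_scale L_mult R_mult mid)
  moreover have "mmult z (f x) = f (fst y x)" if "x \<in> tpow n" for x
    by (rule multiplier_eqI[of _ m]) (use that zM in \<open>simp_all add: fst_mmult, simp add: z_def Lf\<close>)
  moreover have "mmult (f x) z = f (snd y x)" if "x \<in> tpow n" for x
    by (rule multiplier_eqI'[of _ m]) (use that zM in \<open>simp_all add: snd_mmult, simp add: z_def Rf\<close>)
  ultimately show ?thesis by blast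
qed

text \<open>One-sided products with the values of f on elementary tensors already pin down the
  extension. An equation about \<open>hom_ext\<close> is thus proved by exhibiting z and checking
  these products; the condition on the other side is supplied by existence.\<close>

lemma hom_ext_unique:
  assumes f: "nd_hom n m f" and y: "(y :: 'a multiplier) \<in> multipliers n" and z: "z \<in> multipliers m"
    and eq: "\<And>xs. length xs = n \<Longrightarrow> mmult z (f (pure xs)) = f (fst y (pure xs))"
  shows "hom_ext n m f y = z"
  unfolding hom_ext_def
proof (rule the_equality)
  obtain z' where z': "z' \<in> multipliers m"
    "\<And>x. x \<in> tpow n \<Longrightarrow> mmult z' (f x) = f (fst y x) \<and> mmult (f x) z' = f (snd y x)"
    using hom_ext_exists[OF f y] by blast
  have "z = z'" by (rule nd_hom_eqI[OF f z z'(1)]) (simp add: eq z')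
  then show "z \<in> multipliers m \<and>
    (\<forall>x\<in>tpow n. mmult z (f x) = f (fst y x) \<and> mmult (f x) z = f (snd y x))" using z' by simp
  fix u assume "u \<in> multipliers m \<and> (\<forall>x\<in>tpow n. mmult u (f x) = f (fst y x) \<and> mmult (f x) u = f (snd y x))"
  then show "u = z" by (intro nd_hom_eqI[OF f _ z]) (simp_all add: eq)
qed

lemma hom_ext:
  assumes f: "nd_hom n m f" and y: "(y :: 'a multiplier) \<in> multipliers n"
  shows hom_ext_multipliers [simp]: "hom_ext n m f y \<in> multipliers m"
    and hom_ext_left: "x \<in> tpow n \<Longrightarrow> mmult (hom_ext n m f y) (f x) = f (fst y x)"
    and hom_ext_right: "x \<in> tpow n \<Longrightarrow> mmult (f x) (hom_ext n m f y) = f (snd y x)"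
proof -
  obtain z where z: "z \<in> multipliers m"
    "\<And>x. x \<in> tpow n \<Longrightarrow> mmult z (f x) = f (fst y x) \<and> mmult (f x) z = f (snd y x)"
    using hom_ext_exists[OF f y] by blast
  have "hom_ext n m f y = z" by (rule hom_ext_unique[OF f y z(1)]) (simp add: z)
  then show "hom_ext n m f y \<in> multipliers m"
    "x \<in> tpow n \<Longrightarrow> mmult (hom_ext n m f y) (f x) = f (fst y x)"
    "x \<in> tpow n \<Longrightarrow> mmult (f x) (hom_ext n m f y) = f (snd y x)" using z by simp_all
qed

lemma hom_ext_membed:
  assumes f: "nd_hom n m f" and t: "(t :: 'a tensor) \<in> tpow n"
  shows "hom_ext n m f (membed n t) = f t"
  by (rule hom_ext_unique[OF f]) (use f t in \<open>simp_all add: fst_membed nd_hom_tmult\<close>)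

lemma linear_on_hom_ext:
  assumes f: "nd_hom n m (f :: 'a tensor \<Rightarrow> 'a multiplier)"
  shows "linear_on (multipliers n) (hom_ext n m f)"
  by (intro linear_onI; rule hom_ext_unique[OF f])
    (use f in \<open>simp_all add: mmult_linear[of _ m] hom_ext_left linear_on_add[OF nd_hom_linear[OF f]]
      linear_on_scale[OF nd_hom_linear[OF f]]\<close>)

lemma hom_ext_mmult:
  assumes f: "nd_hom n m f" and "x \<in> multipliers n" "(y :: 'a multiplier) \<in> multipliers n"
  shows "hom_ext n m f (mmult x y) = mmult (hom_ext n m f x) (hom_ext n m f y)"
  by (rule hom_ext_unique[OF f]) (use assms in \<open>simp_all add: mmult_assoc hom_ext_left fst_mmult\<close>)

lemma hom_ext_mone:
  assumes f: "nd_hom n m (f :: 'a tensor \<Rightarrow> 'a multiplier)"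
  shows "hom_ext n m f (mone n) = (mone m :: 'a multiplier)"
  by (rule hom_ext_unique[OF f]) (use assms in \<open>simp_all add: fst_mone\<close>)

section \<open>Composition and comparison of extended homomorphisms\<close>

definition strict_hom :: "nat \<Rightarrow> nat \<Rightarrow> ('a multiplier \<Rightarrow> 'a multiplier) \<Rightarrow> bool" where
  "strict_hom n m F \<longleftrightarrow> linear_on (multipliers n) F \<and> (\<forall>y\<in>multipliers n. F y \<in> multipliers m) \<and>
     (\<forall>x\<in>multipliers n. \<forall>y\<in>multipliers n. F (mmult x y) = mmult (F x) (F y)) \<and>
     nd_hom n m (\<lambda>t. F (membed n t))"

lemma strict_hom_ext:
  assumes f: "nd_hom n m (f :: 'a tensor \<Rightarrow> 'a multiplier)"
  shows "strict_hom n m (hom_ext n m f)"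
proof -
  have "nd_hom n m (\<lambda>t. hom_ext n m f (membed n t))"
    by (rule nd_hom_cong[OF f]) (simp add: hom_ext_membed[OF f])
  then show ?thesis
    by (simp add: strict_hom_def linear_on_hom_ext[OF f] hom_ext_mmult[OF f] hom_ext_multipliers[OF f])
qed

lemma strict_hom_id:
  assumes "nd_hom n n (membed n :: 'a tensor \<Rightarrow> 'a multiplier)"
  shows "strict_hom n n (\<lambda>y. y)"
  using assms unfolding strict_hom_def by (auto simp: linear_on_def)

text \<open>Only nondegeneracy of the composite needs an argument. The target is spanned by elements
  G(v) w, here v may be taken as F(s) u, and G(F(s) u) w = G(F(s)) (G(u) w).\<close>

lemma strict_hom_comp:
  assumes F: "strict_hom n m F" and G: "strict_hom m l G"
  shows "strict_hom n l (\<lambda>y. G (F y))"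
proof -
  have FM: "F y \<in> multipliers m" if "y \<in> multipliers n" for y using that F by (auto simp: strict_hom_def)
  have GM: "G y \<in> multipliers l" if "y \<in> multipliers m" for y using that G by (auto simp: strict_hom_def)
  have Fm: "F (mmult x y) = mmult (F x) (F y)" if "x \<in> multipliers n" "y \<in> multipliers n" for x y
    using that F by (auto simp: strict_hom_def)
  have Gm: "G (mmult x y) = mmult (G x) (G y)" if "x \<in> multipliers m" "y \<in> multipliers m" for x y
    using that G by (auto simp: strict_hom_def)
  have lin: "linear_on (multipliers n) (\<lambda>y. G (F y))"
    using F G by (auto simp: strict_hom_def linear_on_def)
  have ndF: "nd_hom n m (\<lambda>t. F (membed n t))" and ndG: "nd_hom m l (\<lambda>t. G (membed m t))"
    using F G by (auto simp: strict_hom_def)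
  let ?A = "{fst (G (F (membed n s))) w | s w. s \<in> tpow n \<and> w \<in> tpow l}"
  let ?B = "{snd (G (F (membed n s))) w | s w. s \<in> tpow n \<and> w \<in> tpow l}"
  note cl = complex_vector.span_zero complex_vector.span_add complex_vector.span_scale complex_vector.span_base
  have A: "fst (G (membed m v)) w \<in> cspan ?A" if v: "v \<in> tpow m" and w: "w \<in> tpow l" for v w
  proof (rule nd_hom_induct_fst[OF ndF v])
    fix s u :: "'a tensor" assume su: "s \<in> tpow n" "u \<in> tpow m"
    then have "G (membed m (fst (F (membed n s)) u)) = mmult (G (F (membed n s))) (G (membed m u))"
      by (simp add: FM mmult_membed_right[symmetric] Gm)
    moreover have "fst (G (membed m u)) w \<in> tpow l" using su w by (intro multiplier_tpow[OF GM]) auto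
    then have "fst (G (F (membed n s))) (fst (G (membed m u)) w) \<in> cspan ?A"
      using su by (intro cl(4)) blast
    ultimately show "fst (G (membed m (fst (F (membed n s)) u))) w \<in> cspan ?A" by (simp add: fst_mmult)
  qed (use w linear_on_zero[OF nd_hom_linear[OF ndG]] in
      \<open>auto simp: linear_on_add[OF nd_hom_linear[OF ndG]] linear_on_scale[OF nd_hom_linear[OF ndG]] intro: cl\<close>)
  have B: "snd (G (membed m v)) w \<in> cspan ?B" if v: "v \<in> tpow m" and w: "w \<in> tpow l" for v w
  proof (rule nd_hom_induct_snd[OF ndF v])
    fix s u :: "'a tensor" assume su: "s \<in> tpow n" "u \<in> tpow m"
    then have "G (membed m (snd (F (membed n s)) u)) = mmult (G (membed m u)) (G (F (membed n s)))"
      by (simp add: FM mmult_membed_left[symmetric] Gm)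
    moreover have "snd (G (membed m u)) w \<in> tpow l" using su w by (intro multiplier_tpow[OF GM]) auto
    then have "snd (G (F (membed n s))) (snd (G (membed m u)) w) \<in> cspan ?B"
      using su by (intro cl(4)) blast
    ultimately show "snd (G (membed m (snd (F (membed n s)) u))) w \<in> cspan ?B" by (simp add: snd_mmult)
  qed (use w linear_on_zero[OF nd_hom_linear[OF ndG]] in
      \<open>auto simp: linear_on_add[OF nd_hom_linear[OF ndG]] linear_on_scale[OF nd_hom_linear[OF ndG]] intro: cl\<close>)
  have "w \<in> cspan ?A" "w \<in> cspan ?B" if "w \<in> tpow l" for w
    by (rule nd_hom_induct_fst[OF ndG that] nd_hom_induct_snd[OF ndG that]; auto intro: cl A B)+
  moreover have "linear_on (tpow n) (\<lambda>t. G (F (membed n t)))"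
    using lin by (auto simp: linear_on_def membed_linear)
  moreover have "G (F (membed n (tmult n s t))) = mmult (G (F (membed n s))) (G (F (membed n t)))"
    if "s \<in> tpow n" "t \<in> tpow n" for s t
    using that by (simp add: mmult_membed[symmetric] Fm Gm FM)
  ultimately have "nd_hom n l (\<lambda>t. G (F (membed n t)))"
    unfolding nd_hom_def by (auto simp: FM GM)
  then show ?thesis using lin by (simp add: strict_hom_def FM GM Fm Gm)
qed

text \<open>Both F y and G y solve z F(x) = F(y x) for all tensors x, because F and G agree on
  tensors; nondegeneracy leaves one solution. Equations between composites of inner maps are reduced
  to elementary tensors by this lemma.\<close>

lemma strict_hom_eqI:
  assumes F: "strict_hom n m F" and G: "strict_hom n m G"
    and eq: "\<And>xs. length xs = n \<Longrightarrow> F (membed n (pure xs)) = G (membed n (pure xs))"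
    and y: "y \<in> multipliers n"
  shows "F y = G y"
proof (rule nd_hom_eqI[where f = "\<lambda>t. F (membed n t)" and n = n and m = m])
  show nd: "nd_hom n m (\<lambda>t. F (membed n t))" and "F y \<in> multipliers m" "G y \<in> multipliers m"
    using F G y by (auto simp: strict_hom_def)
  have lG: "linear_on (tpow n) (\<lambda>t. G (membed n t))" using G by (auto simp: strict_hom_def nd_hom_def)
  have eq': "F (membed n t) = G (membed n t)" if "t \<in> tpow n" for t
    by (rule linear_on_tpow_eq[OF nd_hom_linear[OF nd] lG eq that])
  fix xs :: "'a list" assume xs: "length xs = n"
  have "mmult (F y) (F (membed n (pure xs))) = F (membed n (fst y (pure xs)))"
    using F y xs by (simp add: strict_hom_def mmult_membed_right[symmetric])
  moreover have "mmult (G y) (G (membed n (pure xs))) = G (membed n (fst y (pure xs)))"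
    using G y xs by (simp add: strict_hom_def mmult_membed_right[symmetric])
  ultimately show "mmult (F y) (F (membed n (pure xs))) = mmult (G y) (F (membed n (pure xs)))"
    using xs y by (simp add: eq')
qed

end

section \<open>Homomorphisms acting on one tensor factor\<close>

lemma multilinear_cong:
  assumes "multilinear n f" "\<And>xs. length xs = n \<Longrightarrow> f xs = g xs"
  shows "multilinear n g"
proof (rule multilinearI)
  fix xs ys :: "'a list" and a b c
  assume len: "Suc (length xs + length ys) = n"
  then have *: "g (xs @ d # ys) = f (xs @ d # ys)" for d using assms(2)[of "xs @ d # ys"] by simp
  show "g (xs @ (a + b) # ys) = g (xs @ a # ys) + g (xs @ b # ys)"
    by (simp only: * multilinear_add[OF assms(1) len])
  show "g (xs @ (c *\<^sub>C a) # ys) = c *\<^sub>C g (xs @ a # ys)"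
    by (simp only: * multilinear_scale[OF assms(1) len])
qed

lemma drop_1_Cons [simp]: "drop 1 (x # xs) = xs"
  by (simp add: drop_Cons')

lemma list_split_at:
  assumes "length zs = p + (1 + q)"
  obtains as a bs where "zs = as @ a # bs" "length as = p" "length bs = q"
proof -
  have "p < length zs" using assms by simp
  from id_take_nth_drop[OF this] that[of "take p zs" "zs ! p" "drop (Suc p) zs"] assms show thesis by simp
qed

text \<open>\<open>leg \<phi> k p q\<close> lets \<open>\<phi> : H \<rightarrow> M(H\<^sup>k)\<close> act on the middle factor of \<open>p + 1 + q\<close> factors.  The case \<open>k = 2\<close>, \<open>\<phi> = \<Delta>\<close>
  gives the inner cofaces, the case \<open>k = 0\<close> with \<open>\<phi>\<close> the counit gives the codegeneracies.\<close>

definition leg :: "('a::complex_algebra \<Rightarrow> 'a multiplier) \<Rightarrow> nat \<Rightarrow> nat \<Rightarrow> nat \<Rightarrow> 'a tensor \<Rightarrow> 'a multiplier" where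
  "leg \<phi> k p q = tlift (p + (1 + q)) (\<lambda>xs. mbetween k (take p xs) (\<phi> (xs ! p)) (drop (Suc p) xs))"

definition leg_ext ::
  "('a::complex_algebra \<Rightarrow> 'a multiplier) \<Rightarrow> nat \<Rightarrow> nat \<Rightarrow> nat \<Rightarrow> 'a multiplier \<Rightarrow> 'a multiplier" where
  "leg_ext \<phi> k p q = hom_ext (p + (1 + q)) (p + (k + q)) (leg \<phi> k p q)"

text \<open>On the factors where nothing acts, a leg is the inclusion of H into M(H), and this
  inclusion is nondegenerate exactly if products span H.\<close>

locale idempotent_algebra = nondegenerate_algebra ty for ty :: "'a::complex_algebra itself" +
  assumes idempotent: "cspan {a * b | a b :: 'a. True} = UNIV"
begin

lemma tpow_idempotent: "tpow n \<subseteq> cspan {tmult n s t | s t :: 'a tensor. s \<in> tpow n \<and> t \<in> tpow n}"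
proof (induction n)
  case 0
  let ?S = "{tmult 0 s t | s t :: 'a tensor. s \<in> tpow 0 \<and> t \<in> tpow 0}"
  have "tmult 0 (pure []) (pure []) \<in> ?S"
    by (intro CollectI exI[of _ "pure []"] conjI refl) auto
  then have "pure [] \<in> cspan ?S" by (intro complex_vector.span_base) simp
  then show ?case by (auto elim!: tpow_0_cases intro: complex_vector.span_scale)
next
  case (Suc n)
  let ?S = "{tmult (1 + n) s t | s t :: 'a tensor. s \<in> tpow (1 + n) \<and> t \<in> tpow (1 + n)}"
  let ?T = "{tmult n s t | s t :: 'a tensor. s \<in> tpow n \<and> t \<in> tpow n}"
  note cl = complex_vector.span_zero complex_vector.span_add complex_vector.span_scale
  have 1: "tconcat 1 n (pure [a]) (tmult n u v) \<in> cspan ?S" if uv: "u \<in> tpow n" "v \<in> tpow n" for a u v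
  proof (rule complex_vector.span_induct[where x = a and S = "{a * b | a b :: 'a. True}"])
    show "a \<in> cspan {a * b | a b :: 'a. True}" by (simp only: idempotent UNIV_I)
    show "csubspace {a. tconcat 1 n (pure [a]) (tmult n u v) \<in> cspan ?S}"
      using uv by (auto simp: complex_vector.subspace_def pure_single_add pure_single_scale tconcat_linear intro: cl)
    fix c assume "c \<in> {a * b | a b :: 'a. True}"
    then obtain a b where c: "c = a * b" by blast
    have "tconcat 1 n (pure [c]) (tmult n u v) = tmult (1 + n) (tconcat 1 n (pure [a]) u) (tconcat 1 n (pure [b]) v)"
      using uv by (subst tmult_tconcat) (simp_all add: c)
    then have "tconcat 1 n (pure [c]) (tmult n u v) \<in> ?S"
      using uv by (intro CollectI exI conjI) auto
    then show "tconcat 1 n (pure [c]) (tmult n u v) \<in> cspan ?S" by (rule complex_vector.span_base)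
  qed
  have 2: "tconcat 1 n (pure [a]) t \<in> cspan ?S" if "t \<in> tpow n" for a t
  proof -
    have "t \<in> cspan ?T" using Suc that by blast
    then have "t \<in> tpow n \<and> tconcat 1 n (pure [a]) t \<in> cspan ?S"
      by (rule complex_vector.span_induct)
        (auto simp: complex_vector.subspace_def tconcat_linear intro: cl 1)
    then show ?thesis by simp
  qed
  show ?case unfolding Suc_eq_plus1_left
  proof
    fix t :: "'a tensor" assume "t \<in> tpow (1 + n)"
    then show "t \<in> cspan ?S"
    proof (induction rule: tpow_induct)
      case (pure xs)
      then obtain a ys where "xs = a # ys" "length ys = n" by (cases xs) auto
      then show ?case using 2[of "pure ys" a] by simp
    qed (auto intro: cl)
  qed
qed

lemma tpow_tmult_induct [consumes 1, case_names tmult zero add scale]: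
  assumes "t \<in> tpow n"
    and "\<And>s u. s \<in> tpow n \<Longrightarrow> u \<in> tpow n \<Longrightarrow> P (tmult n s (u :: 'a tensor))"
    and "P 0"
    and "\<And>s t. s \<in> tpow n \<Longrightarrow> t \<in> tpow n \<Longrightarrow> P s \<Longrightarrow> P t \<Longrightarrow> P (s + t)"
    and "\<And>c s. s \<in> tpow n \<Longrightarrow> P s \<Longrightarrow> P (c *\<^sub>C s)"
  shows "P t"
proof -
  have "t \<in> cspan {tmult n s t | s t :: 'a tensor. s \<in> tpow n \<and> t \<in> tpow n}"
    using assms(1) tpow_idempotent by blast
  then have "t \<in> tpow n \<and> P t"
    by (rule complex_vector.span_induct) (use assms in \<open>auto simp: complex_vector.subspace_def\<close>)
  then show ?thesis by simp
qed

lemma nd_hom_membed: "nd_hom n n (membed n :: 'a tensor \<Rightarrow> 'a multiplier)"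
proof -
  have "{tmult n w s | s w :: 'a tensor. s \<in> tpow n \<and> w \<in> tpow n} = {tmult n s t | s t. s \<in> tpow n \<and> t \<in> tpow n}"
    by blast
  then show ?thesis
    using tpow_idempotent[of n] unfolding nd_hom_def fst_membed snd_membed
    by (simp add: linear_on_membed mmult_membed)
qed

end

text \<open>Nondegeneracy is left to \<open>leg_hom\<close>: for \<Delta> it becomes available only
  through the counit, whereas coassociativity, from which the counit is built, already speaks of
  legs.\<close>

locale leg_map =
  fixes \<phi> :: "'a::complex_algebra \<Rightarrow> 'a multiplier" and k :: nat
  assumes hom_multipliers [simp]: "\<phi> a \<in> multipliers k"
    and hom_linear: "linear_on UNIV \<phi>"
begin

lemma hom_add: "\<phi> (a + b) = \<phi> a + \<phi> b" and hom_scale: "\<phi> (c *\<^sub>C a) = c *\<^sub>C \<phi> a"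
  using hom_linear by (auto simp: linear_on_def)

lemma multilinear_leg:
  "multilinear (p + (1 + q)) (\<lambda>xs. mbetween k (take p xs) (\<phi> (xs ! p)) (drop (Suc p) xs))"
proof -
  have "multilinear 1 (\<lambda>xs. \<phi> (hd xs))"
    by (rule multilinearI) (auto simp: hom_add hom_scale)
  from multilinear_split[OF bilinear_mtensor this multilinear_linear[OF linear_on_membed], of k q q]
  have *: "multilinear (1 + q) (\<lambda>zs. mtensor k q (\<phi> (hd (take 1 zs))) (membed q (pure (drop 1 zs))))" by simp
  have "multilinear (p + (1 + q)) (\<lambda>zs. mtensor p (k + q) (membed p (pure (take p zs)))
     (mtensor k q (\<phi> (hd (take 1 (drop p zs)))) (membed q (pure (drop 1 (drop p zs))))))"
    by (rule multilinear_split[OF bilinear_mtensor multilinear_linear[OF linear_on_membed] *]) auto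
  then show ?thesis
  proof (rule multilinear_cong)
    fix xs :: "'a list" assume "length xs = p + (1 + q)"
    then obtain as a bs where "xs = as @ a # bs" "length as = p" "length bs = q" by (rule list_split_at)
    then show "mtensor p (k + q) (membed p (pure (take p xs)))
     (mtensor k q (\<phi> (hd (take 1 (drop p xs)))) (membed q (pure (drop 1 (drop p xs))))) =
     mbetween k (take p xs) (\<phi> (xs ! p)) (drop (Suc p) xs)" by (simp add: mbetween_def nth_append)
  qed
qed

lemma leg_pure:
  assumes "length as = p" "length bs = q"
  shows "leg \<phi> k p q (pure (as @ a # bs)) =
    mtensor p (k + q) (membed p (pure as)) (mtensor k q (\<phi> a) (membed q (pure bs)))"
  unfolding leg_def by (subst tlift_pure[OF multilinear_leg]) (use assms in \<open>simp_all add: mbetween_def nth_append\<close>)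

lemma linear_on_leg: "linear_on (tpow (p + (1 + q))) (leg \<phi> k p q)"
  unfolding leg_def by (rule linear_on_tlift[OF multilinear_leg])

lemmas leg_add = linear_on_add[OF linear_on_leg]
  and leg_scale = linear_on_scale[OF linear_on_leg]

lemma leg_multipliers [simp]:
  assumes "t \<in> tpow (p + (1 + q))"
  shows "leg \<phi> k p q t \<in> multipliers (p + (k + q))"
proof (rule linear_on_tpow_mem[OF linear_on_leg subspace_multipliers _ assms])
  fix xs :: "'a list" assume "length xs = p + (1 + q)"
  then obtain as a bs where "xs = as @ a # bs" "length as = p" "length bs = q" by (rule list_split_at)
  then show "leg \<phi> k p q (pure xs) \<in> multipliers (p + (k + q))" by (simp add: leg_pure)
qed

lemma leg_left:
  assumes "s \<in> tpow m" "t \<in> tpow (p + (1 + q))"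
  shows "leg \<phi> k (m + p) q (tconcat m (p + (1 + q)) s t) =
    mtensor m (p + (k + q)) (membed m s) (leg \<phi> k p q t)"
proof (rule bilinear_on_tpow_eq[OF _ _ _ assms])
  have *: "tconcat m (p + (1 + q)) s t \<in> tpow (m + p + (1 + q))"
    if "s \<in> tpow m" "t \<in> tpow (p + (1 + q))" for s t :: "'a tensor" using that by (simp add: add.assoc)
  show "bilinear_on (tpow m) (tpow (p + (1 + q))) (\<lambda>s t. leg \<phi> k (m + p) q (tconcat m (p + (1 + q)) s t))"
    by (auto simp: bilinear_on_def linear_on_def tconcat_linear leg_add leg_scale *)
  show "bilinear_on (tpow m) (tpow (p + (1 + q))) (\<lambda>s t. mtensor m (p + (k + q)) (membed m s) (leg \<phi> k p q t))"
    by (auto simp: bilinear_on_def linear_on_def mtensor_linear leg_add leg_scale membed_linear)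
  fix xs ys :: "'a list"
  assume xs: "length xs = m" and ys: "length ys = p + (1 + q)"
  obtain cs c ds where 2: "ys = cs @ c # ds" "length cs = p" "length ds = q" using ys by (rule list_split_at)
  have "leg \<phi> k (m + p) q (tconcat m (p + (1 + q)) (pure xs) (pure ys)) = leg \<phi> k (m + p) q (pure ((xs @ cs) @ c # ds))"
    using xs 2 by simp
  also have "\<dots> = mtensor (m + p) (k + q) (membed (m + p) (tconcat m p (pure xs) (pure cs)))
      (mtensor k q (\<phi> c) (membed q (pure ds)))"
    using xs 2 by (subst leg_pure) simp_all
  also have "\<dots> = mtensor m (p + (k + q)) (membed m (pure xs)) (leg \<phi> k p q (pure ys))"
    using xs 2 by (simp add: mtensor_membed[symmetric] leg_pure mtensor_assoc del: tconcat_pure)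
  finally show "leg \<phi> k (m + p) q (tconcat m (p + (1 + q)) (pure xs) (pure ys)) =
    mtensor m (p + (k + q)) (membed m (pure xs)) (leg \<phi> k p q (pure ys))" .
qed

lemma leg_right:
  assumes "s \<in> tpow (p + (1 + q))" "t \<in> tpow m"
  shows "leg \<phi> k p (q + m) (tconcat (p + (1 + q)) m s t) =
    mtensor (p + (k + q)) m (leg \<phi> k p q s) (membed m t)"
proof (rule bilinear_on_tpow_eq[OF _ _ _ assms])
  have *: "tconcat (p + (1 + q)) m s t \<in> tpow (p + (1 + (q + m)))"
    if "s \<in> tpow (p + (1 + q))" "t \<in> tpow m" for s t :: "'a tensor" using that by (simp add: add.assoc)
  show "bilinear_on (tpow (p + (1 + q))) (tpow m) (\<lambda>s t. leg \<phi> k p (q + m) (tconcat (p + (1 + q)) m s t))"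
    by (auto simp: bilinear_on_def linear_on_def tconcat_linear leg_add leg_scale *)
  show "bilinear_on (tpow (p + (1 + q))) (tpow m) (\<lambda>s t. mtensor (p + (k + q)) m (leg \<phi> k p q s) (membed m t))"
    by (auto simp: bilinear_on_def linear_on_def mtensor_linear leg_add leg_scale membed_linear)
  fix ys xs :: "'a list"
  assume xs: "length xs = m" and ys: "length ys = p + (1 + q)"
  obtain cs c ds where 2: "ys = cs @ c # ds" "length cs = p" "length ds = q" using ys by (rule list_split_at)
  have "leg \<phi> k p (q + m) (tconcat (p + (1 + q)) m (pure ys) (pure xs)) = leg \<phi> k p (q + m) (pure (cs @ c # (ds @ xs)))"
    using xs 2 by simp
  also have "\<dots> = mtensor p (k + (q + m)) (membed p (pure cs))
      (mtensor k (q + m) (\<phi> c) (membed (q + m) (tconcat q m (pure ds) (pure xs))))"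
    using xs 2 by (subst leg_pure) simp_all
  also have "\<dots> = mtensor p (k + q + m) (membed p (pure cs))
      (mtensor (k + q) m (mtensor k q (\<phi> c) (membed q (pure ds))) (membed m (pure xs)))"
    using xs 2 by (simp add: mtensor_membed[symmetric] mtensor_assoc add.assoc del: tconcat_pure)
  also have "\<dots> = mtensor (p + (k + q)) m (leg \<phi> k p q (pure ys)) (membed m (pure xs))"
    using xs 2 by (subst mtensor_assoc[symmetric]) (simp_all add: leg_pure)
  finally show "leg \<phi> k p (q + m) (tconcat (p + (1 + q)) m (pure ys) (pure xs)) =
    mtensor (p + (k + q)) m (leg \<phi> k p q (pure ys)) (membed m (pure xs))" .
qed

lemma leg_single: "leg \<phi> k 0 0 (pure [a]) = \<phi> a"
  using leg_pure[of "[]" 0 "[]" 0 a] by (simp add: membed_unit)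

lemma leg_tconcat:
  assumes "s \<in> tpow p" "t \<in> tpow q"
  shows "leg \<phi> k p q (tconcat p (1 + q) s (tconcat 1 q (pure [a]) t)) =
    mtensor p (k + q) (membed p s) (mtensor k q (\<phi> a) (membed q t))"
  using leg_left[of s p "tconcat 1 q (pure [a]) t" 0 q] leg_right[of "pure [a]" 0 0 t q] assms
  by (simp add: leg_single)

end

locale leg_hom = idempotent_algebra ty + leg_map \<phi> k
  for ty :: "'a::complex_algebra itself" and \<phi> :: "'a \<Rightarrow> 'a multiplier" and k :: nat +
  assumes hom_mult: "\<phi> (a * b) = mmult (\<phi> a) (\<phi> b)"
    and hom_nd_fst: "tpow k \<subseteq> cspan {fst (\<phi> a) w | a w. w \<in> tpow k}"
    and hom_nd_snd: "tpow k \<subseteq> cspan {snd (\<phi> a) w | a w. w \<in> tpow k}"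
begin

lemma leg_tmult:
  assumes "s \<in> tpow (p + (1 + q))" "t \<in> tpow (p + (1 + q))"
  shows "leg \<phi> k p q (tmult (p + (1 + q)) s t) = mmult (leg \<phi> k p q s) (leg \<phi> k p q t)"
proof (rule bilinear_on_tpow_eq[OF _ _ _ assms])
  show "bilinear_on (tpow (p + (1 + q))) (tpow (p + (1 + q))) (\<lambda>s t. leg \<phi> k p q (tmult (p + (1 + q)) s t))"
    by (auto simp: bilinear_on_def linear_on_def tmult_linear leg_add leg_scale)
  show "bilinear_on (tpow (p + (1 + q))) (tpow (p + (1 + q))) (\<lambda>s t. mmult (leg \<phi> k p q s) (leg \<phi> k p q t))"
    by (auto simp: bilinear_on_def linear_on_def mmult_linear[of _ "p + (k + q)"] leg_add leg_scale)
  fix xs ys :: "'a list"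
  assume xs: "length xs = p + (1 + q)" and ys: "length ys = p + (1 + q)"
  obtain as a bs where 1: "xs = as @ a # bs" "length as = p" "length bs = q" using xs by (rule list_split_at)
  obtain cs c ds where 2: "ys = cs @ c # ds" "length cs = p" "length ds = q" using ys by (rule list_split_at)
  from 1 2 show "leg \<phi> k p q (tmult (p + (1 + q)) (pure xs) (pure ys)) =
      mmult (leg \<phi> k p q (pure xs)) (leg \<phi> k p q (pure ys))"
    by (simp add: leg_pure mtensor_mmult hom_mult mmult_membed)
qed

lemma tpow3_induct:
  assumes "w \<in> tpow (p + (k + q))" and W: "csubspace (W :: 'a tensor set)"
    and st: "\<And>s v t. s \<in> tpow p \<Longrightarrow> v \<in> tpow k \<Longrightarrow> t \<in> tpow q \<Longrightarrow> tconcat p (k + q) s (tconcat k q v t) \<in> W"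
  shows "w \<in> W"
  using assms(1)
proof (rule tpow_split_induct)
  fix xs ys :: "'a list" assume len: "length xs = p" "length ys = k + q"
  from len(2) have "pure ys \<in> tpow (k + q)" by simp
  then show "tconcat p (k + q) (pure xs) (pure ys) \<in> W"
    by (rule tpow_split_induct)
      (use W len st in \<open>auto simp: tconcat_linear complex_vector.subspace_def simp del: tconcat_pure\<close>)
qed (use W in \<open>auto simp: complex_vector.subspace_def\<close>)

text \<open>By idempotence the outer factors may be taken as products, and by nondegeneracy of
  \<phi> the middle part as \<phi>(a) u. Then s1 s2 \<otimes> \<phi>(a) u \<otimes> t1 t2 is the leg
  of s1 \<otimes> a \<otimes> t1 applied to s2 \<otimes> u \<otimes> t2. For the right action the
  indices 1 and 2 change roles.\<close>

lemma nd_leg: "nd_hom (p + (1 + q)) (p + (k + q)) (leg \<phi> k p q)"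
proof -
  let ?n = "p + (1 + q)" and ?m = "p + (k + q)"
  let ?A = "{fst (leg \<phi> k p q s) w | s w. s \<in> tpow ?n \<and> w \<in> tpow ?m}"
  let ?B = "{snd (leg \<phi> k p q s) w | s w. s \<in> tpow ?n \<and> w \<in> tpow ?m}"
  note cl = complex_vector.span_zero complex_vector.span_add complex_vector.span_scale
  note [simp] = tconcat_linear cl complex_vector.subspace_def
  have "tconcat p (k + q) s (tconcat k q v t) \<in> cspan ?A \<and> tconcat p (k + q) s (tconcat k q v t) \<in> cspan ?B"
    if s: "s \<in> tpow p" and v: "v \<in> tpow k" and t: "t \<in> tpow q" for s v t
    using s
  proof (induction rule: tpow_tmult_induct)
    case (tmult s1 s2)
    note s12 = tmult
    from t show ?case
    proof (induction rule: tpow_tmult_induct)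
      case (tmult t1 t2)
      note mem = s12 tmult
      let ?l = "\<lambda>v. tconcat p (k + q) (tmult p s1 s2) (tconcat k q v (tmult q t1 t2))"
      have A: "?l (fst (\<phi> a) u) \<in> cspan ?A" if u: "u \<in> tpow k" for a u
      proof -
        have "?l (fst (\<phi> a) u) = fst (leg \<phi> k p q (tconcat p (1 + q) s1 (tconcat 1 q (pure [a]) t1)))
            (tconcat p (k + q) s2 (tconcat k q u t2))"
          using mem u by (simp add: leg_tconcat fst_mtensor fst_membed)
        then show ?thesis using mem u by (intro complex_vector.span_base CollectI exI conjI) auto
      qed
      have B: "tconcat p (k + q) (tmult p s1 s2) (tconcat k q (snd (\<phi> a) u) (tmult q t1 t2)) \<in> cspan ?B"
        if u: "u \<in> tpow k" for a u
      proof -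
        have "?l (snd (\<phi> a) u) = snd (leg \<phi> k p q (tconcat p (1 + q) s2 (tconcat 1 q (pure [a]) t2)))
            (tconcat p (k + q) s1 (tconcat k q u t1))"
          using mem u by (simp add: leg_tconcat snd_mtensor snd_membed)
        then show ?thesis using mem u by (intro complex_vector.span_base CollectI exI conjI) auto
      qed
      have "v \<in> tpow k \<and> ?l v \<in> cspan ?A"
        by (rule complex_vector.span_induct[OF subsetD[OF hom_nd_fst v]]) (use mem A in auto)
      moreover have "v \<in> tpow k \<and> ?l v \<in> cspan ?B"
        by (rule complex_vector.span_induct[OF subsetD[OF hom_nd_snd v]]) (use mem B in auto)
      ultimately show ?case by simp
    qed (use s12 v in auto)
  qed (use v t in auto)
  then have "w \<in> cspan ?A" "w \<in> cspan ?B" if "w \<in> tpow ?m" for w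
    by (rule_tac tpow3_induct[OF that complex_vector.subspace_span]; auto)+
  then show ?thesis unfolding nd_hom_def
    using linear_on_leg leg_tmult leg_multipliers by blast
qed

lemma strict_hom_leg: "strict_hom (p + (1 + q)) (p + (k + q)) (leg_ext \<phi> k p q)"
  unfolding leg_ext_def by (rule strict_hom_ext[OF nd_leg])

lemma leg_ext_multipliers [simp]:
  "y \<in> multipliers (p + (1 + q)) \<Longrightarrow> leg_ext \<phi> k p q y \<in> multipliers (p + (k + q))"
  unfolding leg_ext_def by (rule hom_ext_multipliers[OF nd_leg])

lemma leg_ext_membed: "t \<in> tpow (p + (1 + q)) \<Longrightarrow> leg_ext \<phi> k p q (membed (p + (1 + q)) t) = leg \<phi> k p q t"
  unfolding leg_ext_def by (rule hom_ext_membed[OF nd_leg])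

lemma leg_ext_left:
  "y \<in> multipliers (p + (1 + q)) \<Longrightarrow> x \<in> tpow (p + (1 + q)) \<Longrightarrow>
    mmult (leg_ext \<phi> k p q y) (leg \<phi> k p q x) = leg \<phi> k p q (fst y x)"
  unfolding leg_ext_def by (rule hom_ext_left[OF nd_leg])

lemma leg_ext_mmult:
  "x \<in> multipliers (p + (1 + q)) \<Longrightarrow> y \<in> multipliers (p + (1 + q)) \<Longrightarrow>
    leg_ext \<phi> k p q (mmult x y) = mmult (leg_ext \<phi> k p q x) (leg_ext \<phi> k p q y)"
  unfolding leg_ext_def by (rule hom_ext_mmult[OF nd_leg])

lemma linear_on_leg_ext: "linear_on (multipliers (p + (1 + q))) (leg_ext \<phi> k p q)"
  unfolding leg_ext_def by (rule linear_on_hom_ext[OF nd_leg])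

lemma leg_ext_mone: "leg_ext \<phi> k p q (mone (p + (1 + q))) = mone (p + (k + q))"
  unfolding leg_ext_def by (rule hom_ext_mone[OF nd_leg])

text \<open>The product of the right-hand side with a leg splits after m factors, and
  \<open>hom_ext_unique\<close> identifies it. With its mirror image this evaluates extended maps on
  tensor products of multipliers, not only of elements of H.\<close>

lemma leg_ext_mtensor_left:
  assumes c: "c \<in> multipliers m" and y: "y \<in> multipliers (p + (1 + q))"
  shows "leg_ext \<phi> k (m + p) q (mtensor m (p + (1 + q)) c y) = mtensor m (p + (k + q)) c (leg_ext \<phi> k p q y)"
  unfolding leg_ext_def[of _ _ "m + p"]
proof (rule hom_ext_unique[OF nd_leg])
  fix xs :: "'a list" assume "length xs = m + p + (1 + q)"
  then have xs: "pure xs = tconcat m (p + (1 + q)) (pure (take m xs)) (pure (drop m xs))"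
    and [simp]: "pure (take m xs) \<in> tpow m" "pure (drop m xs) \<in> tpow (p + (1 + q))" by simp_all
  show "mmult (mtensor m (p + (k + q)) c (leg_ext \<phi> k p q y)) (leg \<phi> k (m + p) q (pure xs)) =
     leg \<phi> k (m + p) q (fst (mtensor m (p + (1 + q)) c y) (pure xs))"
    unfolding xs using c y
    by (simp add: leg_left mtensor_mmult mmult_membed_right leg_ext_left fst_mtensor del: tconcat_pure)
qed (use c y in \<open>simp_all add: add.assoc\<close>)

lemma leg_ext_mtensor_right:
  assumes c: "c \<in> multipliers m" and y: "y \<in> multipliers (p + (1 + q))"
  shows "leg_ext \<phi> k p (q + m) (mtensor (p + (1 + q)) m y c) = mtensor (p + (k + q)) m (leg_ext \<phi> k p q y) c"
  unfolding leg_ext_def[of _ _ _ "q + m"]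
proof (rule hom_ext_unique[OF nd_leg])
  fix xs :: "'a list" assume "length xs = p + (1 + (q + m))"
  then have xs: "pure xs = tconcat (p + (1 + q)) m (pure (take (p + (1 + q)) xs)) (pure (drop (p + (1 + q)) xs))"
    and [simp]: "pure (take (p + (1 + q)) xs) \<in> tpow (p + (1 + q))" "pure (drop (p + (1 + q)) xs) \<in> tpow m" by simp_all
  show "mmult (mtensor (p + (k + q)) m (leg_ext \<phi> k p q y) c) (leg \<phi> k p (q + m) (pure xs)) =
     leg \<phi> k p (q + m) (fst (mtensor (p + (1 + q)) m y c) (pure xs))"
    by (subst (1 2) xs) (use c y in \<open>simp add: leg_right mtensor_mmult mmult_membed_right leg_ext_left fst_mtensor del: tconcat_pure\<close>)
qed (use c y in \<open>simp_all add: add.assoc\<close>)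

lemma leg_ext_between:
  assumes "a \<in> multipliers p" "y \<in> multipliers 1" "b \<in> multipliers q"
  shows "leg_ext \<phi> k p q (mtensor p (1 + q) a (mtensor 1 q y b)) =
    mtensor p (k + q) a (mtensor k q (leg_ext \<phi> k 0 0 y) b)"
  using leg_ext_mtensor_left[of a p "mtensor 1 q y b" 0 q] leg_ext_mtensor_right[of b q y 0 0] assms
  by simp

lemma leg_ext_single: "leg_ext \<phi> k 0 0 (membed 1 (pure [a])) = \<phi> a"
  using leg_ext_membed[of "pure [a]" 0 0] by (simp add: leg_single)

end

text \<open>Before \<phi> acts, p + 1 + q factors stand in front of the one for \<psi>; afterwards
  there are p + k + q. This is the source of the index shifts in the cosimplicial identities. With
  \<Delta> and \<epsilon> for \<phi> and \<psi> all pairs of inner maps on different factors are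
  covered.\<close>

lemma leg_ext_commute:
  assumes "leg_hom ty \<phi> k" "leg_hom ty \<psi> l" and y: "y \<in> multipliers (p + (1 + (q + (1 + r))))"
  shows "leg_ext \<psi> l (p + (k + q)) r (leg_ext \<phi> k p (q + (1 + r)) y) =
    leg_ext \<phi> k p (q + (l + r)) (leg_ext \<psi> l (p + (1 + q)) r y)"
proof -
  interpret F: leg_hom ty \<phi> k by fact
  interpret G: leg_hom ty \<psi> l by fact
  let ?n = "p + (1 + (q + (1 + r)))" and ?m = "p + (k + (q + (l + r)))"
  have F1: "F.strict_hom ?n (p + (k + (q + (1 + r)))) (leg_ext \<phi> k p (q + (1 + r)))"
    and G2: "F.strict_hom (p + (1 + (q + (l + r)))) ?m (leg_ext \<phi> k p (q + (l + r)))"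
    by (rule F.strict_hom_leg)+
  have G1: "F.strict_hom (p + (k + (q + (1 + r)))) ?m (leg_ext \<psi> l (p + (k + q)) r)"
    using G.strict_hom_leg[of "p + (k + q)" r] by (simp add: add.assoc)
  have F2: "F.strict_hom ?n (p + (1 + (q + (l + r)))) (leg_ext \<psi> l (p + (1 + q)) r)"
    using G.strict_hom_leg[of "p + (1 + q)" r] by (simp add: add.assoc)
  show ?thesis
  proof (rule F.strict_hom_eqI[OF F.strict_hom_comp[OF F1 G1] F.strict_hom_comp[OF F2 G2] _ y])
    fix xs :: "'a list" assume "length xs = ?n"
    then obtain as a ys where 1: "xs = as @ a # ys" "length as = p" "length ys = q + (1 + r)"
      by (rule list_split_at)
    from 1(3) obtain bs b cs where 2: "ys = bs @ b # cs" "length bs = q" "length cs = r"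
      by (rule list_split_at)
    \<comment> \<open>Both composites produce the tensor in which \<phi>(a) and \<psi>(b) have
      replaced a and b.\<close>
    let ?z = "mtensor p (k + (q + (l + r))) (membed p (pure as)) (mtensor k (q + (l + r)) (\<phi> a)
       (mtensor q (l + r) (membed q (pure bs)) (mtensor l r (\<psi> b) (membed r (pure cs)))))"
    have "leg_ext \<phi> k p (q + (1 + r)) (membed ?n (pure xs)) =
       mtensor p ((k + q) + (1 + r)) (membed p (pure as)) (mtensor k (q + (1 + r)) (\<phi> a) (membed (q + (1 + r)) (pure ys)))"
      using 1 by (simp add: F.leg_ext_membed F.leg_pure add.assoc)
    also have "leg_ext \<psi> l (p + (k + q)) r \<dots> =
       mtensor p ((k + q) + (l + r)) (membed p (pure as)) (leg_ext \<psi> l (k + q) r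
         (mtensor k (q + (1 + r)) (\<phi> a) (membed (q + (1 + r)) (pure ys))))"
      using 1 by (subst G.leg_ext_mtensor_left) (simp_all add: add.assoc)
    also have "\<dots> = ?z"
      using 1 2 by (subst G.leg_ext_mtensor_left) (simp_all add: add.assoc G.leg_ext_membed G.leg_pure)
    finally have L: "leg_ext \<psi> l (p + (k + q)) r (leg_ext \<phi> k p (q + (1 + r)) (membed ?n (pure xs))) = ?z" .
    have "leg_ext \<psi> l (p + (1 + q)) r (membed ?n (pure xs)) =
       leg_ext \<psi> l (p + (1 + q)) r (membed (p + (1 + q) + (1 + r)) (pure ((as @ a # bs) @ b # cs)))"
      using 1 2 by (simp add: add.assoc)
    also have "\<dots> = mtensor (p + (1 + q)) (l + r) (membed (p + (1 + q)) (pure (as @ a # bs)))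
        (mtensor l r (\<psi> b) (membed r (pure cs)))"
      using 1 2 by (subst G.leg_ext_membed, simp, subst G.leg_pure) simp_all
    also have "leg_ext \<phi> k p (q + (l + r)) \<dots> = mtensor (p + (k + q)) (l + r)
        (leg \<phi> k p q (pure (as @ a # bs))) (mtensor l r (\<psi> b) (membed r (pure cs)))"
      using 1 2 by (subst F.leg_ext_mtensor_right) (simp_all add: F.leg_ext_membed)
    also have "\<dots> = ?z"
      using 1 2 by (simp add: F.leg_pure mtensor_assoc add.assoc)
    finally show "leg_ext \<psi> l (p + (k + q)) r (leg_ext \<phi> k p (q + (1 + r)) (membed ?n (pure xs))) =
       leg_ext \<phi> k p (q + (l + r)) (leg_ext \<psi> l (p + (1 + q)) r (membed ?n (pure xs)))"
      by (simp only: L)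
  qed
qed

section \<open>The counit of a multiplier Hopf algebra\<close>

lemma linear_on_inv_into:
  assumes W: "bij_betw W V V" and V: "csubspace V" and lin: "linear_on V W" "linear_on V f"
  shows "linear_on V (\<lambda>t. f (inv_into V W t))"
proof -
  let ?g = "inv_into V W"
  have g: "?g t \<in> V" "W (?g t) = t" if "t \<in> V" for t
    by (rule bij_betw_apply[OF bij_betw_inv_into[OF W] that])
      (rule bij_betw_inv_into_right[OF W that])
  have inj: "s = t" if "s \<in> V" "t \<in> V" "W s = W t" for s t
    using inj_onD[OF bij_betw_imp_inj_on[OF W]] that by blast
  have "linear_on V ?g"
    by (rule linear_onI; rule inj)
      (simp_all add: g linear_on_add[OF lin(1)] linear_on_scale[OF lin(1)]
        complex_vector.subspace_add[OF V] complex_vector.subspace_scale[OF V])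
  then show ?thesis by (rule linear_on_comp[OF _ lin(2)]) (rule image_subsetI, rule g(1))
qed

lemma list_length_2:
  assumes "length xs = 2" obtains a b where "xs = [a, b]"
proof -
  obtain as a bs where "xs = as @ a # bs" "length as = 1" "length bs = 0"
    by (rule list_split_at[of xs 1 0]) (use assms in auto)
  then show thesis using that by (cases as) auto
qed

lemma multilinear_2:
  assumes "\<And>a a' b. f (a + a') b = f a b + f a' b" "\<And>a b b'. f a (b + b') = f a b + f a b'"
    and "\<And>c a b. f (c *\<^sub>C a) b = c *\<^sub>C f a b" "\<And>c a b. f a (c *\<^sub>C b) = c *\<^sub>C f a b"
  shows "multilinear 2 (\<lambda>xs. f (xs ! 0) (xs ! 1))"
proof (rule multilinearI)
  fix xs ys :: "'a list" and a b c assume "Suc (length xs + length ys) = 2"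
  then consider y where "xs = []" "ys = [y]" | x where "xs = [x]" "ys = []"
    by (cases xs; cases ys) auto
  note cases = this
  show "f ((xs @ (a + b) # ys) ! 0) ((xs @ (a + b) # ys) ! 1) =
    f ((xs @ a # ys) ! 0) ((xs @ a # ys) ! 1) + f ((xs @ b # ys) ! 0) ((xs @ b # ys) ! 1)"
    by (cases rule: cases) (auto simp: nth_Cons' assms)
  show "f ((xs @ (c *\<^sub>C a) # ys) ! 0) ((xs @ (c *\<^sub>C a) # ys) ! 1) =
    c *\<^sub>C f ((xs @ a # ys) ! 0) ((xs @ a # ys) ! 1)"
    by (cases rule: cases) (auto simp: nth_Cons' assms)
qed

lemma linear_on_tpow_2_eq:
  assumes "linear_on (tpow 2) f" "linear_on (tpow 2) g"
    and "\<And>a b. f (pure [a, b]) = g (pure [a, b])" "t \<in> tpow 2"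
  shows "f t = g t"
  by (rule linear_on_tpow_eq[OF assms(1,2) _ assms(4)]) (metis list_length_2 assms(3))

lemma linear_on_tpow_2_mem:
  assumes "linear_on (tpow 2) f" "csubspace W"
    and "\<And>a b. f (pure [a, b]) \<in> W" "t \<in> tpow 2"
  shows "f t \<in> W"
  by (rule linear_on_tpow_mem[OF assms(1,2) _ assms(4)]) (metis list_length_2 assms(3))

lemma pure_2_add: "pure [a + a', b] = pure [a, b] + pure [a', b]" "pure [a, b + b'] = pure [a, b] + pure [a, b']"
  and pure_2_scale: "pure [c *\<^sub>C a, b] = c *\<^sub>C pure [a, b]" "pure [a, c *\<^sub>C b] = c *\<^sub>C pure [a, b]"
  using pure_add[of "[]" a a' "[b]"] pure_add[of "[a]" b b' "[]"]
    pure_scale[of "[]" c a "[b]"] pure_scale[of "[a]" c b "[]"] by simp_all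


text \<open>Apply f \<otimes> id with f(a - b) = 1: the difference of the two tensors becomes c
  itself, which would have to vanish.\<close>

lemma pure_2_inject_left:
  fixes a b c :: "'a::complex_algebra"
  assumes "pure [a, c] = pure [b, c]" "c \<noteq> 0"
  shows "a = b"
proof (rule ccontr)
  assume "a \<noteq> b"
  then obtain f where f: "linear_on UNIV f" "f (a - b) = (1::complex)"
    using functional_ex[of "a - b"] by auto
  have *: "slice 1 f (pure [d, c]) = f d *\<^sub>C pure [c]" for d
    using slice_tconcat[OF f(1), of "pure [c]" 1 d] by simp
  have "f (a - b) *\<^sub>C pure [c] = f a *\<^sub>C pure [c] - f b *\<^sub>C pure [c]"
    using linear_on_diff[OF f(1)] by (simp add: complex_vector.scale_left_diff_distrib)
  then have "pure [c] = pure [0]" using assms(1) f(2) by (simp add: *[symmetric] scaleC_one)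
  then show False using assms(2) by (simp only: pure_single_inject)
qed

lemma linear_on_slot:
  assumes "c \<in> multipliers 2" shows "linear_on (tpow 2) (fst c)" "linear_on (tpow 2) (snd c)"
  using multiplier_linear[OF assms] .

abbreviation mult1 :: "'a::complex_algebra \<Rightarrow> 'a multiplier" where
  "mult1 a \<equiv> mtensor 1 1 (membed 1 (pure [a])) (mone 1)"

abbreviation mult2 :: "'a::complex_algebra \<Rightarrow> 'a multiplier" where
  "mult2 a \<equiv> mtensor 1 1 (mone 1) (membed 1 (pure [a]))"

lemma mult12_multipliers [simp]: "mult1 a \<in> multipliers 2" "mult2 a \<in> multipliers 2"
  by simp_all

lemma mult12_pure [simp]:
  "fst (mult1 a) (pure [x, y]) = pure [a * x, y]" "snd (mult1 a) (pure [x, y]) = pure [x * a, y]"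
  "fst (mult2 a) (pure [x, y]) = pure [x, a * y]" "snd (mult2 a) (pure [x, y]) = pure [x, y * a]"
proof -
  have xy: "pure [x, y] = tconcat 1 1 (pure [x]) (pure [y])" by simp
  show "fst (mult1 a) (pure [x, y]) = pure [a * x, y]" "snd (mult1 a) (pure [x, y]) = pure [x * a, y]"
    "fst (mult2 a) (pure [x, y]) = pure [x, a * y]" "snd (mult2 a) (pure [x, y]) = pure [x, y * a]"
    unfolding xy by (subst fst_mtensor snd_mtensor; simp add: fst_membed snd_membed fst_mone snd_mone)+
qed

lemma mult12_linear:
  "mult1 (a + b) = mult1 a + mult1 b" "mult1 (c *\<^sub>C a) = c *\<^sub>C mult1 a"
  "mult2 (a + b) = mult2 a + mult2 b" "mult2 (c *\<^sub>C a) = c *\<^sub>C mult2 a"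
  by (simp_all add: pure_single_add pure_single_scale membed_linear mtensor_linear)

lemma mult12_mmult:
  "mmult (mult1 a) (mult2 b) = membed 2 (pure [a, b])" "mmult (mult2 b) (mult1 a) = membed 2 (pure [a, b])"
  by (simp_all add: mtensor_mmult mtensor_membed)

text \<open>Scalars are compared by letting them act on a fixed nonzero element, which
  \<open>nontrivial\<close> provides. In the theorem it comes from a nonzero value of the
  character.\<close>

locale multiplier_hopf =
  fixes \<Delta> :: "'a::complex_algebra \<Rightarrow> 'a multiplier"
  assumes mha: "multiplier_hopf_algebra \<Delta>" and nontrivial: "\<exists>a :: 'a. a \<noteq> 0"
begin

sublocale nondegenerate_algebra "TYPE('a)"
  by standard (use mha in \<open>simp add: multiplier_hopf_algebra_def\<close>)

sublocale D: leg_map \<Delta> 2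
  by standard (use mha in \<open>auto simp: multiplier_hopf_algebra_def\<close>)

lemma Delta_mult: "\<Delta> (a * b) = mmult (\<Delta> a) (\<Delta> b)"
  using mha by (simp add: multiplier_hopf_algebra_def)

lemma linear_on_mult_pair: "linear_on (tpow 2) (tlift 2 (\<lambda>xs. xs ! 0 * xs ! 1 :: 'a))"
  and mult_pair_pure: "tlift 2 (\<lambda>xs. xs ! 0 * xs ! 1) (pure [a, b]) = a * (b :: 'a)"
proof -
  have *: "multilinear 2 (\<lambda>xs. xs ! 0 * xs ! 1 :: 'a)"
    by (rule multilinear_2) (simp_all add: distrib_left distrib_right mult_scaleC_left mult_scaleC_right)
  show "linear_on (tpow 2) (tlift 2 (\<lambda>xs. xs ! 0 * xs ! 1 :: 'a))" by (rule linear_on_tlift[OF *])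
  show "tlift 2 (\<lambda>xs. xs ! 0 * xs ! 1) (pure [a, b]) = a * b" by (simp add: tlift_pure[OF *])
qed

text \<open>One argument for \<open>W_R\<close> and \<open>W_L\<close>, with h a b standing for
  \<Delta>(a)(1 \<otimes> b) or (a \<otimes> 1)\<Delta>(b). The preimage in H \<otimes> H is unique,
  so it depends bilinearly on a and b because h does.\<close>

lemma galois_map:
  fixes h :: "'a \<Rightarrow> 'a \<Rightarrow> 'a multiplier"
  assumes ex: "\<And>a b. \<exists>t\<in>tpow 2. membed 2 t = h a b"
    and lin: "\<And>a a' b. h (a + a') b = h a b + h a' b" "\<And>a b b'. h a (b + b') = h a b + h a b'"
      "\<And>c a b. h (c *\<^sub>C a) b = c *\<^sub>C h a b" "\<And>c a b. h a (c *\<^sub>C b) = c *\<^sub>C h a b"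
  defines "W \<equiv> tlift 2 (\<lambda>xs. THE t. t \<in> tpow 2 \<and> membed 2 t = h (xs ! 0) (xs ! 1))"
  shows "linear_on (tpow 2) W" "membed 2 (W (pure [a, b])) = h a b"
    "W (pure [a, b]) \<in> tpow 2"
proof -
  define w where "w a b = (THE t. t \<in> tpow 2 \<and> membed 2 t = h a b)" for a b
  have w: "w a b \<in> tpow 2 \<and> membed 2 (w a b) = h a b" for a b
    unfolding w_def by (rule theI') (use ex[of a b] membed_inject in metis)
  have eq: "w a b = t" if "t \<in> tpow 2" "membed 2 t = h a b" for t a b
    by (rule membed_inject[of _ 2]) (use w that in auto)
  have ml: "multilinear 2 (\<lambda>xs. w (xs ! 0) (xs ! 1))"
    by (rule multilinear_2; rule eq) (use w in \<open>auto simp: membed_linear lin\<close>)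
  have W: "W = tlift 2 (\<lambda>xs. w (xs ! 0) (xs ! 1))" by (simp add: W_def w_def)
  show "linear_on (tpow 2) W" unfolding W by (rule linear_on_tlift[OF ml])
  have "W (pure [a, b]) = w a b" unfolding W by (simp add: tlift_pure[OF ml])
  then show "membed 2 (W (pure [a, b])) = h a b" "W (pure [a, b]) \<in> tpow 2" using w by auto
qed

lemma linear_on_W_R: "linear_on (tpow 2) (W_R \<Delta>)"
  and membed_W_R: "membed 2 (W_R \<Delta> (pure [a, b])) = mmult (\<Delta> a) (mult2 b)"
  and W_R_pure_tpow [simp]: "W_R \<Delta> (pure [a, b]) \<in> tpow 2"
  unfolding W_R_def
  by (rule galois_map[where h = "\<lambda>a b. mmult (\<Delta> a) (mult2 b)"];
      (use mha in \<open>simp add: multiplier_hopf_algebra_def\<close>)?;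
      simp add: mult12_linear D.hom_add D.hom_scale mmult_linear[of _ 2])+

lemma linear_on_W_L: "linear_on (tpow 2) (W_L \<Delta>)"
  and membed_W_L: "membed 2 (W_L \<Delta> (pure [a, b])) = mmult (mult1 a) (\<Delta> b)"
  and W_L_pure_tpow [simp]: "W_L \<Delta> (pure [a, b]) \<in> tpow 2"
  unfolding W_L_def
  by (rule galois_map[where h = "\<lambda>a b. mmult (mult1 a) (\<Delta> b)"];
      (use mha in \<open>simp add: multiplier_hopf_algebra_def\<close>)?;
      simp add: mult12_linear D.hom_add D.hom_scale mmult_linear[of _ 2])+

lemma bij_W: "bij_betw (W_R \<Delta>) (tpow 2) (tpow 2)" "bij_betw (W_L \<Delta>) (tpow 2) (tpow 2)"
  using mha by (simp_all add: multiplier_hopf_algebra_def)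

lemma W_tpow [simp]: "t \<in> tpow 2 \<Longrightarrow> W_R \<Delta> t \<in> tpow 2" "t \<in> tpow 2 \<Longrightarrow> W_L \<Delta> t \<in> tpow 2"
  using bij_W by (auto simp: bij_betw_def)

lemma W_R_surj: assumes "t \<in> tpow 2" obtains s where "s \<in> tpow 2" "t = W_R \<Delta> s"
  using bij_W(1) assms by (auto simp: bij_betw_def)

lemma W_L_surj: assumes "t \<in> tpow 2" obtains s where "s \<in> tpow 2" "t = W_L \<Delta> s"
  using bij_W(2) assms by (auto simp: bij_betw_def)

text \<open>The definitions count positions from 1, legs count the factors in front; hence the
  successor.\<close>

lemma coprod_at_leg: "coprod_at \<Delta> (p + (1 + q)) (Suc p) = leg \<Delta> 2 p q"
  by (simp add: coprod_at_def leg_def)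

text \<open>On x \<otimes> y this is (a \<otimes> 1)\<Delta>(x) \<otimes> y. Since \<Delta> is cut
  down by a, the values lie in the third power of H and no extended map is involved.\<close>

definition left_coassoc :: "'a \<Rightarrow> 'a tensor \<Rightarrow> 'a tensor" where
  "left_coassoc a = tlift 2 (\<lambda>xs. tconcat 2 1 (W_L \<Delta> (pure [a, xs ! 0])) (pure [xs ! 1]))"

definition right_coassoc :: "'a \<Rightarrow> 'a tensor \<Rightarrow> 'a tensor" where
  "right_coassoc c = tlift 2 (\<lambda>xs. tconcat 1 2 (pure [xs ! 0]) (W_R \<Delta> (pure [xs ! 1, c])))"

lemma coassoc_maps:
  shows linear_on_left_coassoc: "linear_on (tpow 2) (left_coassoc a)"
    and left_coassoc_pure: "left_coassoc a (pure [x, y]) = tconcat 2 1 (W_L \<Delta> (pure [a, x])) (pure [y])"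
    and linear_on_right_coassoc: "linear_on (tpow 2) (right_coassoc c)"
    and right_coassoc_pure: "right_coassoc c (pure [x, y]) = tconcat 1 2 (pure [x]) (W_R \<Delta> (pure [y, c]))"
proof -
  have 1: "multilinear 2 (\<lambda>xs. tconcat 2 1 (W_L \<Delta> (pure [a, xs ! 0])) (pure [xs ! 1]))"
    by (rule multilinear_2)
      (simp_all add: pure_2_add pure_2_scale pure_single_add pure_single_scale tconcat_linear
        linear_on_add[OF linear_on_W_L] linear_on_scale[OF linear_on_W_L])
  have 2: "multilinear 2 (\<lambda>xs. tconcat 1 2 (pure [xs ! 0]) (W_R \<Delta> (pure [xs ! 1, c])))"
    by (rule multilinear_2)
      (simp_all add: pure_2_add pure_2_scale pure_single_add pure_single_scale tconcat_linear
        linear_on_add[OF linear_on_W_R] linear_on_scale[OF linear_on_W_R])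
  show "linear_on (tpow 2) (left_coassoc a)" "linear_on (tpow 2) (right_coassoc c)"
    unfolding left_coassoc_def right_coassoc_def by (rule linear_on_tlift[OF 1] linear_on_tlift[OF 2])+
  show "left_coassoc a (pure [x, y]) = tconcat 2 1 (W_L \<Delta> (pure [a, x])) (pure [y])"
    "right_coassoc c (pure [x, y]) = tconcat 1 2 (pure [x]) (W_R \<Delta> (pure [y, c]))"
    unfolding left_coassoc_def right_coassoc_def by (simp_all add: tlift_pure[OF 1] tlift_pure[OF 2])
qed

lemma coassoc_tpow:
  assumes "t \<in> tpow 2"
  shows left_coassoc_tpow: "left_coassoc a t \<in> tpow 3" and right_coassoc_tpow: "right_coassoc c t \<in> tpow 3"
  by (rule linear_on_tpow_2_mem[OF linear_on_left_coassoc subspace_tpow _ assms]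
      linear_on_tpow_2_mem[OF linear_on_right_coassoc subspace_tpow _ assms],
      simp add: left_coassoc_pure right_coassoc_pure)+

lemma membed_left_coassoc:
  assumes "t \<in> tpow 2"
  shows "membed 3 (left_coassoc a t) =
    mmult (mtensor 1 2 (membed 1 (pure [a])) (mone 2)) (leg \<Delta> 2 0 1 t)"
proof (rule linear_on_tpow_2_eq[OF _ _ _ assms])
  show "linear_on (tpow 2) (\<lambda>t. membed 3 (left_coassoc a t))"
    by (rule linear_on_comp[OF linear_on_left_coassoc linear_on_membed]) (auto intro: left_coassoc_tpow)
  have [simp]: "leg \<Delta> 2 0 1 t \<in> multipliers 3" if "t \<in> tpow 2" for t
    using D.leg_multipliers[of t 0 1] that by simp
  show "linear_on (tpow 2) (\<lambda>t. mmult (mtensor 1 2 (membed 1 (pure [a])) (mone 2)) (leg \<Delta> 2 0 1 t))"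
    using D.leg_add[of _ 0 1] D.leg_scale[of _ 0 1] by (intro linear_onI) (simp_all add: mmult_linear[of _ 3])
  fix x y
  have "mtensor 1 2 (membed 1 (pure [a])) (mone 2) =
      mtensor (1 + 1) 1 (mtensor 1 1 (membed 1 (pure [a])) (mone 1)) (mone 1)"
    by (subst mtensor_assoc) (simp_all add: mtensor_mone)
  then show "membed 3 (left_coassoc a (pure [x, y])) =
     mmult (mtensor 1 2 (membed 1 (pure [a])) (mone 2)) (leg \<Delta> 2 0 1 (pure [x, y]))"
    using D.leg_pure[of "[]" 0 "[y]" 1 x]
    by (simp add: membed_unit left_coassoc_pure mtensor_mmult membed_W_L[symmetric] mtensor_membed)
qed

lemma membed_right_coassoc:
  assumes "t \<in> tpow 2"
  shows "membed 3 (right_coassoc c t) =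
    mmult (leg \<Delta> 2 1 0 t) (mtensor 2 1 (mone 2) (membed 1 (pure [c])))"
proof (rule linear_on_tpow_2_eq[OF _ _ _ assms])
  show "linear_on (tpow 2) (\<lambda>t. membed 3 (right_coassoc c t))"
    by (rule linear_on_comp[OF linear_on_right_coassoc linear_on_membed]) (auto intro: right_coassoc_tpow)
  have [simp]: "leg \<Delta> 2 1 0 t \<in> multipliers 3" if "t \<in> tpow 2" for t
    using D.leg_multipliers[of t 1 0] that by simp
  show "linear_on (tpow 2) (\<lambda>t. mmult (leg \<Delta> 2 1 0 t) (mtensor 2 1 (mone 2) (membed 1 (pure [c]))))"
    using D.leg_add[of _ 1 0] D.leg_scale[of _ 1 0] by (intro linear_onI) (simp_all add: mmult_linear[of _ 3])
  fix x y
  have "mtensor 2 1 (mone 2) (membed 1 (pure [c])) =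
      mtensor 1 2 (mone 1) (mtensor 1 1 (mone 1) (membed 1 (pure [c])))"
    using mtensor_assoc[of "mone 1" 1 "mone 1" 1 "membed 1 (pure [c])" 1] by (simp add: mtensor_mone)
  then show "membed 3 (right_coassoc c (pure [x, y])) =
     mmult (leg \<Delta> 2 1 0 (pure [x, y])) (mtensor 2 1 (mone 2) (membed 1 (pure [c])))"
    using D.leg_pure[of "[x]" 1 "[]" 0 y]
    by (simp add: membed_unit right_coassoc_pure mtensor_mmult membed_W_R[symmetric] mtensor_membed)
qed

text \<open>The axiom equates two multipliers; both come from tensors of degree 3, which agree by
  \<open>membed_inject\<close>.\<close>

lemma coassoc: "left_coassoc a (W_R \<Delta> (pure [b, c])) = right_coassoc c (W_L \<Delta> (pure [a, b]))"
proof (rule membed_inject[of _ 3])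
  have "coprod_at \<Delta> 2 1 = leg \<Delta> 2 0 1" "coprod_at \<Delta> 2 2 = leg \<Delta> 2 1 0"
    using coprod_at_leg[of 0 1] coprod_at_leg[of 1 0] by simp_all
  then have "mmult (mtensor 1 2 (membed 1 (pure [a])) (mone 2)) (leg \<Delta> 2 0 1 (W_R \<Delta> (pure [b, c]))) =
        mmult (leg \<Delta> 2 1 0 (W_L \<Delta> (pure [a, b]))) (mtensor 2 1 (mone 2) (membed 1 (pure [c])))"
    using mha by (simp add: multiplier_hopf_algebra_def)
  then show "membed 3 (left_coassoc a (W_R \<Delta> (pure [b, c]))) = membed 3 (right_coassoc c (W_L \<Delta> (pure [a, b])))"
    by (simp add: membed_left_coassoc membed_right_coassoc)
qed (simp_all add: left_coassoc_tpow right_coassoc_tpow)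

section \<open>The map \<kappa> and the counit\<close>

definition kappa :: "'a tensor \<Rightarrow> 'a" where
  "kappa t = tlift 2 (\<lambda>xs. xs ! 0 * xs ! 1) (inv_into (tpow 2) (W_R \<Delta>) t)"

lemma kappa_W_R: "t \<in> tpow 2 \<Longrightarrow> kappa (W_R \<Delta> t) = tlift 2 (\<lambda>xs. xs ! 0 * xs ! 1) t"
  using bij_W(1) by (simp add: kappa_def bij_betw_def inv_into_f_f)

lemma linear_on_kappa: "linear_on (tpow 2) kappa"
  unfolding kappa_def[abs_def]
  by (rule linear_on_inv_into[OF bij_W(1) subspace_tpow linear_on_W_R linear_on_mult_pair])

definition id_kappa :: "'a tensor \<Rightarrow> 'a tensor" where
  "id_kappa = tlift (1 + 2) (\<lambda>zs. tconcat 1 1 (pure (take 1 zs)) (pure [kappa (pure (drop 1 zs))]))"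

lemma multilinear_id_kappa:
  "multilinear (1 + 2) (\<lambda>zs. tconcat 1 1 (pure (take 1 zs)) (pure [kappa (pure (drop 1 zs))]))"
proof (rule multilinear_split[where f = pure and g = "\<lambda>ys. pure [kappa (pure ys)]", OF bilinear_tconcat multilinear_pure])
  have "linear_on (tpow 2) (\<lambda>t. pure [kappa t])"
    using linear_on_kappa by (simp add: linear_on_def pure_single_add pure_single_scale)
  then show "multilinear 2 (\<lambda>ys. pure [kappa (pure ys)])" by (rule multilinear_linear)
qed simp_all

lemma linear_on_id_kappa: "linear_on (tpow 3) id_kappa"
  using linear_on_tlift[OF multilinear_id_kappa] by (simp add: id_kappa_def)

lemma id_kappa_tconcat:
  assumes "t \<in> tpow 2"
  shows "id_kappa (tconcat 1 2 (pure [x]) t) = pure [x, kappa t]"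
proof (rule linear_on_tpow_2_eq[OF _ _ _ assms])
  show "linear_on (tpow 2) (\<lambda>t. id_kappa (tconcat 1 2 (pure [x]) t))"
    by (rule linear_on_comp[OF bilinear_on_right[OF bilinear_tconcat] linear_on_id_kappa]) auto
  show "linear_on (tpow 2) (\<lambda>t. pure [x, kappa t])"
    using linear_on_kappa by (simp add: linear_on_def pure_2_add pure_2_scale)
  show "id_kappa (tconcat 1 2 (pure [x]) (pure [a, b])) = pure [x, kappa (pure [a, b])]" for a b
    using tlift_pure[OF multilinear_id_kappa, of "[x, a, b]"] by (simp add: id_kappa_def take_Cons')
qed

text \<open>Up to the product, \<kappa> undoes \<open>W_R\<close>: the tensor x \<otimes> W_R(y
  \<otimes> c) goes to x \<otimes> y c.\<close>

lemma id_kappa_right_coassoc: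
  assumes "t \<in> tpow 2"
  shows "id_kappa (right_coassoc c t) = snd (mult2 c) t"
proof (rule linear_on_tpow_2_eq[OF _ _ _ assms])
  show "linear_on (tpow 2) (\<lambda>t. id_kappa (right_coassoc c t))"
    by (rule linear_on_comp[OF linear_on_right_coassoc linear_on_id_kappa]) (auto intro: right_coassoc_tpow)
  show "linear_on (tpow 2) (snd (mult2 c))" by (rule linear_on_slot) simp
  show "id_kappa (right_coassoc c (pure [a, b])) = snd (mult2 c) (pure [a, b])" for a b
    by (simp add: right_coassoc_pure id_kappa_tconcat kappa_W_R mult_pair_pure)
qed

text \<open>Both sides are (a \<otimes> 1)\<Delta>(b)(1 \<otimes> c).\<close>

lemma W_compat: "snd (mult2 c) (W_L \<Delta> (pure [a, b])) = fst (mult1 a) (W_R \<Delta> (pure [b, c]))"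
proof (rule membed_inject[of _ 2])
  have "membed 2 (snd (mult2 c) (W_L \<Delta> (pure [a, b]))) = mmult (mmult (mult1 a) (\<Delta> b)) (mult2 c)"
    by (simp add: mmult_membed_left[symmetric] membed_W_L)
  also have "\<dots> = membed 2 (fst (mult1 a) (W_R \<Delta> (pure [b, c])))"
    by (simp add: mmult_membed_right[symmetric] membed_W_R mmult_assoc)
  finally show "membed 2 (snd (mult2 c) (W_L \<Delta> (pure [a, b]))) = membed 2 (fst (mult1 a) (W_R \<Delta> (pure [b, c])))" .
qed simp_all

text \<open>Surjectivity of \<open>W_R\<close> reduces the claim to t = W_R(b \<otimes> c), where
  coassociativity exchanges the left map for the right one, which \<kappa> can evaluate.\<close>

lemma id_kappa_left_coassoc:
  assumes "t \<in> tpow 2"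
  shows "id_kappa (left_coassoc a t) = fst (mult1 a) t"
proof -
  obtain s where s: "s \<in> tpow 2" "t = W_R \<Delta> s" using assms by (rule W_R_surj)
  show ?thesis unfolding s(2)
  proof (rule linear_on_tpow_2_eq[OF _ _ _ s(1)])
    have "linear_on (tpow 2) (\<lambda>s. left_coassoc a (W_R \<Delta> s))"
      by (rule linear_on_comp[OF linear_on_W_R linear_on_left_coassoc]) auto
    then show "linear_on (tpow 2) (\<lambda>s. id_kappa (left_coassoc a (W_R \<Delta> s)))"
      by (rule linear_on_comp[OF _ linear_on_id_kappa]) (auto intro: left_coassoc_tpow)
    show "linear_on (tpow 2) (\<lambda>s. fst (mult1 a) (W_R \<Delta> s))"
      by (rule linear_on_comp[OF linear_on_W_R linear_on_slot(1)]) auto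
    show "id_kappa (left_coassoc a (W_R \<Delta> (pure [b, c]))) = fst (mult1 a) (W_R \<Delta> (pure [b, c]))" for b c
      by (simp only: coassoc id_kappa_right_coassoc W_L_pure_tpow W_compat)
  qed
qed

lemma id_kappa_W_L: "id_kappa (tconcat 2 1 (W_L \<Delta> (pure [a, b])) (pure [c])) = pure [a * b, c]"
  using id_kappa_left_coassoc[of "pure [b, c]" a] by (simp add: left_coassoc_pure)

text \<open>The coefficient of \<open>c\<close> can be read off in the first tensor factor, where it does not involve \<open>c\<close>.\<close>

lemma kappa_scalar: "\<exists>\<epsilon>. linear_on UNIV \<epsilon> \<and> (\<forall>y c. kappa (pure [y, c]) = \<epsilon> y *\<^sub>C c)"
proof -
  \<comment> \<open>The mirror image of \<open>kappa\<close>, built from \<open>W_L\<close>. It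
    turns out to be id \<otimes> \<epsilon>.\<close>
  define l where "l t = tlift 2 (\<lambda>xs. xs ! 0 * xs ! 1 :: 'a) (inv_into (tpow 2) (W_L \<Delta>) t)" for t
  have l_W: "l (W_L \<Delta> s) = tlift 2 (\<lambda>xs. xs ! 0 * xs ! 1) s" if "s \<in> tpow 2" for s
    using bij_W(2) that by (simp add: l_def bij_betw_def inv_into_f_f)
  have l_lin: "linear_on (tpow 2) l"
    unfolding l_def[abs_def]
    by (rule linear_on_inv_into[OF bij_W(2) subspace_tpow linear_on_W_L linear_on_mult_pair])
  have *: "id_kappa (tconcat 2 1 t (pure [c])) = pure [l t, c]" if t: "t \<in> tpow 2" for t c
  proof -
    obtain s where s: "s \<in> tpow 2" "t = W_L \<Delta> s" using t by (rule W_L_surj)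
    show ?thesis unfolding s(2)
    proof (rule linear_on_tpow_2_eq[OF _ _ _ s(1)])
      have "linear_on (tpow 2) (\<lambda>s. tconcat 2 1 (W_L \<Delta> s) (pure [c]))"
        by (rule linear_on_comp[OF linear_on_W_L bilinear_on_left[OF bilinear_tconcat]]) auto
      then show "linear_on (tpow 2) (\<lambda>s. id_kappa (tconcat 2 1 (W_L \<Delta> s) (pure [c])))"
        by (rule linear_on_comp[OF _ linear_on_id_kappa]) auto
      have "linear_on (tpow 2) (\<lambda>s. l (W_L \<Delta> s))" by (rule linear_on_comp[OF linear_on_W_L l_lin]) auto
      then show "linear_on (tpow 2) (\<lambda>s. pure [l (W_L \<Delta> s), c])"
        by (simp add: linear_on_def pure_2_add pure_2_scale)
      show "id_kappa (tconcat 2 1 (W_L \<Delta> (pure [a, b])) (pure [c])) = pure [l (W_L \<Delta> (pure [a, b])), c]" for a b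
        by (simp add: id_kappa_W_L l_W mult_pair_pure)
    qed
  qed
  \<comment> \<open>Two evaluations of id \<otimes> \<kappa> on x \<otimes> y \<otimes> c: the left
    one keeps x, the right one keeps c. A functional with value 1 at x0, applied to the first
    factor, then isolates \<kappa>(y \<otimes> c) as a multiple of c.\<close>
  have eq: "pure [x, kappa (pure [y, c])] = pure [l (pure [x, y]), c]" for x y c
    using *[of "pure [x, y]" c] id_kappa_tconcat[of "pure [y, c]" x] by simp
  obtain x0 :: 'a where "x0 \<noteq> 0" using nontrivial by blast
  then obtain f where f: "linear_on UNIV f" "f x0 = (1::complex)" by (rule functional_ex)
  have sl: "slice 1 f (pure [d, e]) = pure [f d *\<^sub>C e]" for d e
    using slice_tconcat[OF f(1), of "pure [e]" 1 d] by (simp add: pure_single_scale)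
  define \<epsilon> where "\<epsilon> y = f (l (pure [x0, y]))" for y
  have "kappa (pure [y, c]) = \<epsilon> y *\<^sub>C c" for y c
    using arg_cong[OF eq[of x0 y c], of "slice 1 f"] by (simp add: sl f(2) scaleC_one \<epsilon>_def)
  moreover have "linear_on UNIV \<epsilon>"
    using f(1) l_lin by (simp add: linear_on_def \<epsilon>_def pure_2_add pure_2_scale)
  ultimately show ?thesis by blast
qed

text \<open>The first counit law restates the definition of \<kappa>. The second is
  \<open>id_kappa_W_L\<close> with c cancelled. Multiplicativity comes from the effect of 1
  \<otimes> q under id \<otimes> \<epsilon>. For uniqueness, \<open>W_R\<close> is onto, so the
  first law determines \<epsilon> \<otimes> id.\<close>

lemma counit_exists: "\<exists>!\<epsilon>. is_counit \<Delta> \<epsilon>"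
proof -
  obtain \<epsilon> where lin: "linear_on UNIV \<epsilon>" and kappa: "\<And>y c. kappa (pure [y, c]) = \<epsilon> y *\<^sub>C c"
    using kappa_scalar by blast
  obtain c0 :: 'a where c0: "c0 \<noteq> 0" using nontrivial by blast
  note el [simp] = linear_on_add[OF lin] linear_on_scale[OF lin] 
  have ml1: "multilinear 2 (\<lambda>xs. e (xs ! 0) *\<^sub>C xs ! 1 :: 'a)" and ml2: "multilinear 2 (\<lambda>xs. e (xs ! 1) *\<^sub>C xs ! 0 :: 'a)"
    if "linear_on UNIV e" for e :: "'a \<Rightarrow> complex"
    using multilinear_2[of "\<lambda>x y. e x *\<^sub>C y"] multilinear_2[of "\<lambda>x y. e y *\<^sub>C x"] that
    by (simp_all add: linear_on_def scaleC_add_left scaleC_add_right scaleC_scaleC scaleC_complex_def mult.commute)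
  \<comment> \<open>\<open>e1\<close> is \<epsilon> \<otimes> id and \<open>e2\<close> is id
    \<otimes> \<epsilon>, with scalars absorbed.\<close>
  define e1 where "e1 = tlift 2 (\<lambda>xs. \<epsilon> (xs ! 0) *\<^sub>C (xs ! 1))"
  define e2 where "e2 = tlift 2 (\<lambda>xs. \<epsilon> (xs ! 1) *\<^sub>C (xs ! 0))"
  have e1: "linear_on (tpow 2) e1" "e1 (pure [a, b]) = \<epsilon> a *\<^sub>C b"
    and e2: "linear_on (tpow 2) e2" "e2 (pure [a, b]) = \<epsilon> b *\<^sub>C a" for a b
    unfolding e1_def e2_def
    by (simp_all add: linear_on_tlift[OF ml1[OF lin]] linear_on_tlift[OF ml2[OF lin]]
        tlift_pure[OF ml1[OF lin]] tlift_pure[OF ml2[OF lin]])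
  have e1_kappa: "e1 t = kappa t" if "t \<in> tpow 2" for t
    by (rule linear_on_tpow_2_eq[OF e1(1) linear_on_kappa _ that]) (simp add: e1 kappa)
  then have 1: "e1 (W_R \<Delta> (pure [a, b])) = a * b" for a b
    by (simp add: kappa_W_R mult_pair_pure)
  have "id_kappa (tconcat 2 1 t (pure [c])) = pure [e2 t, c]" if t: "t \<in> tpow 2" for t c
  proof (rule linear_on_tpow_2_eq[OF _ _ _ t])
    show "linear_on (tpow 2) (\<lambda>t. id_kappa (tconcat 2 1 t (pure [c])))"
      by (rule linear_on_comp[OF bilinear_on_left[OF bilinear_tconcat] linear_on_id_kappa]) auto
    show "linear_on (tpow 2) (\<lambda>t. pure [e2 t, c])"
      using e2(1) by (simp add: linear_on_def pure_2_add pure_2_scale)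
    show "id_kappa (tconcat 2 1 (pure [a, b]) (pure [c])) = pure [e2 (pure [a, b]), c]" for a b
      using id_kappa_tconcat[of "pure [b, c]" a] by (simp add: kappa e2 pure_2_scale)
  qed
  then have 2: "e2 (W_L \<Delta> (pure [a, b])) = a * b" for a b
    using id_kappa_W_L[of a b c0] c0 by (simp add: pure_2_inject_left)
  have e2_Delta: "e2 (snd (\<Delta> c) t) = e2 t * c" if t: "t \<in> tpow 2" for t c
  proof -
    obtain s where s: "s \<in> tpow 2" "t = W_L \<Delta> s" using t by (rule W_L_surj)
    show ?thesis unfolding s(2)
    proof (rule linear_on_tpow_2_eq[OF _ _ _ s(1)])
      have "linear_on (tpow 2) (\<lambda>s. snd (\<Delta> c) (W_L \<Delta> s))"
        by (rule linear_on_comp[OF linear_on_W_L linear_on_slot(2)]) auto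
      then show "linear_on (tpow 2) (\<lambda>s. e2 (snd (\<Delta> c) (W_L \<Delta> s)))"
        by (rule linear_on_comp[OF _ e2(1)]) (auto intro: multiplier_tpow)
      have "linear_on (tpow 2) (\<lambda>s. e2 (W_L \<Delta> s))" by (rule linear_on_comp[OF linear_on_W_L e2(1)]) auto
      then show "linear_on (tpow 2) (\<lambda>s. e2 (W_L \<Delta> s) * c)"
        by (simp add: linear_on_def distrib_right mult_scaleC_left)
      fix a b
      have "snd (\<Delta> c) (W_L \<Delta> (pure [a, b])) = W_L \<Delta> (pure [a, b * c])"
        by (rule membed_inject[of _ 2])
          (simp_all add: membed_W_L mmult_membed_left[symmetric] mmult_assoc Delta_mult)
      then show "e2 (snd (\<Delta> c) (W_L \<Delta> (pure [a, b]))) = e2 (W_L \<Delta> (pure [a, b])) * c"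
        by (simp add: 2 mult.assoc)
    qed
  qed
  \<comment> \<open>For t = W_L(p \<otimes> c) the product (1 \<otimes> q) t equals (p \<otimes>
    q)\<Delta>(c), whose image under \<open>e2\<close> is \<epsilon>(q) p c by the previous
    step.\<close>
  have e2_mult: "e2 (fst (mult2 q) t) = \<epsilon> q *\<^sub>C e2 t" if t: "t \<in> tpow 2" for t q
  proof -
    obtain s where s: "s \<in> tpow 2" "t = W_L \<Delta> s" using t by (rule W_L_surj)
    show ?thesis unfolding s(2)
    proof (rule linear_on_tpow_2_eq[OF _ _ _ s(1)])
      have "linear_on (tpow 2) (\<lambda>s. fst (mult2 q) (W_L \<Delta> s))"
        by (rule linear_on_comp[OF linear_on_W_L linear_on_slot(1)]) auto
      then show "linear_on (tpow 2) (\<lambda>s. e2 (fst (mult2 q) (W_L \<Delta> s)))"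
        by (rule linear_on_comp[OF _ e2(1)]) (auto intro: multiplier_tpow)
      have "linear_on (tpow 2) (\<lambda>s. e2 (W_L \<Delta> s))" by (rule linear_on_comp[OF linear_on_W_L e2(1)]) auto
      then show "linear_on (tpow 2) (\<lambda>s. \<epsilon> q *\<^sub>C e2 (W_L \<Delta> s))"
        by (simp add: linear_on_def scaleC_add_right scaleC_scaleC mult.commute)
      fix p c
      have "fst (mult2 q) (W_L \<Delta> (pure [p, c])) = snd (\<Delta> c) (pure [p, q])"
      proof (rule membed_inject[of _ 2])
        show "membed 2 (fst (mult2 q) (W_L \<Delta> (pure [p, c]))) = membed 2 (snd (\<Delta> c) (pure [p, q]))"
          by (simp add: mmult_membed_right[symmetric] mmult_membed_left[symmetric] membed_W_L mult12_mmult(2)[symmetric] mmult_assoc)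
      qed simp_all
      then show "e2 (fst (mult2 q) (W_L \<Delta> (pure [p, c]))) = \<epsilon> q *\<^sub>C e2 (W_L \<Delta> (pure [p, c]))"
        by (simp add: e2_Delta e2 2 mult_scaleC_left)
    qed
  qed
  have mult: "\<epsilon> (q * s) = \<epsilon> q * \<epsilon> s" for q s
  proof -
    have "\<epsilon> (q * s) *\<^sub>C c0 = (\<epsilon> q * \<epsilon> s) *\<^sub>C c0"
      using e2_mult[of "pure [c0, s]" q] by (simp add: e2 scaleC_scaleC)
    then show ?thesis using c0 by simp
  qed
  have "is_counit \<Delta> \<epsilon>" unfolding is_counit_def
    using lin mult 1 2 by (simp add: e1_def e2_def)
  moreover have "\<eta> = \<epsilon>" if \<eta>: "is_counit \<Delta> \<eta>" for \<eta>
  proof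
    fix a
    have l: "linear_on UNIV \<eta>" using \<eta> by (simp add: is_counit_def)
    let ?e = "tlift 2 (\<lambda>xs. \<eta> (xs ! 0) *\<^sub>C (xs ! 1))"
    have e: "linear_on (tpow 2) ?e" by (rule linear_on_tlift[OF ml1[OF l]])
    obtain s where s: "s \<in> tpow 2" "pure [a, c0] = W_R \<Delta> s" by (rule W_R_surj[of "pure [a, c0]"]) auto
    have "?e (W_R \<Delta> s) = kappa (W_R \<Delta> s)"
    proof (rule linear_on_tpow_2_eq[OF _ _ _ s(1)])
      show "linear_on (tpow 2) (\<lambda>s. ?e (W_R \<Delta> s))" by (rule linear_on_comp[OF linear_on_W_R e]) auto
      show "linear_on (tpow 2) (\<lambda>s. kappa (W_R \<Delta> s))" by (rule linear_on_comp[OF linear_on_W_R linear_on_kappa]) auto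
      show "?e (W_R \<Delta> (pure [a, b])) = kappa (W_R \<Delta> (pure [a, b]))" for a b
        using \<eta> by (simp add: is_counit_def kappa_W_R mult_pair_pure)
    qed
    then have "\<eta> a *\<^sub>C c0 = \<epsilon> a *\<^sub>C c0" by (simp add: s(2)[symmetric] kappa tlift_pure[OF ml1[OF l]])
    then show "\<eta> a = \<epsilon> a" using c0 by simp
  qed
  ultimately show ?thesis by blast
qed

section \<open>Consequences of the counit: idempotence, and nondegeneracy of \<Delta> and
  \<epsilon>\<close>

lemma is_counit_counit: "is_counit \<Delta> (counit \<Delta>)"
  unfolding counit_def by (rule theI'[OF counit_exists])

lemma counit_linear: "linear_on UNIV (counit \<Delta>)"
  and counit_mult: "counit \<Delta> (a * b) = counit \<Delta> a * counit \<Delta> b"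
  and counit_W_R: "tlift 2 (\<lambda>xs. counit \<Delta> (xs ! 0) *\<^sub>C (xs ! 1)) (W_R \<Delta> (pure [a, b])) = a * b"
  and counit_W_L: "tlift 2 (\<lambda>xs. counit \<Delta> (xs ! 1) *\<^sub>C (xs ! 0)) (W_L \<Delta> (pure [a, b])) = a * b"
  using is_counit_counit by (auto simp: is_counit_def)

text \<open>If \<epsilon> were zero, the counit law would make every product a b vanish, contrary to
  nondegeneracy.\<close>

lemma counit_nonzero: "\<exists>a. counit \<Delta> a = 1"
proof -
  have "\<exists>a. counit \<Delta> a \<noteq> 0"
  proof (rule ccontr)
    assume "\<nexists>a. counit \<Delta> a \<noteq> 0"
    then have z: "counit \<Delta> a = 0" for a by simp
    have "multilinear 2 (\<lambda>xs. 0 *\<^sub>C (xs ! 1 :: 'a))" by (simp add: multilinear_def)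
    then have "tlift 2 (\<lambda>xs. 0 *\<^sub>C (xs ! 1 :: 'a)) t \<in> {0}" for t
      by (rule tlift_mem) (simp_all)
    then have "a * b = 0" for a b :: 'a using counit_W_R[of a b] by (simp add: z)
    then show False using nondegenerate_left nontrivial by metis
  qed
  then obtain a where a: "counit \<Delta> a \<noteq> 0" by blast
  then have "counit \<Delta> ((1 / counit \<Delta> a) *\<^sub>C a) = 1"
    using linear_on_scale[OF counit_linear, of a] by (simp add: scaleC_complex_def)
  then show ?thesis by blast
qed

text \<open>With \<epsilon>(y) = 1 an element a is the image of y \<otimes> a under \<epsilon>
  \<otimes> id. Now y \<otimes> a is a value of \<open>W_R\<close>, and \<epsilon> \<otimes> id
  takes W_R(b \<otimes> c) to b c. So a is a sum of products.\<close>

sublocale idempotent_algebra "TYPE('a)"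
proof
  let ?S = "{a * b | a b :: 'a. True}"
  obtain y where y: "counit \<Delta> y = 1" using counit_nonzero by blast
  have ml: "multilinear 2 (\<lambda>xs. counit \<Delta> (xs ! 0) *\<^sub>C xs ! 1)"
    using multilinear_2[of "\<lambda>x y. counit \<Delta> x *\<^sub>C y"] counit_linear
    by (simp add: linear_on_def scaleC_add_left scaleC_add_right scaleC_scaleC scaleC_complex_def mult.commute)
  let ?e = "tlift 2 (\<lambda>xs. counit \<Delta> (xs ! 0) *\<^sub>C (xs ! 1))"
  have e: "linear_on (tpow 2) (\<lambda>s. ?e (W_R \<Delta> s))"
    by (rule linear_on_comp[OF linear_on_W_R linear_on_tlift[OF ml]]) auto
  have "a \<in> cspan ?S" for a
  proof -
    obtain s where s: "s \<in> tpow 2" "pure [y, a] = W_R \<Delta> s" by (rule W_R_surj[of "pure [y, a]"]) auto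
    have "?e (W_R \<Delta> s) \<in> cspan ?S"
      by (rule linear_on_tpow_2_mem[OF e complex_vector.subspace_span _ s(1)])
        (auto simp: counit_W_R intro: complex_vector.span_base)
    then show ?thesis by (simp add: s(2)[symmetric] tlift_pure[OF ml] y scaleC_one)
  qed
  then show "cspan ?S = UNIV" by blast
qed

text \<open>Since W_R(a \<otimes> b)(c \<otimes> 1) = \<Delta>(a)(c \<otimes> b), surjectivity of
  \<open>W_R\<close> puts x c \<otimes> y into the span of \<Delta>(H)(H \<otimes> H), and
  idempotence removes c. The other side uses (1 \<otimes> c) W_L(a \<otimes> b) = (a \<otimes>
  c)\<Delta>(b).\<close>

sublocale D: leg_hom "TYPE('a)" \<Delta> 2
proof
  show "\<Delta> (a * b) = mmult (\<Delta> a) (\<Delta> b)" for a b by (rule Delta_mult)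
  let ?A = "{fst (\<Delta> a) w | a w. w \<in> tpow 2}" and ?B = "{snd (\<Delta> a) w | a w. w \<in> tpow 2}"
  note cl = complex_vector.span_zero complex_vector.span_add complex_vector.span_scale
  have A: "pure [x * c, y] \<in> cspan ?A" for x c y
  proof -
    obtain s where s: "s \<in> tpow 2" "pure [x, y] = W_R \<Delta> s" by (rule W_R_surj[of "pure [x, y]"]) auto
    have "snd (mult1 c) (W_R \<Delta> s) \<in> cspan ?A"
    proof (rule linear_on_tpow_2_mem[OF linear_on_comp[OF linear_on_W_R linear_on_slot(2)] complex_vector.subspace_span _ s(1)])
      fix a b
      have "snd (mult1 c) (W_R \<Delta> (pure [a, b])) = fst (\<Delta> a) (pure [c, b])"
        by (rule membed_inject[of _ 2]) (simp_all add: mmult_membed_right[symmetric]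
          mmult_membed_left[symmetric] membed_W_R mult12_mmult(2)[symmetric] mmult_assoc)
      then show "snd (mult1 c) (W_R \<Delta> (pure [a, b])) \<in> cspan ?A"
        by (intro complex_vector.span_base CollectI exI[of _ a] exI[of _ "pure [c, b]"] conjI) simp_all
    qed auto
    then show ?thesis by (simp add: s(2)[symmetric])
  qed
  have B: "pure [x, c * y] \<in> cspan ?B" for x c y
  proof -
    obtain s where s: "s \<in> tpow 2" "pure [x, y] = W_L \<Delta> s" by (rule W_L_surj[of "pure [x, y]"]) auto
    have "fst (mult2 c) (W_L \<Delta> s) \<in> cspan ?B"
    proof (rule linear_on_tpow_2_mem[OF linear_on_comp[OF linear_on_W_L linear_on_slot(1)] complex_vector.subspace_span _ s(1)])
      fix a b
      have "fst (mult2 c) (W_L \<Delta> (pure [a, b])) = snd (\<Delta> b) (pure [a, c])"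
        by (rule membed_inject[of _ 2]) (simp_all add: mmult_membed_right[symmetric]
          mmult_membed_left[symmetric] membed_W_L mult12_mmult(2)[symmetric] mmult_assoc)
      then show "fst (mult2 c) (W_L \<Delta> (pure [a, b])) \<in> cspan ?B"
        by (intro complex_vector.span_base CollectI exI[of _ b] exI[of _ "pure [a, c]"] conjI) simp_all
    qed auto
    then show ?thesis by (simp add: s(2)[symmetric])
  qed
  have A': "pure [x, y] \<in> cspan ?A" for x y
  proof (rule complex_vector.span_induct[where x = x and S = "{a * b | a b :: 'a. True}"])
    show "x \<in> cspan {a * b | a b :: 'a. True}" by (simp only: idempotent UNIV_I)
    show "csubspace {x. pure [x, y] \<in> cspan ?A}"
      using pure_2_scale(1)[of 0 0 y] by (auto simp: complex_vector.subspace_def pure_2_add pure_2_scale intro: cl)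
  qed (use A in auto)
  show "tpow 2 \<subseteq> cspan ?A"
    by (rule subsetI, rule linear_on_tpow_2_mem[where f = "\<lambda>t. t", OF _ complex_vector.subspace_span A'])
      (simp_all add: linear_on_def)
  have B': "pure [x, y] \<in> cspan ?B" for x y
  proof (rule complex_vector.span_induct[where x = y and S = "{a * b | a b :: 'a. True}"])
    show "y \<in> cspan {a * b | a b :: 'a. True}" by (simp only: idempotent UNIV_I)
    show "csubspace {y. pure [x, y] \<in> cspan ?B}"
      using pure_2_scale(2)[of x 0 0] by (auto simp: complex_vector.subspace_def pure_2_add pure_2_scale intro: cl)
  qed (use B in auto)
  show "tpow 2 \<subseteq> cspan ?B"
    by (rule subsetI, rule linear_on_tpow_2_mem[where f = "\<lambda>t. t", OF _ complex_vector.subspace_span B'])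
      (simp_all add: linear_on_def)
qed

text \<open>The counit as a homomorphism into the multipliers of degree 0, so that applying it to a
  factor removes that factor.\<close>

definition counit_leg :: "'a \<Rightarrow> 'a multiplier" where
  "counit_leg a = counit \<Delta> a *\<^sub>C mone 0"

sublocale E: leg_hom "TYPE('a)" counit_leg 0
proof
  obtain e where e: "counit \<Delta> e = 1" using counit_nonzero by blast
  show "counit_leg a \<in> multipliers 0" for a by (simp add: counit_leg_def)
  show "linear_on UNIV counit_leg"
    using counit_linear by (simp add: linear_on_def counit_leg_def scaleC_add_left scaleC_scaleC scaleC_complex_def)
  show "counit_leg (a * b) = mmult (counit_leg a) (counit_leg b)" for a b
    by (simp add: counit_leg_def counit_mult mmult_linear[of _ 0] scaleC_scaleC mult.commute)
  have "t \<in> {fst (counit_leg a) w | a w. w \<in> tpow 0}" "t \<in> {snd (counit_leg a) w | a w. w \<in> tpow 0}"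
    if "t \<in> tpow 0" for t
    using that by (intro CollectI exI[of _ e] exI[of _ t]; simp add: counit_leg_def e scaleC_one fst_mone snd_mone)+
  then show "tpow 0 \<subseteq> cspan {fst (counit_leg a) w | a w. w \<in> tpow 0}"
    "tpow 0 \<subseteq> cspan {snd (counit_leg a) w | a w. w \<in> tpow 0}"
    by (blast intro: complex_vector.span_base)+
qed

end

section \<open>Cofaces and codegeneracies\<close>

context leg_hom
begin

text \<open>The degrees are separate variables tied by equations. The rule then matches sums of any
  shape and leaves the equations to arithmetic.\<close>

lemma leg_ext_mtensor_left':
  assumes "c \<in> multipliers m" "y \<in> multipliers N" "N = p + (1 + q)" "N' = p + (k + q)" "P = m + p"
  shows "leg_ext \<phi> k P q (mtensor m N c y) = mtensor m N' c (leg_ext \<phi> k p q y)"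
  using leg_ext_mtensor_left[of c m y p q] assms by simp

lemma leg_ext_mtensor_right':
  assumes "c \<in> multipliers m" "y \<in> multipliers N" "N = p + (1 + q)" "N' = p + (k + q)" "Q = q + m"
  shows "leg_ext \<phi> k p Q (mtensor N m y c) = mtensor N' m (leg_ext \<phi> k p q y) c"
  using leg_ext_mtensor_right[of c m y p q] assms by simp

lemma strict_hom_leg':
  "n = p + (1 + q) \<Longrightarrow> m = p + (k + q) \<Longrightarrow> strict_hom n m (leg_ext \<phi> k p q)"
  using strict_hom_leg by simp

lemma leg_ext_multipliers' [simp]:
  "y \<in> multipliers (p + (1 + q)) \<Longrightarrow> m = p + (k + q) \<Longrightarrow> leg_ext \<phi> k p q y \<in> multipliers m"
  using leg_ext_multipliers by simp

lemma leg_ext_first: "x \<in> multipliers n \<Longrightarrow> leg_ext \<phi> k 0 n (mtensor 1 n (mone 1) x) = mtensor k n (mone k) x"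
  using leg_ext_mone[of 0 0] by (simp add: leg_ext_mtensor_right'[where N' = k and q = 0])

lemma leg_ext_last: "x \<in> multipliers n \<Longrightarrow> y \<in> multipliers 1 \<Longrightarrow>
    leg_ext \<phi> k n 0 (mtensor n 1 x y) = mtensor n k x (leg_ext \<phi> k 0 0 y)"
  by (simp add: leg_ext_mtensor_left'[where N' = k and p = 0])

end

section \<open>Coassociativity and the counit laws for extended maps\<close>

context multiplier_hopf
begin

text \<open>The axiom gives this equation only between a \<otimes> 1 \<otimes> 1 on the left and 1
  \<otimes> 1 \<otimes> c on the right. Elementary tensors of degree 3 contain such factors, so
  nondegeneracy cancels first c and then a.\<close>

lemma coassoc_ext: "leg_ext \<Delta> 2 1 0 (\<Delta> b) = leg_ext \<Delta> 2 0 1 (\<Delta> b)"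
proof -
  let ?X = "leg_ext \<Delta> 2 0 1 (\<Delta> b)" and ?Y = "leg_ext \<Delta> 2 1 0 (\<Delta> b)"
  let ?l = "\<lambda>a. mtensor 1 2 (membed 1 (pure [a])) (mone 2)"
  let ?r = "\<lambda>c. mtensor 2 1 (mone 2) (membed 1 (pure [c]))"
  have X: "?X \<in> multipliers 3" and Y: "?Y \<in> multipliers 3" by simp_all
  have r: "leg_ext \<Delta> 2 0 1 (mult2 c) = ?r c" for c
    using D.leg_ext_mone[of 0 0] by (simp add: D.leg_ext_mtensor_right'[where N' = 2 and q = 0])
  have l: "leg_ext \<Delta> 2 1 0 (mult1 a) = ?l a" for a
    using D.leg_ext_mone[of 0 0] by (simp add: D.leg_ext_mtensor_left'[where N' = 2 and p = 0])
  have "mmult (mmult (?l a) ?X) (?r c) = mmult (mmult (?l a) ?Y) (?r c)" for a c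
  proof -
    have "mmult ?X (?r c) = leg \<Delta> 2 0 1 (W_R \<Delta> (pure [b, c]))"
      using D.leg_ext_mmult[of "\<Delta> b" 0 1 "mult2 c"] D.leg_ext_membed[of "W_R \<Delta> (pure [b, c])" 0 1]
      by (simp add: r membed_W_R)
    moreover have "mmult (?l a) ?Y = leg \<Delta> 2 1 0 (W_L \<Delta> (pure [a, b]))"
      using D.leg_ext_mmult[of "mult1 a" 1 0 "\<Delta> b"] D.leg_ext_membed[of "W_L \<Delta> (pure [a, b])" 1 0]
      by (simp add: l membed_W_L)
    ultimately show ?thesis
      by (simp add: mmult_assoc membed_left_coassoc[symmetric] coassoc membed_right_coassoc)
  qed
  then have lX: "mmult (?l a) ?X = mmult (?l a) ?Y" for a
  proof (rule_tac multiplier_eqI[of _ 3])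
    fix xs :: "'a list" assume xs: "length xs = 3"
    then have "length xs = 2 + (1 + 0)" by simp
    then obtain us c ds where "xs = us @ c # ds" "length us = 2" "length ds = 0" by (rule list_split_at)
    then have us: "xs = us @ [c]" "length us = 2" by simp_all
    have "membed 3 (pure xs) = mmult (?r c) (mtensor 2 1 (membed 2 (pure us)) (mone 1))"
      using us by (simp add: mtensor_mmult mtensor_membed)
    then have "mmult (mmult (?l a) ?X) (membed 3 (pure xs)) = mmult (mmult (?l a) ?Y) (membed 3 (pure xs))"
      using \<open>mmult (mmult (?l a) ?X) (?r c) = mmult (mmult (?l a) ?Y) (?r c)\<close>
      by (simp add: mmult_assoc[symmetric])
    then have "membed 3 (fst (mmult (?l a) ?X) (pure xs)) = membed 3 (fst (mmult (?l a) ?Y) (pure xs))"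
      using xs X Y by (simp add: mmult_membed_right)
    then show "fst (mmult (?l a) ?X) (pure xs) = fst (mmult (?l a) ?Y) (pure xs)"
      by (rule membed_inject[rotated 2]) (use xs X Y in \<open>auto intro!: multiplier_tpow\<close>)
  qed (use X Y in simp_all)
  show ?thesis
  proof (rule multiplier_eqI'[OF Y X])
    fix xs :: "'a list" assume xs: "length xs = 3"
    then have "length xs = 0 + (1 + 2)" by simp
    then obtain ds c us where "xs = ds @ c # us" "length ds = 0" "length us = 2" by (rule list_split_at)
    then have us: "xs = c # us" "length us = 2" by simp_all
    have *: "membed 3 (pure xs) = mmult (mtensor 1 2 (mone 1) (membed 2 (pure us))) (?l c)"
      using us by (simp add: mtensor_mmult mtensor_membed)
    have "mmult (membed 3 (pure xs)) ?Y = mmult (membed 3 (pure xs)) ?X"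
      unfolding * by (simp add: mmult_assoc lX)
    then have "membed 3 (snd ?Y (pure xs)) = membed 3 (snd ?X (pure xs))"
      using xs X Y by (simp add: mmult_membed_left)
    then show "snd ?Y (pure xs) = snd ?X (pure xs)"
      by (rule membed_inject[rotated 2]) (use xs X Y in \<open>auto intro!: multiplier_tpow\<close>)
  qed
qed

lemma Delta_Delta:
  assumes y: "y \<in> multipliers n" "n = p + (1 + q)"
  shows "leg_ext \<Delta> 2 (p + 1) q (leg_ext \<Delta> 2 p q y) = leg_ext \<Delta> 2 p (1 + q) (leg_ext \<Delta> 2 p q y)"
proof -
  have D1: "strict_hom n (p + (2 + q)) (leg_ext \<Delta> 2 p q)" by (rule D.strict_hom_leg'; simp add: y)
  have D2: "strict_hom (p + (2 + q)) (p + (3 + q)) (leg_ext \<Delta> 2 (p + 1) q)"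
     "strict_hom (p + (2 + q)) (p + (3 + q)) (leg_ext \<Delta> 2 p (1 + q))"
    by (rule D.strict_hom_leg'; simp)+
  show ?thesis
  proof (rule strict_hom_eqI[OF strict_hom_comp[OF D1 D2(1)] strict_hom_comp[OF D1 D2(2)] _ y(1)])
  fix xs :: "'a list" assume "length xs = n"
  then obtain as a bs where 1: "xs = as @ a # bs" "length as = p" "length bs = q"
    unfolding y(2) by (rule list_split_at)
  have e: "leg_ext \<Delta> 2 p q (membed n (pure xs)) =
      mtensor p (2 + q) (membed p (pure as)) (mtensor 2 q (\<Delta> a) (membed q (pure bs)))"
    using 1 y by (simp add: D.leg_ext_membed D.leg_pure)
  have "leg_ext \<Delta> 2 (p + 1) q (leg_ext \<Delta> 2 p q (membed n (pure xs))) =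
      mtensor p (3 + q) (membed p (pure as)) (mtensor 3 q (leg_ext \<Delta> 2 1 0 (\<Delta> a)) (membed q (pure bs)))"
    unfolding e using 1
    by (simp add: D.leg_ext_mtensor_left'[where p = 1 and N' = "3 + q"] D.leg_ext_mtensor_right'[where q = 0 and N' = 3])
  moreover have "leg_ext \<Delta> 2 p (1 + q) (leg_ext \<Delta> 2 p q (membed n (pure xs))) =
      mtensor p (3 + q) (membed p (pure as)) (mtensor 3 q (leg_ext \<Delta> 2 0 1 (\<Delta> a)) (membed q (pure bs)))"
    unfolding e using 1
    by (simp add: D.leg_ext_mtensor_left'[where p = 0 and N' = "3 + q"] D.leg_ext_mtensor_right'[where q = 1 and N' = 3])
  ultimately show "leg_ext \<Delta> 2 (p + 1) q (leg_ext \<Delta> 2 p q (membed n (pure xs))) =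
     leg_ext \<Delta> 2 p (1 + q) (leg_ext \<Delta> 2 p q (membed n (pure xs)))" by (simp add: coassoc_ext)
  qed
qed

lemma leg_counit_pure: "leg counit_leg 0 0 1 (pure [x, y]) = counit \<Delta> x *\<^sub>C membed 1 (pure [y])"
    "leg counit_leg 0 1 0 (pure [x, y]) = counit \<Delta> y *\<^sub>C membed 1 (pure [x])"
  using E.leg_pure[of "[]" 0 "[y]" 1 x] E.leg_pure[of "[x]" 1 "[]" 0 y]
  by (simp_all add: counit_leg_def membed_unit mtensor_linear)

text \<open>Test with b: (\<epsilon> \<otimes> id)(\<Delta>(a)) b is \<epsilon> \<otimes> id applied
  to \<Delta>(a)(1 \<otimes> b), which is a b by the counit law, and such products determine a
  multiplier. The second equation is tested from the left with \<open>W_L\<close>.\<close>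

lemma counit_Delta:
  "leg_ext counit_leg 0 0 1 (\<Delta> a) = membed 1 (pure [a])" "leg_ext counit_leg 0 1 0 (\<Delta> a) = membed 1 (pure [a])"
proof -
  have ml: "multilinear 2 (\<lambda>xs. counit \<Delta> (xs ! 0) *\<^sub>C xs ! 1)" "multilinear 2 (\<lambda>xs. counit \<Delta> (xs ! 1) *\<^sub>C xs ! 0)"
    using multilinear_2[of "\<lambda>x y. counit \<Delta> x *\<^sub>C y"] multilinear_2[of "\<lambda>x y. counit \<Delta> y *\<^sub>C x"] counit_linear
    by (simp_all add: linear_on_def scaleC_add_left scaleC_add_right scaleC_scaleC scaleC_complex_def mult.commute)
  have lin: "linear_on (tpow 2) (leg counit_leg 0 0 1)" "linear_on (tpow 2) (leg counit_leg 0 1 0)"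
    using E.linear_on_leg[of 0 1] E.linear_on_leg[of 1 0] by simp_all
  have mem: "linear_on (tpow 2) (\<lambda>t. membed 1 (pure [f t]))" if "linear_on (tpow 2) f" for f :: "'a tensor \<Rightarrow> 'a"
    using that by (simp add: linear_on_def pure_single_add pure_single_scale membed_linear)
  have 1: "leg counit_leg 0 0 1 t = membed 1 (pure [tlift 2 (\<lambda>xs. counit \<Delta> (xs ! 0) *\<^sub>C xs ! 1) t])"
    if "t \<in> tpow 2" for t
    by (rule linear_on_tpow_2_eq[OF lin(1) mem[OF linear_on_tlift[OF ml(1)]] _ that])
      (simp add: leg_counit_pure tlift_pure[OF ml(1)] pure_single_scale membed_linear)
  have 2: "leg counit_leg 0 1 0 t = membed 1 (pure [tlift 2 (\<lambda>xs. counit \<Delta> (xs ! 1) *\<^sub>C xs ! 0) t])"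
    if "t \<in> tpow 2" for t
    by (rule linear_on_tpow_2_eq[OF lin(2) mem[OF linear_on_tlift[OF ml(2)]] _ that])
      (simp add: leg_counit_pure tlift_pure[OF ml(2)] pure_single_scale membed_linear)
  let ?z = "leg_ext counit_leg 0 0 1 (\<Delta> a)" and ?z' = "leg_ext counit_leg 0 1 0 (\<Delta> a)"
  have z: "?z \<in> multipliers 1" "?z' \<in> multipliers 1" by simp_all
  have m: "leg_ext counit_leg 0 0 1 (mult2 b) = membed 1 (pure [b])"
    "leg_ext counit_leg 0 1 0 (mult1 b) = membed 1 (pure [b])" for b
    using E.leg_ext_mone[of 0 0]
    by (simp_all add: E.leg_ext_mtensor_right'[where N' = 0 and q = 0] E.leg_ext_mtensor_left'[where N' = 0 and p = 0])
  have "mmult ?z (membed 1 (pure [b])) = membed 1 (pure [a * b])" for b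
    using E.leg_ext_mmult[of "\<Delta> a" 0 1 "mult2 b"] E.leg_ext_membed[of "W_R \<Delta> (pure [a, b])" 0 1]
    by (simp add: m membed_W_R 1 counit_W_R)
  then have "membed 1 (fst ?z (pure [b])) = membed 1 (pure [a * b])" for b using z by (simp add: mmult_membed_right)
  then have f: "fst ?z (pure [b]) = pure [a * b]" for b
    by (rule membed_inject[rotated 2]) (use z in \<open>auto intro!: multiplier_tpow\<close>)
  show "?z = membed 1 (pure [a])"
    by (rule multiplier_eqI[OF z(1)]) (auto simp: fst_membed f elim!: list_split_at[of _ 0 0, simplified])
  have "mmult (membed 1 (pure [b])) ?z' = membed 1 (pure [b * a])" for b
    using E.leg_ext_mmult[of "mult1 b" 1 0 "\<Delta> a"] E.leg_ext_membed[of "W_L \<Delta> (pure [b, a])" 1 0]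
    by (simp add: m membed_W_L 2 counit_W_L)
  then have "membed 1 (snd ?z' (pure [b])) = membed 1 (pure [b * a])" for b using z by (simp add: mmult_membed_left)
  then have f: "snd ?z' (pure [b]) = pure [b * a]" for b
    by (rule membed_inject[rotated 2]) (use z in \<open>auto intro!: multiplier_tpow\<close>)
  show "?z' = membed 1 (pure [a])"
    by (rule multiplier_eqI'[OF z(2)]) (auto simp: snd_membed f elim!: list_split_at[of _ 0 0, simplified])
qed

text \<open>The composite is compared with the identity, which counts as an extended homomorphism
  because the inclusion of tensors into multipliers is nondegenerate.\<close>

lemma counit_Delta_ext:
  assumes y: "y \<in> multipliers n" "n = p + (1 + q)"
  shows "leg_ext counit_leg 0 p (1 + q) (leg_ext \<Delta> 2 p q y) = y"
    and "leg_ext counit_leg 0 (p + 1) q (leg_ext \<Delta> 2 p q y) = y"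
proof -
  have D: "strict_hom n (p + (2 + q)) (leg_ext \<Delta> 2 p q)" by (rule D.strict_hom_leg'; simp add: y)
  have E: "strict_hom (p + (2 + q)) n (leg_ext counit_leg 0 p (1 + q))"
     "strict_hom (p + (2 + q)) n (leg_ext counit_leg 0 (p + 1) q)"
    by (rule E.strict_hom_leg'; simp add: y)+
  have pure: "leg_ext counit_leg 0 p (1 + q) (leg_ext \<Delta> 2 p q (membed n (pure xs))) = membed n (pure xs) \<and>
     leg_ext counit_leg 0 (p + 1) q (leg_ext \<Delta> 2 p q (membed n (pure xs))) = membed n (pure xs)"
    if "length xs = n" for xs
  proof -
    from that obtain as a bs where 1: "xs = as @ a # bs" "length as = p" "length bs = q"
      unfolding y(2) by (rule list_split_at)
    have e: "leg_ext \<Delta> 2 p q (membed n (pure xs)) =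
        mtensor p (2 + q) (membed p (pure as)) (mtensor 2 q (\<Delta> a) (membed q (pure bs)))"
      using 1 y by (simp add: D.leg_ext_membed D.leg_pure)
    have x: "membed n (pure xs) = mtensor p (1 + q) (membed p (pure as)) (mtensor 1 q (membed 1 (pure [a])) (membed q (pure bs)))"
      using 1 y by (simp add: mtensor_membed)
    show ?thesis unfolding e unfolding x using 1(2,3)
      by (simp add: E.leg_ext_mtensor_left'[where p = 1 and N' = "1 + q"] E.leg_ext_mtensor_right'[where q = 0 and N' = 1]
        E.leg_ext_mtensor_left'[where p = 0 and N' = "1 + q"] E.leg_ext_mtensor_right'[where q = 1 and N' = 1]
        counit_Delta)
  qed
  show "leg_ext counit_leg 0 p (1 + q) (leg_ext \<Delta> 2 p q y) = y"
    by (rule strict_hom_eqI[OF strict_hom_comp[OF D E(1)] strict_hom_id[OF nd_hom_membed] _ y(1)]) (simp add: pure)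
  show "leg_ext counit_leg 0 (p + 1) q (leg_ext \<Delta> 2 p q y) = y"
    by (rule strict_hom_eqI[OF strict_hom_comp[OF D E(2)] strict_hom_id[OF nd_hom_membed] _ y(1)]) (simp add: pure)
qed

section \<open>Identification of the given maps with extended legs\<close>

lemma coprod_at_ext_leg:
  assumes y: "y \<in> multipliers n" and n: "n = p + (1 + q)" "i = Suc p"
  shows "coprod_at_ext \<Delta> n i y = leg_ext \<Delta> 2 p q y"
  unfolding coprod_at_ext_def
proof (rule the_equality)
  have c: "coprod_at \<Delta> n i = leg \<Delta> 2 p q" using n coprod_at_leg by simp
  have m: "n + 1 = p + (2 + q)" using n by simp
  have left: "mmult (leg_ext \<Delta> 2 p q y) (leg \<Delta> 2 p q x) = leg \<Delta> 2 p q (fst y x)"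
    and right: "mmult (leg \<Delta> 2 p q x) (leg_ext \<Delta> 2 p q y) = leg \<Delta> 2 p q (snd y x)" if "x \<in> tpow n" for x
    using that y n D.leg_ext_left hom_ext_right[OF D.nd_leg, folded leg_ext_def] by simp_all
  show "leg_ext \<Delta> 2 p q y \<in> multipliers (n + 1) \<and> (\<forall>x\<in>tpow n. \<forall>w\<in>tpow (n + 1).
     fst (leg_ext \<Delta> 2 p q y) (fst (coprod_at \<Delta> n i x) w) = fst (coprod_at \<Delta> n i (fst y x)) w \<and>
     snd (leg_ext \<Delta> 2 p q y) (snd (coprod_at \<Delta> n i x) w) = snd (coprod_at \<Delta> n i (snd y x)) w)"
    unfolding c using y n by (simp add: left[symmetric] right[symmetric] fst_mmult snd_mmult)
  fix z assume z: "z \<in> multipliers (n + 1) \<and> (\<forall>x\<in>tpow n. \<forall>w\<in>tpow (n + 1).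
     fst z (fst (coprod_at \<Delta> n i x) w) = fst (coprod_at \<Delta> n i (fst y x)) w \<and>
     snd z (snd (coprod_at \<Delta> n i x) w) = snd (coprod_at \<Delta> n i (snd y x)) w)"
  show "z = leg_ext \<Delta> 2 p q y"
  proof (rule nd_hom_eqI[OF D.nd_leg])
    show zM: "z \<in> multipliers (p + (2 + q))" using z unfolding m by blast
    show "leg_ext \<Delta> 2 p q y \<in> multipliers (p + (2 + q))" using y n by simp
    fix xs :: "'a list" assume xs: "length xs = p + (1 + q)"
    show "mmult z (leg \<Delta> 2 p q (pure xs)) = mmult (leg_ext \<Delta> 2 p q y) (leg \<Delta> 2 p q (pure xs))"
    proof (rule multiplier_eqI)
      show "mmult z (leg \<Delta> 2 p q (pure xs)) \<in> multipliers (p + (2 + q))"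
        "mmult (leg_ext \<Delta> 2 p q y) (leg \<Delta> 2 p q (pure xs)) \<in> multipliers (p + (2 + q))"
        using xs y[unfolded n]
        by - (rule mmult_multipliers[OF zM D.leg_multipliers], erule pure_tpow,
          rule mmult_multipliers[OF D.leg_ext_multipliers D.leg_multipliers], assumption, erule pure_tpow)
      show "fst (mmult z (leg \<Delta> 2 p q (pure xs))) (pure ys) = fst (mmult (leg_ext \<Delta> 2 p q y) (leg \<Delta> 2 p q (pure xs))) (pure ys)"
        if "length ys = p + (2 + q)" for ys
        using z xs that n unfolding m c by (simp add: left fst_mmult)
    qed
  qed
qed

lemma counit_at_leg:
  assumes n: "n = p + (1 + q)" "i = Suc p"
  shows "linear_on (tpow n) (counit_at \<Delta> n i)"
    and "t \<in> tpow n \<Longrightarrow> counit_at \<Delta> n i t \<in> tpow (p + q)"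
    and "t \<in> tpow n \<Longrightarrow> membed (p + q) (counit_at \<Delta> n i t) = leg counit_leg 0 p q t"
    and "length as = p \<Longrightarrow> length bs = q \<Longrightarrow>
      counit_at \<Delta> n i (pure (as @ a # bs)) = counit \<Delta> a *\<^sub>C pure (as @ bs)"
proof -
  let ?f = "\<lambda>xs. counit \<Delta> (xs ! (i - 1)) *\<^sub>C pure (remove_at i xs)"
  have f: "?f (as @ a # bs) = counit \<Delta> a *\<^sub>C pure (as @ bs)" if "length as = p" for as a bs
    using that n by (simp add: remove_at_def nth_append)
  have leg: "membed (p + q) (?f xs) = leg counit_leg 0 p q (pure xs)" "?f xs \<in> tpow (p + q)"
    if len: "length xs = n" for xs
  proof -
    from len obtain as a bs where xs: "xs = as @ a # bs" "length as = p" "length bs = q"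
      unfolding n by (rule list_split_at)
    then show "?f xs \<in> tpow (p + q)" using f by (simp del: One_nat_def)
    show "membed (p + q) (?f xs) = leg counit_leg 0 p q (pure xs)"
      unfolding xs(1) f[OF xs(2)] using xs(2,3)
      by (simp add: E.leg_pure counit_leg_def mtensor_linear mtensor_membed membed_linear)
  qed
  \<comment> \<open>Multilinearity is read off after embedding into multipliers, where the function
    becomes the leg of \<epsilon>, already known to be linear.\<close>
  have ml: "multilinear n ?f"
  proof (rule multilinearI; rule membed_inject[of _ "p + q"])
    fix xs ys :: "'a list" and a b c
    assume len: "Suc (length xs + length ys) = n"
    have [simp]: "?f (xs @ d # ys) \<in> tpow (p + q)" for d by (rule leg) (use len in simp)
    show "?f (xs @ (a + b) # ys) \<in> tpow (p + q)"
      "?f (xs @ a # ys) + ?f (xs @ b # ys) \<in> tpow (p + q)"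
      "?f (xs @ (c *\<^sub>C a) # ys) \<in> tpow (p + q)" "c *\<^sub>C ?f (xs @ a # ys) \<in> tpow (p + q)"
      by (intro tpow_closed leg; use len in simp)+
    have *: "pure (xs @ d # ys) \<in> tpow (p + (1 + q))" for d using len n by simp
    have **: "membed (p + q) (?f (xs @ d # ys)) = leg counit_leg 0 p q (pure (xs @ d # ys))" for d
      by (rule leg) (use len in simp)
    show "membed (p + q) (?f (xs @ (a + b) # ys)) = membed (p + q) (?f (xs @ a # ys) + ?f (xs @ b # ys))"
      by (subst membed_linear(1), (intro leg; use len in simp)+) (simp only: ** pure_add E.leg_add[OF * *])
    show "membed (p + q) (?f (xs @ (c *\<^sub>C a) # ys)) = membed (p + q) (c *\<^sub>C ?f (xs @ a # ys))"
      by (subst membed_linear(2), (intro leg; use len in simp)+) (simp only: ** pure_scale E.leg_scale[OF *])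
  qed
  show lin: "linear_on (tpow n) (counit_at \<Delta> n i)" unfolding counit_at_def by (rule linear_on_tlift[OF ml])
  have pure: "counit_at \<Delta> n i (pure xs) = ?f xs" if "length xs = n" for xs
    unfolding counit_at_def by (rule tlift_pure[OF ml that])
  show mem: "counit_at \<Delta> n i t \<in> tpow (p + q)" if "t \<in> tpow n" for t
    by (rule linear_on_tpow_mem[OF lin subspace_tpow _ that]) (simp only: pure leg)
  show "membed (p + q) (counit_at \<Delta> n i t) = leg counit_leg 0 p q t" if t: "t \<in> tpow n"
  proof (rule linear_on_tpow_eq[OF _ _ _ t])
    show "linear_on (tpow n) (\<lambda>t. membed (p + q) (counit_at \<Delta> n i t))"
      by (rule linear_on_comp[OF lin linear_on_membed]) (auto intro: mem)
    show "linear_on (tpow n) (leg counit_leg 0 p q)" unfolding n by (rule E.linear_on_leg)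
  qed (simp only: pure leg)
  show "counit_at \<Delta> n i (pure (as @ a # bs)) = counit \<Delta> a *\<^sub>C pure (as @ bs)"
    if "length as = p" "length bs = q"
    by (subst pure) (use that n in simp, rule f[OF that(1)])
qed

text \<open>The leg of \<epsilon> sends an elementary tensor to \<epsilon> of its i-th entry times
  the tensor without that entry. So the defining equations of \<open>codegeneracy\<close> are those
  of the extended leg, read inside the tensor power instead of among multipliers.\<close>

lemma codegeneracy_leg:
  assumes y: "y \<in> multipliers n" and n: "n = p + (1 + q)" "i = Suc p"
  shows "codegeneracy \<Delta> n i y = leg_ext counit_leg 0 p q y"
  unfolding codegeneracy_def
proof (rule the_equality)
  have m: "n - 1 = p + q" using n by simp
  note cl = counit_at_leg[OF n]
  have left: "mmult (leg_ext counit_leg 0 p q y) (leg counit_leg 0 p q x) = leg counit_leg 0 p q (fst y x)"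
    and right: "mmult (leg counit_leg 0 p q x) (leg_ext counit_leg 0 p q y) = leg counit_leg 0 p q (snd y x)"
    if "x \<in> tpow n" for x
    using that y n E.leg_ext_left hom_ext_right[OF E.nd_leg, folded leg_ext_def] by simp_all
  have arg: "counit \<Delta> (xs ! (i - 1)) *\<^sub>C f (pure (remove_at i xs)) = f (counit_at \<Delta> n i (pure xs))"
    if "length xs = n" "linear_on (tpow (p + q)) f" for xs and f :: "'a tensor \<Rightarrow> 'a tensor"
  proof -
    from that(1) obtain as a bs where xs: "xs = as @ a # bs" "length as = p" "length bs = q"
      unfolding n by (rule list_split_at)
    have "counit_at \<Delta> n i (pure xs) = counit \<Delta> a *\<^sub>C pure (as @ bs)" unfolding xs(1) by (rule cl(4)[OF xs(2,3)])
    moreover have "xs ! (i - 1) = a" "remove_at i xs = as @ bs"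
      using xs n by (simp_all add: remove_at_def nth_append)
    ultimately show ?thesis using linear_on_scale[OF that(2)] xs by simp
  qed
  have eqv: "(\<forall>as. length as = n \<longrightarrow>
        counit \<Delta> (as ! (i - 1)) *\<^sub>C fst z (pure (remove_at i as)) = counit_at \<Delta> n i (fst y (pure as)) \<and>
        counit \<Delta> (as ! (i - 1)) *\<^sub>C snd z (pure (remove_at i as)) = counit_at \<Delta> n i (snd y (pure as))) \<longleftrightarrow>
     (\<forall>as. length as = n \<longrightarrow> mmult z (leg counit_leg 0 p q (pure as)) = leg counit_leg 0 p q (fst y (pure as)) \<and>
        mmult (leg counit_leg 0 p q (pure as)) z = leg counit_leg 0 p q (snd y (pure as)))"
    if z: "z \<in> multipliers (p + q)" for z
  proof -
    have inj: "membed (p + q) s = membed (p + q) t \<longleftrightarrow> s = t" if "s \<in> tpow (p + q)" "t \<in> tpow (p + q)" for s t :: "'a tensor"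
      using membed_inject that by blast
    have "(counit \<Delta> (as ! (i - 1)) *\<^sub>C fst z (pure (remove_at i as)) = counit_at \<Delta> n i (fst y (pure as))) \<longleftrightarrow>
        mmult z (leg counit_leg 0 p q (pure as)) = leg counit_leg 0 p q (fst y (pure as))"
      "(counit \<Delta> (as ! (i - 1)) *\<^sub>C snd z (pure (remove_at i as)) = counit_at \<Delta> n i (snd y (pure as))) \<longleftrightarrow>
        mmult (leg counit_leg 0 p q (pure as)) z = leg counit_leg 0 p q (snd y (pure as))"
      if "length as = n" for as
      using z y that multiplier_linear[OF z] cl(2)
      by (simp_all only: arg multiplier_tpow pure_tpow cl(3)[symmetric] mmult_membed_right mmult_membed_left inj)
    then show ?thesis by simp
  qed
  let ?z = "leg_ext counit_leg 0 p q y"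
  have z: "?z \<in> multipliers (p + q)" using y n by simp
  then show "?z \<in> multipliers (n - 1) \<and> (\<forall>as. length as = n \<longrightarrow>
        counit \<Delta> (as ! (i - 1)) *\<^sub>C fst ?z (pure (remove_at i as)) = counit_at \<Delta> n i (fst y (pure as)) \<and>
        counit \<Delta> (as ! (i - 1)) *\<^sub>C snd ?z (pure (remove_at i as)) = counit_at \<Delta> n i (snd y (pure as)))"
    by (subst eqv[OF z]) (simp add: m left right)
  fix z assume a: "z \<in> multipliers (n - 1) \<and> (\<forall>as. length as = n \<longrightarrow>
        counit \<Delta> (as ! (i - 1)) *\<^sub>C fst z (pure (remove_at i as)) = counit_at \<Delta> n i (fst y (pure as)) \<and>
        counit \<Delta> (as ! (i - 1)) *\<^sub>C snd z (pure (remove_at i as)) = counit_at \<Delta> n i (snd y (pure as)))"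
  then have z': "z \<in> multipliers (p + q)" using m by simp
  have b: "\<forall>as. length as = n \<longrightarrow> mmult z (leg counit_leg 0 p q (pure as)) = leg counit_leg 0 p q (fst y (pure as))"
    using conjunct2[OF a] unfolding eqv[OF z'] by blast
  show "z = ?z"
  proof (rule nd_hom_eqI[OF E.nd_leg])
    show "z \<in> multipliers (p + (0 + q))" "?z \<in> multipliers (p + (0 + q))" using z z' by simp_all
    fix xs :: "'a list" assume "length xs = p + (1 + q)"
    then have "length xs = n" using n by simp
    then show "mmult z (leg counit_leg 0 p q (pure xs)) = mmult ?z (leg counit_leg 0 p q (pure xs))"
      using b left[of "pure xs"] by simp
  qed
qed

end

section \<open>The cosimplicial identities on all multipliers\<close>

locale grouplike_multiplier = multiplier_hopf \<Delta> for \<Delta> :: "'a::complex_algebra \<Rightarrow> 'a multiplier" +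
  fixes \<sigma> :: "'a multiplier"
  assumes grouplike_multipliers [simp]: "\<sigma> \<in> multipliers 1"
    and grouplike: "coprod_at_ext \<Delta> 1 1 \<sigma> = mtensor 1 1 \<sigma> \<sigma>"
    and grouplike_nonzero: "\<sigma> \<noteq> 0"
begin

lemma Delta_grouplike: "leg_ext \<Delta> 2 0 0 \<sigma> = mtensor 1 1 \<sigma> \<sigma>"
  using grouplike coprod_at_ext_leg[of \<sigma> 1 0 0 1] by simp

lemma counit_grouplike: "leg_ext counit_leg 0 0 0 \<sigma> = mone 0"
proof -
  have "leg_ext counit_leg 0 0 0 \<sigma> \<in> multipliers 0" by simp
  then obtain c where c: "leg_ext counit_leg 0 0 0 \<sigma> = c *\<^sub>C mone 0" by (rule multipliers_0_cases)
  have "\<sigma> = leg_ext counit_leg 0 0 1 (mtensor 1 1 \<sigma> \<sigma>)"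
    using counit_Delta_ext(1)[of \<sigma> 1 0 0] by (simp add: Delta_grouplike)
  also have "\<dots> = c *\<^sub>C \<sigma>"
    by (simp add: E.leg_ext_mtensor_right'[where N' = 0 and q = 0] c mtensor_linear)
  finally have "(1 - c) *\<^sub>C \<sigma> = 0" by (simp add: complex_vector.scale_left_diff_distrib scaleC_one)
  then show ?thesis using grouplike_nonzero c by (simp add: scaleC_one)
qed

lemma coface_first: "coface \<Delta> \<sigma> n 0 y = mtensor 1 n (mone 1) y"
  by (simp add: coface_def)

lemma coface_last: "i = n + 1 \<Longrightarrow> coface \<Delta> \<sigma> n i y = mtensor n 1 y \<sigma>"
  by (simp add: coface_def)

lemma coface_middle:
  assumes "y \<in> multipliers n" "n = p + (1 + q)" "i = p + 1"
  shows "coface \<Delta> \<sigma> n i y = leg_ext \<Delta> 2 p q y"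
  using coprod_at_ext_leg[OF assms(1,2), of i] assms(2,3) by (simp add: coface_def)

lemma coface_cases [consumes 1, case_names first middle last]:
  fixes i n :: nat
  assumes "i \<le> n + 1"
  obtains "i = 0" | p q where "i = p + 1" "n = p + (1 + q)" | "i = n + 1"
proof -
  consider "i = 0" | "0 < i" "i \<le> n" | "i = n + 1" using assms by linarith
  then show thesis
  proof cases
    case 2
    then show thesis using that(2)[of "i - 1" "n - i"] by simp
  qed (use that in auto)
qed

lemma coface_linear:
  assumes "i \<le> n + 1" shows "linear_on (multipliers n) (coface \<Delta> \<sigma> n i)"
  using assms
proof (cases rule: coface_cases)
  case first
  then show ?thesis by (simp add: linear_on_def coface_first mtensor_linear)
next
  case (middle p q)
  have "linear_on (multipliers n) (leg_ext \<Delta> 2 p q)"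
    unfolding middle(2) by (rule D.linear_on_leg_ext)
  then show ?thesis by (simp add: linear_on_def coface_middle[OF _ middle(2,1)])
next
  case last
  then show ?thesis by (simp add: linear_on_def coface_last mtensor_linear)
qed

lemma coface_multipliers:
  assumes "i \<le> n + 1" and y: "y \<in> multipliers n"
  shows "coface \<Delta> \<sigma> n i y \<in> multipliers (n + 1)"
  using assms(1)
proof (cases rule: coface_cases)
  case (middle p q)
  have "n + 1 = p + (2 + q)" using middle by simp
  then show ?thesis unfolding coface_middle[OF y middle(2,1)] using y middle(2) D.leg_ext_multipliers
    by simp
qed (use y in \<open>simp_all add: coface_first coface_last\<close>)

abbreviation codeg :: "nat \<Rightarrow> nat \<Rightarrow> 'a multiplier \<Rightarrow> 'a multiplier" where
  "codeg n j \<equiv> codegeneracy \<Delta> (n + 1) (j + 1)"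

lemma codeg_eq: "y \<in> multipliers (n + 1) \<Longrightarrow> n = p + q \<Longrightarrow> j = p \<Longrightarrow> codeg n j y = leg_ext counit_leg 0 p q y"
  by (rule codegeneracy_leg) simp_all

lemma codegeneracy_linear:
  assumes "j \<le> n" shows "linear_on (multipliers (n + 1)) (codeg n j)"
proof -
  have n: "n = j + (n - j)" "n + 1 = j + (1 + (n - j))" using assms by simp_all
  have l: "linear_on (multipliers (n + 1)) (leg_ext counit_leg 0 j (n - j))"
    unfolding n(2) by (rule E.linear_on_leg_ext)
  have e: "codeg n j y = leg_ext counit_leg 0 j (n - j) y" if "y \<in> multipliers (n + 1)" for y
    by (rule codeg_eq[OF that n(1) refl])
  show ?thesis
    by (rule linear_onI) (simp_all only: e multipliers_closed linear_on_add[OF l] linear_on_scale[OF l])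
qed

lemma codegeneracy_multipliers:
  assumes "j \<le> n" "y \<in> multipliers (n + 1)"
  shows "codeg n j y \<in> multipliers n"
proof -
  have n: "n = j + (n - j)" "n + 1 = j + (1 + (n - j))" using assms by simp_all
  have "leg_ext counit_leg 0 j (n - j) y \<in> multipliers (j + (0 + (n - j)))"
    by (rule E.leg_ext_multipliers) (use assms(2) n(2) in argo)
  then show ?thesis unfolding codeg_eq[OF assms(2) n(1) refl] using assms(1) by simp
qed

text \<open>Both i and j - 1 are first, inner or last. If an outer coface occurs, associativity or a
  leg passing by a fixed factor suffices, except where \<Delta> meets an inserted 1 or \<sigma>. Two
  inner cofaces act at the same position, which is coassociativity, or at different ones, where they
  commute.\<close>

lemma coface_coface:
  assumes ij: "i < j" "j \<le> n + 2" and x: "x \<in> multipliers n"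
  shows "coface \<Delta> \<sigma> (n + 1) j (coface \<Delta> \<sigma> n i x) = coface \<Delta> \<sigma> (n + 1) i (coface \<Delta> \<sigma> n (j - 1) x)"
    (is "?L = ?R")
proof -
  have i: "i \<le> n + 1" and j: "j - 1 \<le> n + 1" using ij by simp_all
  note dx = coface_multipliers[OF i x] and dx' = coface_multipliers[OF j x]
  show ?thesis using i
  proof (cases rule: coface_cases)
    case first
    have 1: "coface \<Delta> \<sigma> n i x = mtensor 1 n (mone 1) x" unfolding first coface_first ..
    from j show ?thesis
    proof (cases rule: coface_cases)
      case first': first
      \<comment> \<open>Here i = 0 and j = 1, and the equation amounts to \<Delta>(1) = 1 \<otimes>
        1.\<close>
      have j1: "j = 0 + 1" using ij first' by simp
      have "?L = leg_ext \<Delta> 2 0 n (coface \<Delta> \<sigma> n i x)" by (rule coface_middle[OF dx _ j1]) simp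
      also have "\<dots> = mtensor (1 + 1) n (mtensor 1 1 (mone 1) (mone 1)) x"
        unfolding 1 D.leg_ext_first[OF x] by (simp add: mtensor_mone)
      also have "\<dots> = mtensor 1 (1 + n) (mone 1) (mtensor 1 n (mone 1) x)"
        by (rule mtensor_assoc) (use x in simp_all)
      also have "\<dots> = ?R" unfolding first first' coface_first by (simp add: add.commute)
      finally show ?thesis .
    next
      case (middle p q)
      have "?L = leg_ext \<Delta> 2 (1 + p) q (coface \<Delta> \<sigma> n i x)"
        by (rule coface_middle[OF dx]) (use middle ij in linarith)+
      also have "\<dots> = mtensor 1 (n + 1) (mone 1) (leg_ext \<Delta> 2 p q x)"
        unfolding 1 by (rule D.leg_ext_mtensor_left') (use x middle in simp_all)
      also have "\<dots> = ?R" unfolding first coface_first coface_middle[OF x middle(2,1)] ..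
      finally show ?thesis .
    next
      case last
      have "?L = mtensor (1 + n) 1 (mtensor 1 n (mone 1) x) \<sigma>"
        unfolding 1 using last ij by (subst coface_last) (simp_all add: add.commute)
      also have "\<dots> = mtensor 1 (n + 1) (mone 1) (mtensor n 1 x \<sigma>)"
        by (rule mtensor_assoc) (use x in simp_all)
      also have "\<dots> = ?R" unfolding first coface_first coface_last[OF last] ..
      finally show ?thesis .
    qed
  next
    case (middle p q)
    note 1 = coface_middle[OF x middle(2,1)]
    from j show ?thesis
    proof (cases rule: coface_cases)
      case first
      then show ?thesis using ij middle by simp
    next
      case middle': (middle p' q')
      note 2 = coface_middle[OF x middle'(2,1)]
      show ?thesis
      proof (cases "p' = p")
        case True
        have q: "q' = q" using True middle middle' by simp
        have "?L = leg_ext \<Delta> 2 (p + 1) q (coface \<Delta> \<sigma> n i x)"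
          by (rule coface_middle[OF dx]) (use middle middle' True ij in linarith)+
        moreover have "?R = leg_ext \<Delta> 2 p (1 + q) (coface \<Delta> \<sigma> n (j - 1) x)"
          by (rule coface_middle[OF dx']) (use middle in linarith)+
        ultimately show ?thesis using Delta_Delta[OF x middle(2)] unfolding 1 2 True q by simp
      next
        case False
        have "p < p'" using False ij middle middle' by linarith
        \<comment> \<open>r counts the factors strictly between the two positions.\<close>
        then obtain r where "p' = Suc (p + r)" using less_imp_Suc_add by blast
        then have r: "p' = p + (1 + r)" by simp
        have q: "q = r + (1 + q')" using r middle(2) middle'(2) by linarith
        have L: "?L = leg_ext \<Delta> 2 (p + (2 + r)) q' (leg_ext \<Delta> 2 p q x)"
          unfolding 1[symmetric] by (rule coface_middle[OF dx]) (use middle middle' ij r in linarith)+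
        have R: "?R = leg_ext \<Delta> 2 p (r + (2 + q')) (leg_ext \<Delta> 2 p' q' x)"
          unfolding 2[symmetric] by (rule coface_middle[OF dx']) (use middle q in linarith)+
        show ?thesis unfolding L R unfolding r q
          by (rule leg_ext_commute[OF D.leg_hom_axioms D.leg_hom_axioms]) (use x middle(2) q in argo)
      qed
    next
      case last
      have "?L = mtensor (n + 1) 1 (leg_ext \<Delta> 2 p q x) \<sigma>"
        unfolding 1 by (rule coface_last) (use last ij in linarith)
      also have "\<dots> = leg_ext \<Delta> 2 p (q + 1) (mtensor n 1 x \<sigma>)"
        by (rule D.leg_ext_mtensor_right'[symmetric]) (use x middle in simp_all)
      also have "\<dots> = ?R" unfolding coface_last[OF last]
        by (rule coface_middle[symmetric]) (use x middle in simp_all)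
      finally show ?thesis .
    qed
  next
    case last
    \<comment> \<open>Only j = n + 2 remains: appending \<sigma> twice is compared with applying
      \<Delta> to one appended \<sigma>.\<close>
    have j': "j - 1 = n + 1" using last ij by linarith
    have "?L = mtensor (n + 1) 1 (mtensor n 1 x \<sigma>) \<sigma>"
      unfolding coface_last[OF last] by (rule coface_last) (use last ij in linarith)
    also have "\<dots> = mtensor n (1 + 1) x (mtensor 1 1 \<sigma> \<sigma>)" by (rule mtensor_assoc) (use x in simp_all)
    also have "\<dots> = leg_ext \<Delta> 2 n 0 (mtensor n 1 x \<sigma>)"
      using x by (simp add: D.leg_ext_last Delta_grouplike)
    also have "\<dots> = ?R" unfolding coface_last[OF j']
      by (rule coface_middle[symmetric]) (use x last in simp_all)
    finally show ?thesis .
  qed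
qed

text \<open>For i < j the removed factor lies behind the two produced by an inner coface, or behind
  the inserted 1, so the two maps act on different factors.\<close>

lemma codeg_coface_less:
  assumes ij: "i < j" "j \<le> n + 1" and x: "x \<in> multipliers (n + 1)"
  shows "codeg (n + 1) j (coface \<Delta> \<sigma> (n + 1) i x) = coface \<Delta> \<sigma> n i (codeg n (j - 1) x)" (is "?L = ?R")
proof -
  have dx: "coface \<Delta> \<sigma> (n + 1) i x \<in> multipliers (n + 1 + 1)"
    by (rule coface_multipliers[OF _ x]) (use ij in linarith)
  have sx: "codeg n (j - 1) x \<in> multipliers n"
    by (rule codegeneracy_multipliers[OF _ x]) (use ij in linarith)
  show ?thesis
  proof (cases "i = 0")
    case True
    define p q where "p = j - 1" and "q = n - p"
    have pq: "j = 1 + p" "n = p + q" "j - 1 = p" using ij True by (simp_all add: p_def q_def)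
    have "?L = leg_ext counit_leg 0 (1 + p) q (mtensor 1 (n + 1) (mone 1) x)"
      unfolding True coface_first[symmetric] by (rule codeg_eq) (use dx True pq in simp_all)
    also have "\<dots> = mtensor 1 n (mone 1) (leg_ext counit_leg 0 p q x)"
      by (rule E.leg_ext_mtensor_left') (use x pq in simp_all)
    also have "\<dots> = ?R" unfolding True coface_first codeg_eq[OF x pq(2,3)] ..
    finally show ?thesis .
  next
    case False
    \<comment> \<open>The factors of x in front of the doubled one, between it and the removed one,
      and behind the latter. In x itself the removed factor has j - 1 factors in front.\<close>
    define p q r where "p = i - 1" and "q = j - i - 1" and "r = n + 1 - j"
    have pq: "i = p + 1" "j = p + (2 + q)" "n = p + (1 + (q + r))"
      using ij False by (simp_all add: p_def q_def r_def)
    have n1: "n + 1 = p + (1 + (q + (1 + r)))" and n2: "n = (p + (1 + q)) + r"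
      and n3: "n + 1 = (p + (2 + q)) + r" and j1: "j - 1 = p + (1 + q)" using pq by simp_all
    have "?L = leg_ext counit_leg 0 (p + (2 + q)) r (leg_ext \<Delta> 2 p (q + (1 + r)) x)"
      unfolding coface_middle[OF x n1 pq(1), symmetric] by (rule codeg_eq[OF dx n3 pq(2)])
    also have "\<dots> = leg_ext \<Delta> 2 p (q + (0 + r)) (leg_ext counit_leg 0 (p + (1 + q)) r x)"
      by (rule leg_ext_commute[OF D.leg_hom_axioms E.leg_hom_axioms]) (use x n1 in argo)
    also have "\<dots> = leg_ext \<Delta> 2 p (q + r) (codeg n (j - 1) x)"
      unfolding codeg_eq[OF x n2 j1] by simp
    also have "\<dots> = ?R" by (rule coface_middle[OF sx pq(3,1), symmetric])
    finally show ?thesis .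
  qed
qed

text \<open>Inside, a factor is doubled and its second, respectively its first, copy is removed by
  the counit law. At the ends the removed factor is the inserted 1 or \<sigma>, on which \<epsilon>
  has value 1.\<close>

lemma codeg_coface_same:
  assumes j: "j \<le> n" and x: "x \<in> multipliers n"
  shows "codeg n j (coface \<Delta> \<sigma> n j x) = x" "codeg n j (coface \<Delta> \<sigma> n (j + 1) x) = x"
proof -
  have dx: "coface \<Delta> \<sigma> n j x \<in> multipliers (n + 1)" "coface \<Delta> \<sigma> n (j + 1) x \<in> multipliers (n + 1)"
    by (rule coface_multipliers[OF _ x]; use j in linarith)+
  show "codeg n j (coface \<Delta> \<sigma> n j x) = x"
  proof (cases "j = 0")
    case True
    have "codeg n j (coface \<Delta> \<sigma> n j x) = leg_ext counit_leg 0 0 n (coface \<Delta> \<sigma> n j x)"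
      by (rule codeg_eq[OF dx(1) _ True]) simp
    then show ?thesis unfolding True coface_first E.leg_ext_first[OF x] using x by simp
  next
    case False
    define p q where "p = j - 1" and "q = n - j"
    have pq: "j = p + 1" "n = p + (1 + q)" "n = p + 1 + q" using j False by (simp_all add: p_def q_def)
    have "codeg n j (coface \<Delta> \<sigma> n j x) = leg_ext counit_leg 0 (p + 1) q (leg_ext \<Delta> 2 p q x)"
      unfolding coface_middle[OF x pq(2,1), symmetric] by (rule codeg_eq[OF dx(1) pq(3,1)])
    then show ?thesis by (simp only: counit_Delta_ext(2)[OF x pq(2)])
  qed
  show "codeg n j (coface \<Delta> \<sigma> n (j + 1) x) = x"
  proof (cases "j = n")
    case True
    have "coface \<Delta> \<sigma> n (j + 1) x = mtensor n 1 x \<sigma>" by (rule coface_last) (simp add: True)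
    moreover have "codeg n j (coface \<Delta> \<sigma> n (j + 1) x) = leg_ext counit_leg 0 n 0 (coface \<Delta> \<sigma> n (j + 1) x)"
      by (rule codeg_eq[OF dx(2) _ True]) simp
    ultimately show ?thesis using x by (simp add: E.leg_ext_last counit_grouplike)
  next
    case False
    define q where "q = n - j - 1"
    have pq: "n = j + (1 + q)" using j False by (simp add: q_def)
    have "codeg n j (coface \<Delta> \<sigma> n (j + 1) x) = leg_ext counit_leg 0 j (1 + q) (leg_ext \<Delta> 2 j q x)"
      unfolding coface_middle[OF x pq refl, symmetric] by (rule codeg_eq[OF dx(2) pq refl])
    then show ?thesis by (simp only: counit_Delta_ext(1)[OF x pq])
  qed
qed

text \<open>The removed factor now lies in front of everything that the coface produces, so the
  commutation lemma is applied with \<epsilon> as the first map.\<close>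

lemma codeg_coface_greater:
  assumes ij: "j + 1 < i" "i \<le> n + 2" and x: "x \<in> multipliers (n + 1)"
  shows "codeg (n + 1) j (coface \<Delta> \<sigma> (n + 1) i x) = coface \<Delta> \<sigma> n (i - 1) (codeg n j x)" (is "?L = ?R")
proof -
  have dx: "coface \<Delta> \<sigma> (n + 1) i x \<in> multipliers (n + 1 + 1)"
    by (rule coface_multipliers[OF _ x]) (use ij in linarith)
  have sx: "codeg n j x \<in> multipliers n"
    by (rule codegeneracy_multipliers[OF _ x]) (use ij in linarith)
  show ?thesis
  proof (cases "i = n + 2")
    case True
    define q where "q = n - j"
    have n: "n = j + q" "n + 1 = j + (q + 1)" using ij True by (simp_all add: q_def)
    have i: "i = n + 1 + 1" "i - 1 = n + 1" using True by simp_all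
    have "?L = leg_ext counit_leg 0 j (q + 1) (mtensor (n + 1) 1 x \<sigma>)"
      unfolding coface_last[OF i(1), symmetric] by (rule codeg_eq[OF dx n(2) refl])
    also have "\<dots> = mtensor n 1 (leg_ext counit_leg 0 j q x) \<sigma>"
      by (rule E.leg_ext_mtensor_right') (use x n in simp_all)
    also have "\<dots> = ?R" unfolding coface_last[OF i(2)] codeg_eq[OF x n(1) refl] ..
    finally show ?thesis .
  next
    case False
    define p q r where "p = j" and "q = i - j - 2" and "r = n + 1 - i"
    have pq: "j = p" "i = p + (1 + q) + 1" "n = p + (q + (1 + r))"
      using ij False by (simp_all add: p_def q_def r_def)
    have n1: "n + 1 = (p + (1 + q)) + (1 + r)" and n2: "n + 1 = p + (q + (2 + r))"
      and n4: "n + 1 = p + (1 + (q + (1 + r)))" and n3: "n = p + q + (1 + r)" and i1: "i - 1 = p + q + 1" using pq by simp_all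
    have "?L = leg_ext counit_leg 0 p (q + (2 + r)) (leg_ext \<Delta> 2 (p + (1 + q)) r x)"
      unfolding coface_middle[OF x n1 pq(2), symmetric] by (rule codeg_eq[OF dx n2 pq(1)])
    also have "\<dots> = leg_ext \<Delta> 2 (p + (0 + q)) r (leg_ext counit_leg 0 p (q + (1 + r)) x)"
      by (rule leg_ext_commute[OF E.leg_hom_axioms D.leg_hom_axioms, symmetric]) (use x n4 in argo)
    also have "\<dots> = leg_ext \<Delta> 2 (p + q) r (codeg n j x)"
      unfolding codeg_eq[OF x pq(3,1)] by simp
    also have "\<dots> = ?R" by (rule coface_middle[OF sx n3 i1, symmetric])
    finally show ?thesis .
  qed
qed

lemma codeg_codeg:
  assumes ij: "i \<le> j" "j \<le> n" and x: "x \<in> multipliers (n + 2)"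
  shows "codeg n j (codeg (n + 1) i x) = codeg n i (codeg (n + 1) (j + 1) x)" (is "?L = ?R")
proof -
  have "n + 2 = n + 1 + 1" by simp
  with x have x': "x \<in> multipliers (n + 1 + 1)" by argo
  have sx: "codeg (n + 1) i x \<in> multipliers (n + 1)" "codeg (n + 1) (j + 1) x \<in> multipliers (n + 1)"
    by (rule codegeneracy_multipliers[OF _ x']; use ij in linarith)+
  \<comment> \<open>In x the removed factors have p and p + 1 + q factors in front; once the first
    is gone, the second has only p + q.\<close>
  define p q r where "p = i" and "q = j - i" and "r = n - j"
  have pq: "i = p" "j = p + q" "n = p + (q + r)" using ij by (simp_all add: p_def q_def r_def)
  have n: "n + 1 = p + (q + (1 + r))" "n + 1 = (p + (1 + q)) + r" "j + 1 = p + (1 + q)" "n = p + q + r"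
    "n + 1 + 1 = p + (1 + (q + (1 + r)))"
    using pq by simp_all
  have "?L = leg_ext counit_leg 0 (p + q) r (leg_ext counit_leg 0 p (q + (1 + r)) x)"
    unfolding codeg_eq[OF x' n(1) pq(1), symmetric] by (rule codeg_eq[OF sx(1) n(4) pq(2)])
  also have "\<dots> = leg_ext counit_leg 0 p (q + (0 + r)) (leg_ext counit_leg 0 (p + (1 + q)) r x)"
    using leg_ext_commute[OF E.leg_hom_axioms E.leg_hom_axioms, of x p q r] x'[unfolded n(5)] by simp
  also have "\<dots> = leg_ext counit_leg 0 p (q + r) (codeg (n + 1) (j + 1) x)"
    unfolding codeg_eq[OF x' n(2,3)] by simp
  also have "\<dots> = ?R" by (rule codeg_eq[OF sx(2) pq(3,1), symmetric])
  finally show ?thesis .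
qed

lemma cosimplicial_multipliers:
  "cosimplicial_vector_space multipliers (coface \<Delta> \<sigma>) (\<lambda>n j. codegeneracy \<Delta> (n + 1) (j + 1))"
  unfolding cosimplicial_vector_space_def
  by (intro conjI allI impI ballI image_subsetI; (elim conjE)?)
    (assumption | rule subspace_multipliers coface_linear coface_multipliers codegeneracy_linear
      codegeneracy_multipliers coface_coface codeg_coface_less codeg_coface_same codeg_coface_greater codeg_codeg)+

end

section \<open>The subspaces \<open>M\<^sub>0\<^sup>n(H)\<close>\<close>

text \<open>\<open>mbetween\<close> with tensors in place of the outer lists, so that it is bilinear
  in them and nondegeneracy can be applied to them.\<close>

definition around :: "nat \<Rightarrow> nat \<Rightarrow> nat \<Rightarrow> 'a::complex_algebra tensor \<Rightarrow> 'a multiplier \<Rightarrow> 'a tensor \<Rightarrow> 'a multiplier"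
  where "around k p q s x t = mtensor p (k + q) (membed p s) (mtensor k q x (membed q t))"

lemma mbetween_around: "mbetween k as x bs = around k (length as) (length bs) (pure as) x (pure bs)"
  by (simp add: mbetween_def around_def)

lemma around_multipliers [simp]:
  "s \<in> tpow p \<Longrightarrow> x \<in> multipliers k \<Longrightarrow> t \<in> tpow q \<Longrightarrow> n = p + (k + q) \<Longrightarrow> around k p q s x t \<in> multipliers n"
  by (simp add: around_def)

lemma bilinear_around:
  "x \<in> multipliers k \<Longrightarrow> bilinear_on (tpow p) (tpow q) (\<lambda>s t. around k p q s x t)"
  by (simp add: bilinear_on_def linear_on_def around_def membed_linear mtensor_linear)

lemma mmult_zero:
  assumes "x \<in> multipliers n" shows "mmult x 0 = 0" "mmult 0 x = 0"
  using linear_on_zero[OF bilinear_on_right[OF bilinear_mmult assms]]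
    linear_on_zero[OF bilinear_on_left[OF bilinear_mmult assms]] by simp_all

lemma linear_on_mmult:
  assumes "linear_on V f" "\<And>x. x \<in> V \<Longrightarrow> f x \<in> multipliers n" "c \<in> multipliers n"
  shows "linear_on V (\<lambda>x. mmult (f x) c)" "linear_on V (\<lambda>x. mmult c (f x))"
  using assms by (simp_all add: linear_on_def mmult_linear[of _ n])

text \<open>\<open>NN \<sigma> p q\<close> has \<open>N(H)\<close> between \<open>p\<close> and \<open>q\<close> factors \<open>H\<close>.\<close>

abbreviation NN :: "'a::complex_algebra multiplier \<Rightarrow> nat \<Rightarrow> nat \<Rightarrow> 'a multiplier set" where
  "NN \<sigma> p q \<equiv> N_at \<sigma> (p + (1 + q)) (p + 1)"

lemma subspace_N_at [simp]: "csubspace (N_at \<sigma> n i)"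
  by (simp add: N_at_def)

lemma N_at_closed:
  "0 \<in> N_at \<sigma> n i" "x \<in> N_at \<sigma> n i \<Longrightarrow> y \<in> N_at \<sigma> n i \<Longrightarrow> x + y \<in> N_at \<sigma> n i"
  "x \<in> N_at \<sigma> n i \<Longrightarrow> c *\<^sub>C x \<in> N_at \<sigma> n i"
  by (simp_all add: complex_vector.subspace_0 complex_vector.subspace_add complex_vector.subspace_scale)

lemma NN_eq: "NN \<sigma> p q = cspan {around 1 p q (pure as) \<nu> (pure bs) | as \<nu> bs.
    length as = p \<and> length bs = q \<and> \<nu> \<in> N_alg \<sigma>}"
proof -
  have e: "p + 1 - 1 = p" "p + (1 + q) - (p + 1) = q" by simp_all
  show ?thesis unfolding N_at_def mbetween_around e
    by (rule arg_cong[where f = cspan], rule Collect_cong, intro ex_cong1) auto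
qed

context
  fixes \<sigma> :: "'a::complex_algebra multiplier"
  assumes \<sigma> [simp]: "\<sigma> \<in> multipliers 1"
begin

lemma N_alg_multipliers [simp]: "\<nu> \<in> N_alg \<sigma> \<Longrightarrow> \<nu> \<in> multipliers 1"
  by (induction rule: N_alg.induct) auto

lemma NN_I:
  assumes "\<nu> \<in> N_alg \<sigma>" "s \<in> tpow p" "t \<in> tpow q"
  shows "around 1 p q s \<nu> t \<in> NN \<sigma> p q"
proof (rule bilinear_on_tpow_mem[OF bilinear_around subspace_N_at _ assms(2,3)])
  show "around 1 p q (pure xs) \<nu> (pure ys) \<in> NN \<sigma> p q" if "length xs = p" "length ys = q" for xs ys
    unfolding NN_eq
    by (intro complex_vector.span_base CollectI exI[of _ xs] exI[of _ \<nu>] exI[of _ ys]) (simp add: that assms(1))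
qed (use assms in simp)

text \<open>F is linear on the multipliers of this degree only, so the induction over the span
  carries membership along.\<close>

lemma NN_induct:
  assumes x: "x \<in> NN \<sigma> p q" and F: "linear_on (multipliers (p + (1 + q))) F" and W: "csubspace W"
    and base: "\<And>s \<nu> t. s \<in> tpow p \<Longrightarrow> t \<in> tpow q \<Longrightarrow> \<nu> \<in> N_alg \<sigma> \<Longrightarrow> F (around 1 p q s \<nu> t) \<in> W"
  shows "F x \<in> W"
proof -
  have "x \<in> multipliers (p + (1 + q)) \<and> F x \<in> W"
  proof (rule complex_vector.span_induct[OF x[unfolded NN_eq]])
    show "csubspace {x. x \<in> multipliers (p + (1 + q)) \<and> F x \<in> W}"
      using W linear_on_zero[OF F] by (auto simp: complex_vector.subspace_def linear_on_add[OF F] linear_on_scale[OF F])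
  qed (use base in auto)
  then show ?thesis by simp
qed

lemma NN_left:
  assumes c: "c \<in> tpow m" and x: "x \<in> NN \<sigma> p q"
  shows "mtensor m (p + (1 + q)) (membed m c) x \<in> NN \<sigma> (m + p) q"
proof (rule NN_induct[OF x _ subspace_N_at])
  show "linear_on (multipliers (p + (1 + q))) (mtensor m (p + (1 + q)) (membed m c))"
    using c by (simp add: linear_on_def mtensor_linear)
  fix s t :: "'a tensor" and \<nu> assume *: "s \<in> tpow p" "t \<in> tpow q" "\<nu> \<in> N_alg \<sigma>"
  then have "mtensor m (p + (1 + q)) (membed m c) (around 1 p q s \<nu> t) = around 1 (m + p) q (tconcat m p c s) \<nu> t"
    using c by (simp add: around_def mtensor_membed[symmetric] mtensor_assoc)
  then show "mtensor m (p + (1 + q)) (membed m c) (around 1 p q s \<nu> t) \<in> NN \<sigma> (m + p) q"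
    using * c NN_I by simp
qed

lemma NN_right:
  assumes c: "c \<in> tpow m" and x: "x \<in> NN \<sigma> p q"
  shows "mtensor (p + (1 + q)) m x (membed m c) \<in> NN \<sigma> p (q + m)"
proof (rule NN_induct[OF x _ subspace_N_at])
  show "linear_on (multipliers (p + (1 + q))) (\<lambda>x. mtensor (p + (1 + q)) m x (membed m c))"
    using c by (simp add: linear_on_def mtensor_linear)
  fix s t :: "'a tensor" and \<nu> assume *: "s \<in> tpow p" "t \<in> tpow q" "\<nu> \<in> N_alg \<sigma>"
  then have "mtensor (p + (1 + q)) m (around 1 p q s \<nu> t) (membed m c) = around 1 p (q + m) s \<nu> (tconcat q m t c)"
    using c by (simp add: around_def mtensor_membed[symmetric] mtensor_assoc add.assoc)
  then show "mtensor (p + (1 + q)) m (around 1 p q s \<nu> t) (membed m c) \<in> NN \<sigma> p (q + m)"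
    using * c NN_I by simp
qed

text \<open>By bilinearity the lists of the definition may be replaced by tensors. The position i is
  replaced by the numbers p and q of factors on its two sides, which fits the degrees of
  \<open>mtensor\<close>.\<close>

lemma multipliers0_iff:
  "z \<in> multipliers0 \<sigma> n \<longleftrightarrow> z \<in> multipliers n \<and>
    (\<forall>p q. n = p + (1 + q) \<longrightarrow> (\<forall>s\<in>tpow p. \<forall>t\<in>tpow q.
       mmult z (around 1 p q s (mone 1) t) \<in> NN \<sigma> p q \<and> mmult (around 1 p q s (mone 1) t) z \<in> NN \<sigma> p q))"
    (is "_ \<longleftrightarrow> ?R")
proof
  assume z: "z \<in> multipliers0 \<sigma> n"
  then have zM: "z \<in> multipliers n" by (simp add: multipliers0_def)
  have "mmult z (around 1 p q s (mone 1) t) \<in> NN \<sigma> p q \<and> mmult (around 1 p q s (mone 1) t) z \<in> NN \<sigma> p q"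
    if n: "n = p + (1 + q)" and st: "s \<in> tpow p" "t \<in> tpow q" for p q s t
  proof
    have pure: "mmult z (around 1 p q (pure as) (mone 1) (pure bs)) \<in> NN \<sigma> p q \<and>
       mmult (around 1 p q (pure as) (mone 1) (pure bs)) z \<in> NN \<sigma> p q"
      if ab: "length as = p" "length bs = q" for as bs
    proof -
      have i: "p + 1 \<in> {1..n}" "length as = p + 1 - 1" "length bs = n - (p + 1)" using ab n by auto
      from z[unfolded multipliers0_def] have "\<forall>i\<in>{1..n}. \<forall>as bs. length as = i - 1 \<longrightarrow> length bs = n - i \<longrightarrow>
         mmult z (mbetween 1 as (mone 1) bs) \<in> N_at \<sigma> n i \<and>
         mmult (mbetween 1 as (mone 1) bs) z \<in> N_at \<sigma> n i" by blast
      from this[rule_format, OF i] show ?thesis unfolding mbetween_around ab n .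
    qed
    have B: "bilinear_on (tpow p) (tpow q) (\<lambda>s t. mmult z (around 1 p q s (mone 1) t))"
       "bilinear_on (tpow p) (tpow q) (\<lambda>s t. mmult (around 1 p q s (mone 1) t) z)"
      using zM n
      by (simp_all add: bilinear_onD[OF bilinear_around[of "mone 1" 1 p q]] bilinear_on_def linear_on_def mmult_linear[of _ "p + (1 + q)"])
    show "mmult z (around 1 p q s (mone 1) t) \<in> NN \<sigma> p q"
      by (rule bilinear_on_tpow_mem[OF B(1) subspace_N_at _ st]) (use pure in blast)
    show "mmult (around 1 p q s (mone 1) t) z \<in> NN \<sigma> p q"
      by (rule bilinear_on_tpow_mem[OF B(2) subspace_N_at _ st]) (use pure in blast)
  qed
  with zM show ?R by blast
next
  assume z: ?R
  show "z \<in> multipliers0 \<sigma> n" unfolding multipliers0_def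
  proof (intro CollectI conjI ballI allI impI)
    show "z \<in> multipliers n" using z by simp
    fix i and as bs :: "'a list" assume i: "i \<in> {1..n}" "length as = i - 1" "length bs = n - i"
    then have n: "n = (i - 1) + (1 + (n - i))" and i': "i = (i - 1) + 1" by auto
    from z n i(2,3) have "mmult z (mbetween 1 as (mone 1) bs) \<in> NN \<sigma> (i - 1) (n - i) \<and>
        mmult (mbetween 1 as (mone 1) bs) z \<in> NN \<sigma> (i - 1) (n - i)"
      unfolding mbetween_around by (metis pure_tpow)
    then show "mmult z (mbetween 1 as (mone 1) bs) \<in> N_at \<sigma> n i" "mmult (mbetween 1 as (mone 1) bs) z \<in> N_at \<sigma> n i"
      unfolding n[symmetric] i'[symmetric] by simp_all
  qed
qed

lemma multipliers0_multipliers: "z \<in> multipliers0 \<sigma> n \<Longrightarrow> z \<in> multipliers n"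
  by (simp add: multipliers0_iff)

lemma multipliers0D:
  assumes "z \<in> multipliers0 \<sigma> n" "n = p + (1 + q)" "s \<in> tpow p" "t \<in> tpow q"
  shows "mmult z (around 1 p q s (mone 1) t) \<in> NN \<sigma> p q" "mmult (around 1 p q s (mone 1) t) z \<in> NN \<sigma> p q"
  using assms by (simp_all only: multipliers0_iff)

lemma multipliers0I:
  assumes "z \<in> multipliers n"
    and "\<And>p q s t. n = p + (1 + q) \<Longrightarrow> s \<in> tpow p \<Longrightarrow> t \<in> tpow q \<Longrightarrow>
      mmult z (around 1 p q s (mone 1) t) \<in> NN \<sigma> p q \<and> mmult (around 1 p q s (mone 1) t) z \<in> NN \<sigma> p q"
  shows "z \<in> multipliers0 \<sigma> n"
  using assms unfolding multipliers0_iff by blast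

lemma subspace_multipliers0: "csubspace (multipliers0 \<sigma> n)"
  unfolding complex_vector.subspace_def
proof (intro conjI ballI allI)
  have a: "around 1 p q s (mone 1) t \<in> multipliers n" if "n = p + (1 + q)" "s \<in> tpow p" "t \<in> tpow q" for p q and s t :: "'a tensor"
    using that by simp
  note lin = mmult_linear[of _ n] mmult_zero[of _ n]
  show "0 \<in> multipliers0 \<sigma> n"
    by (rule multipliers0I) (use a in \<open>auto simp: lin N_at_closed\<close>)
  show "x + y \<in> multipliers0 \<sigma> n" if "x \<in> multipliers0 \<sigma> n" "y \<in> multipliers0 \<sigma> n" for x y
    by (rule multipliers0I)
      (use that a multipliers0D in \<open>auto simp: lin multipliers0_multipliers N_at_closed\<close>)
  show "c *\<^sub>C x \<in> multipliers0 \<sigma> n" if "x \<in> multipliers0 \<sigma> n" for c x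
    by (rule multipliers0I)
      (use that a multipliers0D in \<open>auto simp: lin multipliers0_multipliers N_at_closed\<close>)
qed

text \<open>If the slot is the new first factor, it receives 1, an element of N(H). Otherwise the
  first factor of the test tensor meets the inserted 1 and splits off, and the condition on z
  applies to the rest.\<close>

lemma mtensor_mone_multipliers0:
  assumes z: "z \<in> multipliers0 \<sigma> n"
  shows "mtensor 1 n (mone 1) z \<in> multipliers0 \<sigma> (n + 1)" (is "?Z \<in> _")
proof (rule multipliers0I)
  note zM = multipliers0_multipliers[OF z]
  show Z: "?Z \<in> multipliers (n + 1)" using zM by simp
  fix p q and s t :: "'a tensor" assume n: "n + 1 = p + (1 + q)" and s: "s \<in> tpow p" and t: "t \<in> tpow q"
  note bl = bilinear_on_left[OF bilinear_around[of "mone 1" 1 p q] t, simplified]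
  have lin: "linear_on (tpow p) (\<lambda>s. mmult ?Z (around 1 p q s (mone 1) t))"
    "linear_on (tpow p) (\<lambda>s. mmult (around 1 p q s (mone 1) t) ?Z)"
    by (rule linear_on_mmult[OF bl _ Z]; use t n in simp)+
  have "mmult ?Z (around 1 p q (pure as) (mone 1) t) \<in> NN \<sigma> p q \<and>
     mmult (around 1 p q (pure as) (mone 1) t) ?Z \<in> NN \<sigma> p q" if len: "length as = p" for as
  proof (cases as)
    case Nil
    have pq: "p = 0" "q = n" using len n Nil by simp_all
    have "mtensor 1 n (mone 1) (membed n u) \<in> NN \<sigma> 0 n" if "u \<in> tpow n" for u
      using NN_I[OF N_one, of "pure []" 0 u n] that by (simp add: around_def membed_unit)
    then show ?thesis using zM t unfolding Nil pq
      by (simp add: around_def membed_unit mtensor_mmult mmult_membed_right mmult_membed_left)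
  next
    case (Cons a bs)
    define p' where "p' = length bs"
    have p: "p = 1 + p'" and n': "n = p' + (1 + q)" using len n Cons by (simp_all add: p'_def)
    have "around 1 (1 + p') q (tconcat 1 p' (pure [a]) (pure bs)) (mone 1) t =
        mtensor 1 n (membed 1 (pure [a])) (around 1 p' q (pure bs) (mone 1) t)"
      using t n' by (simp add: around_def p'_def mtensor_membed[symmetric] mtensor_assoc del: tconcat_pure)
    then show ?thesis unfolding Cons p using t zM n'
      NN_left[OF _ multipliers0D(1)[OF z n' _ t], of "pure [a]" 1 "pure bs"]
      NN_left[OF _ multipliers0D(2)[OF z n' _ t], of "pure [a]" 1 "pure bs"]
      by (simp add: mtensor_mmult p'_def)
  qed
  then show "mmult ?Z (around 1 p q s (mone 1) t) \<in> NN \<sigma> p q \<and> mmult (around 1 p q s (mone 1) t) ?Z \<in> NN \<sigma> p q"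
    using linear_on_tpow_mem[OF lin(1) subspace_N_at _ s] linear_on_tpow_mem[OF lin(2) subspace_N_at _ s] by blast
qed

text \<open>At the last factor the slot receives \<sigma>, an element of N(H). Otherwise the last
  factor b of the test tensor becomes \<sigma> b or b \<sigma>, again in H, and the condition on z
  applies to the rest.\<close>

lemma mtensor_sigma_multipliers0:
  assumes z: "z \<in> multipliers0 \<sigma> n"
  shows "mtensor n 1 z \<sigma> \<in> multipliers0 \<sigma> (n + 1)" (is "?Z \<in> _")
proof (rule multipliers0I)
  note zM = multipliers0_multipliers[OF z]
  show Z: "?Z \<in> multipliers (n + 1)" using zM by simp
  fix p q and s t :: "'a tensor" assume n: "n + 1 = p + (1 + q)" and s: "s \<in> tpow p" and t: "t \<in> tpow q"
  note bl = bilinear_on_right[OF bilinear_around[of "mone 1" 1 p q] s, simplified]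
  have lin: "linear_on (tpow q) (\<lambda>t. mmult ?Z (around 1 p q s (mone 1) t))"
    "linear_on (tpow q) (\<lambda>t. mmult (around 1 p q s (mone 1) t) ?Z)"
    by (rule linear_on_mmult[OF bl _ Z]; use s n in simp)+
  have "mmult ?Z (around 1 p q s (mone 1) (pure bs)) \<in> NN \<sigma> p q \<and>
     mmult (around 1 p q s (mone 1) (pure bs)) ?Z \<in> NN \<sigma> p q" if len: "length bs = q" for bs
  proof (cases bs rule: rev_cases)
    case Nil
    have pq: "q = 0" "p = n" using len n Nil by simp_all
    have "mtensor n 1 (membed n u) \<sigma> \<in> NN \<sigma> n 0" if "u \<in> tpow n" for u
      using NN_I[OF N_sigma, of u n "pure []" 0] that by (simp add: around_def membed_unit)
    then show ?thesis using zM s unfolding Nil pq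
      by (simp add: around_def membed_unit mtensor_mmult mmult_membed_right mmult_membed_left)
  next
    case (snoc as b)
    define q' where "q' = length as"
    have q: "q = q' + 1" and n': "n = p + (1 + q')" using len n snoc by (simp_all add: q'_def)
    have "around 1 p (q' + 1) s (mone 1) (tconcat q' 1 (pure as) (pure [b])) =
        mtensor n 1 (around 1 p q' s (mone 1) (pure as)) (membed 1 (pure [b]))"
      using s n' by (simp add: around_def q'_def mtensor_membed[symmetric] mtensor_assoc add.assoc del: tconcat_pure)
    then show ?thesis unfolding snoc q using s zM n'
      NN_right[OF _ multipliers0D(1)[OF z n' s], of "fst \<sigma> (pure [b])" 1 "pure as"]
      NN_right[OF _ multipliers0D(2)[OF z n' s], of "snd \<sigma> (pure [b])" 1 "pure as"]
      by (simp add: mtensor_mmult mmult_membed_right mmult_membed_left q'_def)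
  qed
  then show "mmult ?Z (around 1 p q s (mone 1) t) \<in> NN \<sigma> p q \<and> mmult (around 1 p q s (mone 1) t) ?Z \<in> NN \<sigma> p q"
    using linear_on_tpow_mem[OF lin(1) subspace_N_at _ t] linear_on_tpow_mem[OF lin(2) subspace_N_at _ t] by blast
qed

end

declare add_2_eq_Suc [simp del] add_2_eq_Suc' [simp del]

text \<open>\<Delta> produces degrees 2 + n, which index \<open>mtensor\<close>; nested ones are
  brought to this form and not to successors.\<close>

lemma one_add_one_add [simp]: "1 + (1 + n) = 2 + (n :: nat)"
  by simp

section \<open>The case where the slot is not the factor acted on\<close>

context leg_hom
begin

text \<open>By nondegeneracy, the factors on the side of the slot where \<open>\<phi>\<close> acts may be taken of the form
  \<open>\<phi>(s) w\<close>, so that multiplicativity of the extension moves the product inside it.\<close>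

lemma leg_ext_NN_slot_right:
  assumes \<sigma>: "\<sigma> \<in> multipliers 1" and z: "z \<in> multipliers0 \<sigma> n" and n: "n = p0 + (1 + (q1 + (1 + q)))"
    and A: "A \<in> tpow (p0 + (k + q1))" and t: "t \<in> tpow q"
  shows "mmult (leg_ext \<phi> k p0 (q1 + (1 + q)) z) (around 1 (p0 + (k + q1)) q A (mone 1) t) \<in> NN \<sigma> (p0 + (k + q1)) q \<and>
    mmult (around 1 (p0 + (k + q1)) q A (mone 1) t) (leg_ext \<phi> k p0 (q1 + (1 + q)) z) \<in> NN \<sigma> (p0 + (k + q1)) q"
proof -
  let ?Pi = "p0 + (1 + q1)" and ?Po = "p0 + (k + q1)" and ?F = "leg_ext \<phi> k p0 (q1 + (1 + q))"
  \<comment> \<open>This multiplies the factors in front of the slot by w and leaves the slot and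
    all later factors alone.\<close>
  let ?W = "\<lambda>w. mtensor ?Po (1 + q) (membed ?Po w) (mone (1 + q))"
  let ?M = "multipliers (?Po + (1 + q))"
  have n': "n = ?Pi + (1 + q)" using n by simp
  note zM = multipliers0_multipliers[OF \<sigma> z]
  have F: "?F x \<in> ?M" if "x \<in> multipliers n" for x
    by (rule leg_ext_multipliers') (use that n in simp_all)
  have lin: "linear_on (multipliers n) ?F" using linear_on_leg_ext[of p0 "q1 + (1 + q)"] n by simp
  have FM: "?F (mmult x y) = mmult (?F x) (?F y)" if "x \<in> multipliers n" "y \<in> multipliers n" for x y
    using that n leg_ext_mmult by simp
  have W: "?W w \<in> ?M" if "w \<in> tpow ?Po" for w using that by simp
  have aM: "around 1 ?Pi q s (mone 1) t \<in> multipliers n" if "s \<in> tpow ?Pi" for s using that t n' by simp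
  have ext: "?F (around 1 ?Pi q s x t) = mtensor ?Po (1 + q) (leg \<phi> k p0 q1 s) (mtensor 1 q x (membed q t))"
    if "s \<in> tpow ?Pi" "x \<in> multipliers 1" "t \<in> tpow q" for s x t
  proof -
    have "?F (around 1 ?Pi q s x t) = mtensor ?Po (1 + q) (leg_ext \<phi> k p0 q1 (membed ?Pi s)) (mtensor 1 q x (membed q t))"
      unfolding around_def by (rule leg_ext_mtensor_right') (use that in simp_all)
    then show ?thesis using that by (simp only: leg_ext_membed)
  qed
  have fst: "mmult (?F (around 1 ?Pi q s x t)) (?W w) = around 1 ?Po q (fst (leg \<phi> k p0 q1 s) w) x t"
    and snd: "mmult (?W w) (?F (around 1 ?Pi q s x t)) = around 1 ?Po q (snd (leg \<phi> k p0 q1 s) w) x t"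
    if "s \<in> tpow ?Pi" "x \<in> multipliers 1" "w \<in> tpow ?Po" "t \<in> tpow q" for s x w t
    unfolding ext[OF that(1,2,4)] using that
    by (simp_all add: mtensor_mmult mmult_membed_right mmult_membed_left fst_mone snd_mone around_def)
  \<comment> \<open>The extension takes s \<otimes> \<nu> \<otimes> t to a tensor whose front part,
    the leg of s, is only a multiplier. Multiplication by w brings that part back into a tensor
    power of H.\<close>
  have gen: "mmult (?F x) (?W w) \<in> NN \<sigma> ?Po q \<and> mmult (?W w) (?F x) \<in> NN \<sigma> ?Po q"
    if x: "x \<in> NN \<sigma> ?Pi q" and w: "w \<in> tpow ?Po" for x w
    by (rule conjI; rule NN_induct[OF \<sigma> x _ subspace_N_at, folded n'],
        rule linear_on_mmult[OF lin F W[OF w]], assumption)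
      (use w \<sigma> N_alg_multipliers[OF \<sigma>] in \<open>auto simp: fst snd intro!: NN_I multiplier_tpow leg_multipliers\<close>)
  note bl = bilinear_on_left[OF bilinear_around[of "mone 1" 1 ?Po q] t, simplified]
  note aP = linear_on_add[OF bl] linear_on_scale[OF bl] linear_on_zero[OF bl subspace_tpow]
  have Y: "?F z \<in> ?M" by (rule F[OF zM])
  have aM': "around 1 ?Po q s (mone 1) t \<in> ?M" if "s \<in> tpow ?Po" for s using that t by simp
  show ?thesis
  proof
    show "mmult (?F z) (around 1 ?Po q A (mone 1) t) \<in> NN \<sigma> ?Po q"
    proof (rule nd_hom_induct_fst[OF nd_leg A])
      fix s w :: "'a tensor" assume sw: "s \<in> tpow ?Pi" "w \<in> tpow ?Po"
      have "mmult (?F z) (around 1 ?Po q (fst (leg \<phi> k p0 q1 s) w) (mone 1) t) =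
          mmult (?F (mmult z (around 1 ?Pi q s (mone 1) t))) (?W w)"
        unfolding FM[OF zM aM[OF sw(1)]] by (simp only: mmult_assoc fst[OF sw(1) mone_multipliers sw(2) t])
      then show "mmult (?F z) (around 1 ?Po q (fst (leg \<phi> k p0 q1 s) w) (mone 1) t) \<in> NN \<sigma> ?Po q"
        using gen[OF multipliers0D(1)[OF \<sigma> z n' sw(1) t] sw(2)] by simp
    qed (use Y aM' in \<open>simp_all only: aP mmult_linear[of _ "?Po + (1 + q)"] mmult_zero[OF Y] N_at_closed\<close>)
    show "mmult (around 1 ?Po q A (mone 1) t) (?F z) \<in> NN \<sigma> ?Po q"
    proof (rule nd_hom_induct_snd[OF nd_leg A])
      fix s w :: "'a tensor" assume sw: "s \<in> tpow ?Pi" "w \<in> tpow ?Po"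
      have "mmult (around 1 ?Po q (snd (leg \<phi> k p0 q1 s) w) (mone 1) t) (?F z) =
          mmult (?W w) (?F (mmult (around 1 ?Pi q s (mone 1) t) z))"
        unfolding FM[OF aM[OF sw(1)] zM]
        by (simp only: mmult_assoc[symmetric] snd[OF sw(1) mone_multipliers sw(2) t])
      then show "mmult (around 1 ?Po q (snd (leg \<phi> k p0 q1 s) w) (mone 1) t) (?F z) \<in> NN \<sigma> ?Po q"
        using gen[OF multipliers0D(2)[OF \<sigma> z n' sw(1) t] sw(2)] by simp
    qed (use Y aM' in \<open>simp_all only: aP mmult_linear[of _ "?Po + (1 + q)"] mmult_zero[OF Y] N_at_closed\<close>)
  qed
qed

text \<open>Mirror image of the previous lemma: \<phi> acts behind the slot, so it is the tensor B
  behind the slot that nondegeneracy rewrites.\<close>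

lemma leg_ext_NN_slot_left:
  assumes \<sigma>: "\<sigma> \<in> multipliers 1" and z: "z \<in> multipliers0 \<sigma> n" and n: "n = p + (1 + (q1 + (1 + q2)))"
    and s: "s \<in> tpow p" and B: "B \<in> tpow (q1 + (k + q2))"
  shows "mmult (leg_ext \<phi> k (p + (1 + q1)) q2 z) (around 1 p (q1 + (k + q2)) s (mone 1) B) \<in> NN \<sigma> p (q1 + (k + q2)) \<and>
    mmult (around 1 p (q1 + (k + q2)) s (mone 1) B) (leg_ext \<phi> k (p + (1 + q1)) q2 z) \<in> NN \<sigma> p (q1 + (k + q2))"
proof -
  let ?Qi = "q1 + (1 + q2)" and ?Qo = "q1 + (k + q2)" and ?F = "leg_ext \<phi> k (p + (1 + q1)) q2"
  let ?W = "\<lambda>w. mtensor p (1 + ?Qo) (mone p) (mtensor 1 ?Qo (mone 1) (membed ?Qo w))"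
  let ?M = "multipliers (p + (1 + ?Qo))"
  note zM = multipliers0_multipliers[OF \<sigma> z]
  have n': "n = (p + (1 + q1)) + (1 + q2)" using n by simp
  have F: "?F x \<in> ?M" if "x \<in> multipliers n" for x
    by (rule leg_ext_multipliers') (use that n' in simp_all)
  have lin: "linear_on (multipliers n) ?F" unfolding n' by (rule linear_on_leg_ext)
  have FM: "?F (mmult x y) = mmult (?F x) (?F y)" if "x \<in> multipliers n" "y \<in> multipliers n" for x y
    using that unfolding n' by (rule leg_ext_mmult)
  have W: "?W w \<in> ?M" if "w \<in> tpow ?Qo" for w using that by simp
  have aM: "around 1 p ?Qi s (mone 1) t \<in> multipliers n" if "t \<in> tpow ?Qi" for t using that s n by simp
  have ext: "?F (around 1 p ?Qi s x t) = mtensor p (1 + ?Qo) (membed p s) (mtensor 1 ?Qo x (leg \<phi> k q1 q2 t))"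
    if "s \<in> tpow p" "x \<in> multipliers 1" "t \<in> tpow ?Qi" for s x t
  proof -
    have "?F (around 1 p ?Qi s x t) = mtensor p (1 + ?Qo) (membed p s)
        (leg_ext \<phi> k (1 + q1) q2 (mtensor 1 ?Qi x (membed ?Qi t)))"
      unfolding around_def by (rule leg_ext_mtensor_left') (use that in simp_all)
    also have "leg_ext \<phi> k (1 + q1) q2 (mtensor 1 ?Qi x (membed ?Qi t)) =
        mtensor 1 ?Qo x (leg_ext \<phi> k q1 q2 (membed ?Qi t))"
      by (rule leg_ext_mtensor_left') (use that in simp_all)
    finally show ?thesis using that by (simp only: leg_ext_membed)
  qed
  have fst: "mmult (?F (around 1 p ?Qi s x t)) (?W w) = around 1 p ?Qo s x (fst (leg \<phi> k q1 q2 t) w)"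
    and snd: "mmult (?W w) (?F (around 1 p ?Qi s x t)) = around 1 p ?Qo s x (snd (leg \<phi> k q1 q2 t) w)"
    if "s \<in> tpow p" "x \<in> multipliers 1" "w \<in> tpow ?Qo" "t \<in> tpow ?Qi" for s x w t
    unfolding ext[OF that(1,2,4)] using that
    by (simp_all add: mtensor_mmult mmult_membed_right mmult_membed_left fst_mone snd_mone around_def)
  have gen: "mmult (?F x) (?W w) \<in> NN \<sigma> p ?Qo \<and> mmult (?W w) (?F x) \<in> NN \<sigma> p ?Qo"
    if x: "x \<in> NN \<sigma> p ?Qi" and w: "w \<in> tpow ?Qo" for x w
    by (rule conjI; rule NN_induct[OF \<sigma> x _ subspace_N_at, folded n],
        rule linear_on_mmult[OF lin F W[OF w]], assumption)
      (use w \<sigma> N_alg_multipliers[OF \<sigma>] in \<open>auto simp: fst snd intro!: NN_I multiplier_tpow leg_multipliers\<close>)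
  note bl = bilinear_on_right[OF bilinear_around[of "mone 1" 1 p ?Qo] s, simplified]
  note aP = linear_on_add[OF bl] linear_on_scale[OF bl] linear_on_zero[OF bl subspace_tpow]
  have Y: "?F z \<in> ?M" by (rule F[OF zM])
  have aM': "around 1 p ?Qo s (mone 1) t \<in> ?M" if "t \<in> tpow ?Qo" for t using that s by simp
  show ?thesis
  proof
    show "mmult (?F z) (around 1 p ?Qo s (mone 1) B) \<in> NN \<sigma> p ?Qo"
    proof (rule nd_hom_induct_fst[OF nd_leg B])
      fix t w :: "'a tensor" assume sw: "t \<in> tpow ?Qi" "w \<in> tpow ?Qo"
      have "mmult (?F z) (around 1 p ?Qo s (mone 1) (fst (leg \<phi> k q1 q2 t) w)) =
          mmult (?F (mmult z (around 1 p ?Qi s (mone 1) t))) (?W w)"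
        unfolding FM[OF zM aM[OF sw(1)]] by (simp only: mmult_assoc fst[OF s mone_multipliers sw(2,1)])
      then show "mmult (?F z) (around 1 p ?Qo s (mone 1) (fst (leg \<phi> k q1 q2 t) w)) \<in> NN \<sigma> p ?Qo"
        using gen[OF multipliers0D(1)[OF \<sigma> z n s sw(1)] sw(2)] by simp
    qed (use Y aM' in \<open>simp_all only: aP mmult_linear[of _ "p + (1 + ?Qo)"] mmult_zero[OF Y] N_at_closed\<close>)
    show "mmult (around 1 p ?Qo s (mone 1) B) (?F z) \<in> NN \<sigma> p ?Qo"
    proof (rule nd_hom_induct_snd[OF nd_leg B])
      fix t w :: "'a tensor" assume sw: "t \<in> tpow ?Qi" "w \<in> tpow ?Qo"
      have "mmult (around 1 p ?Qo s (mone 1) (snd (leg \<phi> k q1 q2 t) w)) (?F z) =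
          mmult (?W w) (?F (mmult (around 1 p ?Qi s (mone 1) t) z))"
        unfolding FM[OF aM[OF sw(1)] zM]
        by (simp only: mmult_assoc[symmetric] snd[OF s mone_multipliers sw(2,1)])
      then show "mmult (around 1 p ?Qo s (mone 1) (snd (leg \<phi> k q1 q2 t) w)) (?F z) \<in> NN \<sigma> p ?Qo"
        using gen[OF multipliers0D(2)[OF \<sigma> z n s sw(1)] sw(2)] by simp
    qed (use Y aM' in \<open>simp_all only: aP mmult_linear[of _ "p + (1 + ?Qo)"] mmult_zero[OF Y] N_at_closed\<close>)
  qed
qed

end

section \<open>Regularity, and the coproduct on N(H)\<close>

lemma tflip_linear_pure:
  shows linear_on_tflip: "linear_on (tpow 2) (tflip :: 'a::complex_vector tensor \<Rightarrow> 'a tensor)" and tflip_pure [simp]: "tflip (pure [a, b :: 'a]) = pure [b, a]"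
proof -
  have *: "multilinear 2 (\<lambda>xs. pure [xs ! 1, xs ! 0 :: 'a])"
    by (rule multilinear_2) (simp_all add: pure_2_add pure_2_scale)
  show "linear_on (tpow 2) (tflip :: 'a tensor \<Rightarrow> 'a tensor)" "tflip (pure [a, b]) = pure [b, a]"
    unfolding tflip_def by (simp_all add: linear_on_tlift[OF *] tlift_pure[OF *])
qed

lemma tflip_tpow [simp]: "t \<in> tpow 2 \<Longrightarrow> tflip t \<in> tpow 2"
  by (rule linear_on_tpow_2_mem[OF linear_on_tflip]) simp_all

lemma tflip_tflip [simp]: "t \<in> tpow 2 \<Longrightarrow> tflip (tflip t) = t"
  by (rule linear_on_tpow_2_eq[where f = "\<lambda>t. tflip (tflip t)" and g = "\<lambda>t. t"])
    (auto simp: linear_on_def linear_on_add[OF linear_on_tflip] linear_on_scale[OF linear_on_tflip])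

lemma tflip_tmult_pure:
  assumes "t \<in> tpow 2"
  shows "tflip (tmult 2 t (pure [a, b])) = tmult 2 (tflip t) (pure [b, a])"
    "tflip (tmult 2 (pure [a, b]) t) = tmult 2 (pure [b, a]) (tflip t)"
  by (rule linear_on_tpow_2_eq[OF _ _ _ assms];
      (simp add: linear_on_def tmult_linear linear_on_add[OF linear_on_tflip] linear_on_scale[OF linear_on_tflip])?)+

locale regular_grouplike = grouplike_multiplier +
  assumes flip: "multiplier_hopf_algebra (mflip \<circ> \<Delta>)"
begin

text \<open>For the flipped coproduct, its value at a times 1 \<otimes> b lies in H \<otimes> H.
  Flipping this element gives \<Delta>(a)(b \<otimes> 1).\<close>

lemma regular_right: "\<exists>t\<in>tpow 2. membed 2 t = mmult (\<Delta> a) (mult1 b)"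
proof -
  have "\<forall>a b. \<exists>t\<in>tpow 2. membed 2 t = mmult (mflip (\<Delta> a)) (mult2 b)"
    using flip unfolding multiplier_hopf_algebra_def o_apply by (elim conjE)
  then obtain t where t: "t \<in> tpow 2" "membed 2 t = mmult (mflip (\<Delta> a)) (mult2 b)" by meson
  have "membed 2 (tflip t) = mmult (\<Delta> a) (mult1 b)"
  proof (rule multiplier_eqI[of _ 2])
    fix xs :: "'a list" assume "length xs = 2"
    then obtain x y where xs: "xs = [x, y]" by (rule list_length_2)
    have "tmult 2 (tflip t) (pure [x, y]) = tflip (fst (membed 2 t) (pure [y, x]))"
      using t(1) by (simp add: tflip_tmult_pure fst_membed)
    also have "\<dots> = fst (\<Delta> a) (pure [b * x, y])"
      unfolding t(2) by (simp add: fst_mmult mflip_def multiplier_tpow[of _ 2])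
    finally show "fst (membed 2 (tflip t)) (pure xs) = fst (mmult (\<Delta> a) (mult1 b)) (pure xs)"
      by (simp add: xs fst_mmult fst_membed)
  qed (use t in simp_all)
  then show ?thesis using t by (intro bexI[of _ "tflip t"]) simp_all
qed

lemma regular_left: "\<exists>t\<in>tpow 2. membed 2 t = mmult (mult2 b) (\<Delta> a)"
proof -
  have "\<forall>a b. \<exists>t\<in>tpow 2. membed 2 t = mmult (mult1 a) (mflip (\<Delta> b))"
    using flip unfolding multiplier_hopf_algebra_def o_apply by (elim conjE)
  then obtain t where t: "t \<in> tpow 2" "membed 2 t = mmult (mult1 b) (mflip (\<Delta> a))" by meson
  have "membed 2 (tflip t) = mmult (mult2 b) (\<Delta> a)"
  proof (rule multiplier_eqI'[of _ 2])
    fix xs :: "'a list" assume "length xs = 2"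
    then obtain x y where xs: "xs = [x, y]" by (rule list_length_2)
    have "tmult 2 (pure [x, y]) (tflip t) = tflip (snd (membed 2 t) (pure [y, x]))"
      using t(1) by (simp add: tflip_tmult_pure snd_membed)
    also have "\<dots> = snd (\<Delta> a) (pure [x, y * b])"
      unfolding t(2) by (simp add: snd_mmult mflip_def multiplier_tpow[of _ 2])
    finally show "snd (membed 2 (tflip t)) (pure xs) = snd (mmult (mult2 b) (\<Delta> a)) (pure xs)"
      by (simp add: xs snd_mmult snd_membed)
  qed (use t in simp_all)
  then show ?thesis using t by (intro bexI[of _ "tflip t"]) simp_all
qed

lemmas \<sigma>M = grouplike_multipliers

lemma NN_1_mtensor:
  assumes "\<nu> \<in> N_alg \<sigma>" "c \<in> tpow 1"
  shows "mtensor 1 1 \<nu> (membed 1 c) \<in> NN \<sigma> 0 1" "mtensor 1 1 (membed 1 c) \<nu> \<in> NN \<sigma> 1 0"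
  using NN_I[OF \<sigma>M assms(1), of "pure []" 0 c 1] NN_I[OF \<sigma>M assms(1), of c 1 "pure []" 0] assms
    N_alg_multipliers[OF \<sigma>M assms(1)]
  by (simp_all add: around_def membed_unit)

text \<open>With two factors the outer tensors have degrees 0 and 1: the first is a scalar and is
  absorbed, the second is a single element d.\<close>

lemma NN_0_1_induct:
  assumes x: "x \<in> NN \<sigma> 0 1" and F: "linear_on (multipliers 2) F" and W: "csubspace W"
    and base: "\<And>\<nu> d. \<nu> \<in> N_alg \<sigma> \<Longrightarrow> F (mtensor 1 1 \<nu> (membed 1 (pure [d]))) \<in> W"
  shows "F x \<in> W"
proof (rule NN_induct[OF \<sigma>M x _ W])
  show "linear_on (multipliers (0 + (1 + 1))) F" using F by simp
  fix s t :: "'a tensor" and \<nu> assume *: "s \<in> tpow 0" "t \<in> tpow 1" "\<nu> \<in> N_alg \<sigma>"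
  then have \<nu>: "\<nu> \<in> multipliers 1" using N_alg_multipliers[OF \<sigma>M] by simp
  obtain c where c: "s = c *\<^sub>C pure []" using * by (auto elim: tpow_0_cases)
  obtain d where d: "t = pure [d]" using * by (auto elim: tpow_1_cases)
  have "around 1 0 1 s \<nu> t = c *\<^sub>C mtensor 1 1 \<nu> (membed 1 (pure [d]))"
    using \<nu> by (simp add: around_def c d membed_linear mtensor_linear membed_unit)
  then show "F (around 1 0 1 s \<nu> t) \<in> W"
    using base[OF *(3), of d] \<nu> W by (simp add: linear_on_scale[OF F] complex_vector.subspace_scale)
qed

lemma NN_1_0_induct:
  assumes x: "x \<in> NN \<sigma> 1 0" and F: "linear_on (multipliers 2) F" and W: "csubspace W"
    and base: "\<And>\<nu> d. \<nu> \<in> N_alg \<sigma> \<Longrightarrow> F (mtensor 1 1 (membed 1 (pure [d])) \<nu>) \<in> W"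
  shows "F x \<in> W"
proof (rule NN_induct[OF \<sigma>M x _ W])
  show "linear_on (multipliers (1 + (1 + 0))) F" using F by simp
  fix s t :: "'a tensor" and \<nu> assume *: "s \<in> tpow 1" "t \<in> tpow 0" "\<nu> \<in> N_alg \<sigma>"
  then have \<nu>: "\<nu> \<in> multipliers 1" using N_alg_multipliers[OF \<sigma>M] by simp
  obtain c where c: "t = c *\<^sub>C pure []" using * by (auto elim: tpow_0_cases)
  obtain d where d: "s = pure [d]" using * by (auto elim: tpow_1_cases)
  have "around 1 1 0 s \<nu> t = c *\<^sub>C mtensor 1 1 (membed 1 (pure [d])) \<nu>"
    using \<nu> by (simp add: around_def c d membed_linear mtensor_linear membed_unit)
  then show "F (around 1 1 0 s \<nu> t) \<in> W"
    using base[OF *(3), of d] \<nu> W by (simp add: linear_on_scale[OF F] complex_vector.subspace_scale)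
qed

text \<open>Either factor may be regarded as lying in N(H).\<close>

lemma membed_2_NN:
  assumes "t \<in> tpow 2" shows "membed 2 t \<in> NN \<sigma> 0 1" "membed 2 t \<in> NN \<sigma> 1 0"
proof -
  have "membed 2 (pure [a, b]) \<in> NN \<sigma> 0 1 \<and> membed 2 (pure [a, b]) \<in> NN \<sigma> 1 0" for a b
    using NN_1_mtensor(1)[OF N_embed, of "pure [b]" a] NN_1_mtensor(2)[OF N_embed, of "pure [a]" b]
    by (simp add: mtensor_membed)
  then show "membed 2 t \<in> NN \<sigma> 0 1" "membed 2 t \<in> NN \<sigma> 1 0"
    using linear_on_tpow_2_mem[OF linear_on_membed subspace_N_at _ assms] by blast+
qed

text \<open>N(H) is closed under products, so a further factor from N(H) is absorbed in the slot.
  This is what remains in the product case below once \<nu> \<otimes> d is split.\<close>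

lemma NN_slot_mult:
  assumes \<nu>: "\<nu> \<in> N_alg \<sigma>"
  shows "x \<in> NN \<sigma> 0 1 \<Longrightarrow> mmult x (mtensor 1 1 \<nu> (mone 1)) \<in> NN \<sigma> 0 1"
    and "x \<in> NN \<sigma> 0 1 \<Longrightarrow> mmult (mtensor 1 1 \<nu> (mone 1)) x \<in> NN \<sigma> 0 1"
    and "x \<in> NN \<sigma> 1 0 \<Longrightarrow> mmult x (mtensor 1 1 (mone 1) \<nu>) \<in> NN \<sigma> 1 0"
    and "x \<in> NN \<sigma> 1 0 \<Longrightarrow> mmult (mtensor 1 1 (mone 1) \<nu>) x \<in> NN \<sigma> 1 0"
proof -
  note [simp] = N_alg_multipliers[OF \<sigma>M] and mm = N_mult[OF \<nu>] N_mult[OF _ \<nu>]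
  have m: "mtensor 1 1 \<nu> (mone 1) \<in> multipliers 2" "mtensor 1 1 (mone 1) \<nu> \<in> multipliers 2" using \<nu> by simp_all
  have lin: "linear_on (multipliers 2) (\<lambda>x. mmult x y)" "linear_on (multipliers 2) (mmult y)"
    if "y \<in> multipliers 2" for y :: "'a multiplier" using that by (simp_all add: linear_on_def mmult_linear[of _ 2])
  show "mmult x (mtensor 1 1 \<nu> (mone 1)) \<in> NN \<sigma> 0 1" if "x \<in> NN \<sigma> 0 1"
    by (rule NN_0_1_induct[OF that lin(1)[OF m(1)]]) (use \<nu> mm NN_1_mtensor in \<open>simp_all add: mtensor_mmult\<close>)
  show "mmult (mtensor 1 1 \<nu> (mone 1)) x \<in> NN \<sigma> 0 1" if "x \<in> NN \<sigma> 0 1"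
    by (rule NN_0_1_induct[OF that lin(2)[OF m(1)]]) (use \<nu> mm NN_1_mtensor in \<open>simp_all add: mtensor_mmult\<close>)
  show "mmult x (mtensor 1 1 (mone 1) \<nu>) \<in> NN \<sigma> 1 0" if "x \<in> NN \<sigma> 1 0"
    by (rule NN_1_0_induct[OF that lin(1)[OF m(2)]]) (use \<nu> mm NN_1_mtensor in \<open>simp_all add: mtensor_mmult\<close>)
  show "mmult (mtensor 1 1 (mone 1) \<nu>) x \<in> NN \<sigma> 1 0" if "x \<in> NN \<sigma> 1 0"
    by (rule NN_1_0_induct[OF that lin(2)[OF m(2)]]) (use \<nu> mm NN_1_mtensor in \<open>simp_all add: mtensor_mmult\<close>)
qed

text \<open>Regularity enters here: it puts \<open>\<Delta>(h)(b \<otimes> 1)\<close> and \<open>(1 \<otimes> b)\<Delta>(h)\<close> into \<open>H \<otimes> H\<close>.\<close>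

lemma Delta_N_alg:
  assumes "\<nu> \<in> N_alg \<sigma>"
  shows "(\<forall>b. mmult (leg_ext \<Delta> 2 0 0 \<nu>) (mult2 b) \<in> NN \<sigma> 0 1) \<and> (\<forall>b. mmult (mult2 b) (leg_ext \<Delta> 2 0 0 \<nu>) \<in> NN \<sigma> 0 1) \<and>
    (\<forall>b. mmult (leg_ext \<Delta> 2 0 0 \<nu>) (mult1 b) \<in> NN \<sigma> 1 0) \<and> (\<forall>b. mmult (mult1 b) (leg_ext \<Delta> 2 0 0 \<nu>) \<in> NN \<sigma> 1 0)"
  using assms
proof (induction rule: N_alg.induct)
  case (N_embed h)
  have e: "leg_ext \<Delta> 2 0 0 (membed 1 (pure [h])) = \<Delta> h" by (rule D.leg_ext_single)
  have "mmult (\<Delta> h) (mult1 b) \<in> NN \<sigma> 1 0" "mmult (mult2 b) (\<Delta> h) \<in> NN \<sigma> 0 1" for b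
    using regular_right[of h b] regular_left[of b h] membed_2_NN by metis+
  then show ?case unfolding e using membed_2_NN by (simp add: membed_W_R[symmetric] membed_W_L[symmetric])
next
  case N_one
  have e: "leg_ext \<Delta> 2 0 0 (mone 1) = mone 2" using D.leg_ext_mone[of 0 0] by simp
  show ?case unfolding e using NN_1_mtensor[OF N_alg.N_one] by simp
next
  case N_sigma
  show ?case unfolding Delta_grouplike using NN_1_mtensor[OF N_alg.N_sigma]
    by (simp add: mtensor_mmult mmult_membed_right mmult_membed_left)
next
  case (N_add x y)
  then have [simp]: "x \<in> multipliers 1" "y \<in> multipliers 1" using N_alg_multipliers[OF \<sigma>M] by auto
  have [simp]: "leg_ext \<Delta> 2 0 0 x \<in> multipliers 2" "leg_ext \<Delta> 2 0 0 y \<in> multipliers 2" by simp_all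
  have e: "leg_ext \<Delta> 2 0 0 (x + y) = leg_ext \<Delta> 2 0 0 x + leg_ext \<Delta> 2 0 0 y"
    using D.linear_on_leg_ext[of 0 0] by (simp add: linear_on_def)
  show ?case using N_add.IH unfolding e by (simp add: mmult_linear[of _ 2] N_at_closed)
next
  case (N_scale x c)
  then have [simp]: "x \<in> multipliers 1" using N_alg_multipliers[OF \<sigma>M] by auto
  have [simp]: "leg_ext \<Delta> 2 0 0 x \<in> multipliers 2" by simp
  have e: "leg_ext \<Delta> 2 0 0 (c *\<^sub>C x) = c *\<^sub>C leg_ext \<Delta> 2 0 0 x"
    using D.linear_on_leg_ext[of 0 0] by (simp add: linear_on_def)
  show ?case using N_scale.IH unfolding e by (simp add: mmult_linear[of _ 2] N_at_closed)
next
  case (N_mult x y)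
  then have xy [simp]: "x \<in> multipliers 1" "y \<in> multipliers 1" using N_alg_multipliers[OF \<sigma>M] by auto
  let ?X = "leg_ext \<Delta> 2 0 0 x" and ?Y = "leg_ext \<Delta> 2 0 0 y"
  have XY [simp]: "?X \<in> multipliers 2" "?Y \<in> multipliers 2" by simp_all
  have e: "leg_ext \<Delta> 2 0 0 (mmult x y) = mmult ?X ?Y" using D.leg_ext_mmult[of x 0 0 y] by simp
  note [simp] = N_alg_multipliers[OF \<sigma>M]
  have lin: "linear_on (multipliers 2) (\<lambda>x. mmult x y)" "linear_on (multipliers 2) (mmult y)"
    if "y \<in> multipliers 2" for y :: "'a multiplier" using that by (simp_all add: linear_on_def mmult_linear[of _ 2])
  \<comment> \<open>In the product case \<Delta>(x) meets \<Delta>(y)(1 \<otimes> b), a sum of terms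
    \<nu> \<otimes> d. Such a term is (1 \<otimes> d)(\<nu> \<otimes> 1), so \<Delta>(x)(1 \<otimes>
    d) lies in N(H) \<otimes> H by induction, and \<nu> \<otimes> 1 is absorbed. The four orders
    serve the four products.\<close>
  have sp: "mtensor 1 1 \<nu> (membed 1 (pure [d])) = mmult (mult2 d) (mtensor 1 1 \<nu> (mone 1))"
    "mtensor 1 1 \<nu> (membed 1 (pure [d])) = mmult (mtensor 1 1 \<nu> (mone 1)) (mult2 d)"
    "mtensor 1 1 (membed 1 (pure [d])) \<nu> = mmult (mult1 d) (mtensor 1 1 (mone 1) \<nu>)"
    "mtensor 1 1 (membed 1 (pure [d])) \<nu> = mmult (mtensor 1 1 (mone 1) \<nu>) (mult1 d)"
    if "\<nu> \<in> N_alg \<sigma>" for \<nu> d using that by (simp_all add: mtensor_mmult)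
  have 1: "mmult ?X u \<in> NN \<sigma> 0 1" if "u \<in> NN \<sigma> 0 1" for u
    by (rule NN_0_1_induct[OF that lin(2)[OF XY(1)] subspace_N_at])
      (use N_mult.IH NN_slot_mult in \<open>simp only: sp(1) mmult_assoc[symmetric]\<close>)
  have 2: "mmult u ?Y \<in> NN \<sigma> 0 1" if "u \<in> NN \<sigma> 0 1" for u
    by (rule NN_0_1_induct[OF that lin(1)[OF XY(2)] subspace_N_at])
      (use N_mult.IH NN_slot_mult in \<open>simp only: sp(2) mmult_assoc\<close>)
  have 3: "mmult ?X u \<in> NN \<sigma> 1 0" if "u \<in> NN \<sigma> 1 0" for u
    by (rule NN_1_0_induct[OF that lin(2)[OF XY(1)] subspace_N_at])
      (use N_mult.IH NN_slot_mult in \<open>simp only: sp(3) mmult_assoc[symmetric]\<close>)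
  have 4: "mmult u ?Y \<in> NN \<sigma> 1 0" if "u \<in> NN \<sigma> 1 0" for u
    by (rule NN_1_0_induct[OF that lin(1)[OF XY(2)] subspace_N_at])
      (use N_mult.IH NN_slot_mult in \<open>simp only: sp(4) mmult_assoc\<close>)
  have "mmult (mmult ?X ?Y) (mult2 b) \<in> NN \<sigma> 0 1" "mmult (mmult ?X ?Y) (mult1 b) \<in> NN \<sigma> 1 0" for b
    unfolding mmult_assoc by (rule 1 3; use N_mult.IH in blast)+
  moreover have "mmult (mult2 b) (mmult ?X ?Y) \<in> NN \<sigma> 0 1" "mmult (mult1 b) (mmult ?X ?Y) \<in> NN \<sigma> 1 0" for b
    unfolding mmult_assoc[symmetric] by (rule 2 4; use N_mult.IH in blast)+
  ultimately show ?case unfolding e by blast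
qed

lemma around_2_NN:
  assumes "s \<in> tpow p" "t \<in> tpow q"
  shows "x \<in> NN \<sigma> 0 1 \<Longrightarrow> around 2 p q s x t \<in> NN \<sigma> p (1 + q)"
    and "x \<in> NN \<sigma> 1 0 \<Longrightarrow> around 2 p q s x t \<in> NN \<sigma> (p + 1) q"
  using NN_left[OF \<sigma>M assms(1) NN_right[OF \<sigma>M assms(2), of x 0 1]]
    NN_left[OF \<sigma>M assms(1) NN_right[OF \<sigma>M assms(2), of x 1 0]]
  by (simp_all add: around_def)

text \<open>The product of Y with s \<otimes> (1 \<otimes> b) \<otimes> t arises by extending
  \<Delta> to z (s \<otimes> 1 \<otimes> t) and multiplying by 1 \<otimes> b in the two legs. The
  former has its middle factor in N(H), and \<Delta>(N(H))(1 \<otimes> b) lies in N(H) \<otimes> H.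
  With b \<otimes> 1 instead, the slot is the second leg.\<close>

lemma leg_ext_NN_Delta:
  assumes z: "z \<in> multipliers0 \<sigma> n" and n: "n = p + (1 + q)" and s: "s \<in> tpow p" and t: "t \<in> tpow q"
  defines "Y \<equiv> leg_ext \<Delta> 2 p q z"
  shows "mmult Y (around 2 p q s (mult2 b) t) \<in> NN \<sigma> p (1 + q)" "mmult (around 2 p q s (mult2 b) t) Y \<in> NN \<sigma> p (1 + q)"
    "mmult Y (around 2 p q s (mult1 b) t) \<in> NN \<sigma> (p + 1) q" "mmult (around 2 p q s (mult1 b) t) Y \<in> NN \<sigma> (p + 1) q"
proof -
  note zM = multipliers0_multipliers[OF \<sigma>M z]
  let ?F = "leg_ext \<Delta> 2 p q" and ?M = "multipliers (p + (2 + q))"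
  let ?P = "\<lambda>x. mtensor p (2 + q) (mone p) (mtensor 2 q x (mone q))"
  have a: "around 1 p q s (mone 1) t \<in> multipliers n" using s t n by simp
  have lin: "linear_on (multipliers (p + (1 + q))) ?F" by (rule D.linear_on_leg_ext)
  have F: "?F x \<in> ?M" if "x \<in> multipliers (p + (1 + q))" for x using that by (rule D.leg_ext_multipliers)
  have P: "?P x \<in> ?M" if "x \<in> multipliers 2" for x using that by simp
  have ext: "?F (around 1 p q s \<nu> t) = around 2 p q s (leg_ext \<Delta> 2 0 0 \<nu>) t"
    if "s \<in> tpow p" "t \<in> tpow q" "\<nu> \<in> multipliers 1" for s t \<nu>
    using that by (simp add: around_def D.leg_ext_between)
  have one: "?F (around 1 p q s (mone 1) t) = around 2 p q s (mone 2) t"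
    using s t D.leg_ext_mone[of 0 0] by (simp add: ext)
  have ap: "mmult (around 2 p q s x t) (?P y) = around 2 p q s (mmult x y) t"
    "mmult (?P y) (around 2 p q s x t) = around 2 p q s (mmult y x) t"
    if "s \<in> tpow p" "t \<in> tpow q" "x \<in> multipliers 2" "y \<in> multipliers 2" for s t x y
    using that by (simp_all add: around_def mtensor_mmult)
  have Fa: "mmult Y (around 2 p q s x t) = mmult (?F (mmult z (around 1 p q s (mone 1) t))) (?P x)"
    "mmult (around 2 p q s x t) Y = mmult (?P x) (?F (mmult (around 1 p q s (mone 1) t) z))"
    if x: "x \<in> multipliers 2" for x
  proof -
    have e: "around 2 p q s x t = mmult (around 2 p q s (mone 2) t) (?P x)"
      and e': "around 2 p q s x t = mmult (?P x) (around 2 p q s (mone 2) t)"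
      using ap[OF s t mone_multipliers x] x by simp_all
    have Fz: "?F (mmult z (around 1 p q s (mone 1) t)) = mmult Y (around 2 p q s (mone 2) t)"
      "?F (mmult (around 1 p q s (mone 1) t) z) = mmult (around 2 p q s (mone 2) t) Y"
      using zM a n by (simp_all add: D.leg_ext_mmult one Y_def)
    show "mmult Y (around 2 p q s x t) = mmult (?F (mmult z (around 1 p q s (mone 1) t))) (?P x)"
      unfolding Fz e mmult_assoc ..
    show "mmult (around 2 p q s x t) Y = mmult (?P x) (?F (mmult (around 1 p q s (mone 1) t) z))"
      unfolding Fz e' mmult_assoc ..
  qed
  have gen: "mmult (?F x) (?P (mult2 b)) \<in> NN \<sigma> p (1 + q) \<and> mmult (?P (mult2 b)) (?F x) \<in> NN \<sigma> p (1 + q) \<and>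
     mmult (?F x) (?P (mult1 b)) \<in> NN \<sigma> (p + 1) q \<and> mmult (?P (mult1 b)) (?F x) \<in> NN \<sigma> (p + 1) q"
    if x: "x \<in> NN \<sigma> p q" for x
    by (intro conjI; rule NN_induct[OF \<sigma>M x _ subspace_N_at];
        (rule linear_on_mmult[OF lin F P[OF mult12_multipliers(1)]] linear_on_mmult[OF lin F P[OF mult12_multipliers(2)]], assumption)?)
      (use Delta_N_alg N_alg_multipliers[OF \<sigma>M] in \<open>simp_all add: ext ap around_2_NN[simplified]\<close>)
  note z1 = gen[OF multipliers0D(1)[OF \<sigma>M z n s t]] and z2 = gen[OF multipliers0D(2)[OF \<sigma>M z n s t]]
  show "mmult Y (around 2 p q s (mult2 b) t) \<in> NN \<sigma> p (1 + q)" "mmult (around 2 p q s (mult2 b) t) Y \<in> NN \<sigma> p (1 + q)"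
    "mmult Y (around 2 p q s (mult1 b) t) \<in> NN \<sigma> (p + 1) q" "mmult (around 2 p q s (mult1 b) t) Y \<in> NN \<sigma> (p + 1) q"
    unfolding Fa[OF mult12_multipliers(1)] Fa[OF mult12_multipliers(2)] using z1 z2 by blast+
qed

text \<open>The slot is the first leg; the factor b right behind it belongs to the second leg, so
  the test tensor contains 1 \<otimes> b at the place of \<Delta>.\<close>

lemma Delta_slot_first:
  assumes z: "z \<in> multipliers0 \<sigma> n" and n: "n = p + (1 + q)" and s: "s \<in> tpow p" and t: "t \<in> tpow (1 + q)"
  shows "mmult (leg_ext \<Delta> 2 p q z) (around 1 p (1 + q) s (mone 1) t) \<in> NN \<sigma> p (1 + q) \<and>
    mmult (around 1 p (1 + q) s (mone 1) t) (leg_ext \<Delta> 2 p q z) \<in> NN \<sigma> p (1 + q)"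
proof -
  let ?Y = "leg_ext \<Delta> 2 p q z"
  have zM: "z \<in> multipliers (p + (1 + q))" using multipliers0_multipliers[OF \<sigma>M z] n by simp
  have Y: "?Y \<in> multipliers (p + (1 + (1 + q)))" by (rule D.leg_ext_multipliers'[OF zM]) simp
  note bl = bilinear_on_right[OF bilinear_around[of "mone 1" 1 p "1 + q"] s, simplified]
  have lin: "linear_on (tpow (1 + q)) (\<lambda>t. mmult ?Y (around 1 p (1 + q) s (mone 1) t))"
    "linear_on (tpow (1 + q)) (\<lambda>t. mmult (around 1 p (1 + q) s (mone 1) t) ?Y)"
    by (rule linear_on_mmult[OF bl _ Y]; use s in simp)+
  have "mmult ?Y (around 1 p (1 + q) s (mone 1) (pure xs)) \<in> NN \<sigma> p (1 + q) \<and>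
     mmult (around 1 p (1 + q) s (mone 1) (pure xs)) ?Y \<in> NN \<sigma> p (1 + q)" if "length xs = 1 + q" for xs
  proof -
    from that obtain b ys where xs: "xs = b # ys" "length ys = q" by (cases xs) auto
    have "around 1 p (1 + q) s (mone 1) (tconcat 1 q (pure [b]) (pure ys)) = around 2 p q s (mult2 b) (pure ys)"
      using s xs mtensor_assoc[of "mone 1" 1 "membed 1 (pure [b])" 1 "membed q (pure ys)" q]
      by (simp add: around_def mtensor_membed[symmetric] del: tconcat_pure)
    then show ?thesis using leg_ext_NN_Delta(1,2)[OF z n s, of "pure ys" b] xs by simp
  qed
  then show ?thesis
    using linear_on_tpow_mem[OF lin(1) subspace_N_at _ t] linear_on_tpow_mem[OF lin(2) subspace_N_at _ t] by blast
qed

lemma Delta_slot_second: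
  assumes z: "z \<in> multipliers0 \<sigma> n" and n: "n = p + (1 + q)" and s: "s \<in> tpow (p + 1)" and t: "t \<in> tpow q"
  shows "mmult (leg_ext \<Delta> 2 p q z) (around 1 (p + 1) q s (mone 1) t) \<in> NN \<sigma> (p + 1) q \<and>
    mmult (around 1 (p + 1) q s (mone 1) t) (leg_ext \<Delta> 2 p q z) \<in> NN \<sigma> (p + 1) q"
proof -
  let ?Y = "leg_ext \<Delta> 2 p q z"
  have zM: "z \<in> multipliers (p + (1 + q))" using multipliers0_multipliers[OF \<sigma>M z] n by simp
  have Y: "?Y \<in> multipliers (p + 1 + (1 + q))" by (rule D.leg_ext_multipliers'[OF zM]) simp
  note bl = bilinear_on_left[OF bilinear_around[of "mone 1" 1 "p + 1" q] t, simplified]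
  have lin: "linear_on (tpow (p + 1)) (\<lambda>s. mmult ?Y (around 1 (p + 1) q s (mone 1) t))"
    "linear_on (tpow (p + 1)) (\<lambda>s. mmult (around 1 (p + 1) q s (mone 1) t) ?Y)"
    by (rule linear_on_mmult[OF bl _ Y]; use t in simp)+
  have "mmult ?Y (around 1 (p + 1) q (pure xs) (mone 1) t) \<in> NN \<sigma> (p + 1) q \<and>
     mmult (around 1 (p + 1) q (pure xs) (mone 1) t) ?Y \<in> NN \<sigma> (p + 1) q" if "length xs = p + 1" for xs
  proof -
    from that obtain ys b where xs: "xs = ys @ [b]" "length ys = p" by (cases xs rule: rev_cases) auto
    have "around 1 (p + 1) q (tconcat p 1 (pure ys) (pure [b])) (mone 1) t = around 2 p q (pure ys) (mult1 b) t"
      using t xs mtensor_assoc[of "membed 1 (pure [b])" 1 "mone 1" 1 "membed q t" q]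
      by (simp add: around_def mtensor_membed[symmetric] mtensor_assoc del: tconcat_pure)
    then show ?thesis using leg_ext_NN_Delta(3,4)[OF z n _ t, of "pure ys" b] xs by simp
  qed
  then show ?thesis
    using linear_on_tpow_mem[OF lin(1) subspace_N_at _ s] linear_on_tpow_mem[OF lin(2) subspace_N_at _ s] by blast
qed

section \<open>Cofaces and codegeneracies preserve the smaller spaces\<close>

lemma coface_multipliers0:
  assumes i: "i \<le> n + 1" and z: "z \<in> multipliers0 \<sigma> n"
  shows "coface \<Delta> \<sigma> n i z \<in> multipliers0 \<sigma> (n + 1)"
proof -
  note zM = multipliers0_multipliers[OF \<sigma>M z]
  show ?thesis using i
  proof (cases rule: coface_cases)
    case first
    then show ?thesis using mtensor_mone_multipliers0[OF \<sigma>M z] by (simp only: coface_first)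
  next
    case last
    then show ?thesis using mtensor_sigma_multipliers0[OF \<sigma>M z] by (simp only: coface_last)
  next
    case (middle p0 q0)
    show ?thesis
    proof (rule multipliers0I[OF \<sigma>M coface_multipliers[OF i zM]])
      fix p q and s t :: "'a tensor" assume n: "n + 1 = p + (1 + q)" and s: "s \<in> tpow p" and t: "t \<in> tpow q"
      \<comment> \<open>The slot p relative to the two legs p0 and p0 + 1 of \<Delta>: in front of
        both, on the first, on the second, behind both. The outer cases use nondegeneracy, the inner
        ones the behaviour of \<Delta> on N(H).\<close>
      consider q1 where "p0 = p + (1 + q1)" | "p0 = p" | "p = p0 + 1" | q1 where "p = p0 + (2 + q1)"
      proof -
        have "p0 = p + (1 + (p0 - p - 1)) \<or> p0 = p \<or> p = p0 + 1 \<or> p = p0 + (2 + (p - p0 - 2))" by arith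
        then show thesis using that by blast
      qed
      then show "mmult (coface \<Delta> \<sigma> n i z) (around 1 p q s (mone 1) t) \<in> NN \<sigma> p q \<and>
         mmult (around 1 p q s (mone 1) t) (coface \<Delta> \<sigma> n i z) \<in> NN \<sigma> p q"
        unfolding coface_middle[OF zM middle(2,1)]
      proof cases
        case 1
        have q: "q = q1 + (2 + q0)" and n': "n = p + (1 + (q1 + (1 + q0)))" using n 1 middle by simp_all
        show "mmult (leg_ext \<Delta> 2 p0 q0 z) (around 1 p q s (mone 1) t) \<in> NN \<sigma> p q \<and>
         mmult (around 1 p q s (mone 1) t) (leg_ext \<Delta> 2 p0 q0 z) \<in> NN \<sigma> p q"
          using D.leg_ext_NN_slot_left[OF \<sigma>M z n' s t[unfolded q]] unfolding 1 q .
      next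
        case 2
        have q: "q = 1 + q0" using n 2 middle by simp
        show "mmult (leg_ext \<Delta> 2 p0 q0 z) (around 1 p q s (mone 1) t) \<in> NN \<sigma> p q \<and>
         mmult (around 1 p q s (mone 1) t) (leg_ext \<Delta> 2 p0 q0 z) \<in> NN \<sigma> p q"
          using Delta_slot_first[OF z middle(2)[unfolded 2] s t[unfolded q]] unfolding 2 q .
      next
        case 3
        have q: "q = q0" using n 3 middle by simp
        show "mmult (leg_ext \<Delta> 2 p0 q0 z) (around 1 p q s (mone 1) t) \<in> NN \<sigma> p q \<and>
         mmult (around 1 p q s (mone 1) t) (leg_ext \<Delta> 2 p0 q0 z) \<in> NN \<sigma> p q"
          using Delta_slot_second[OF z middle(2) s[unfolded 3] t[unfolded q]] unfolding 3 q .
      next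
        case 4
        have q: "q0 = q1 + (1 + q)" and n': "n = p0 + (1 + (q1 + (1 + q)))" using n 4 middle by simp_all
        show "mmult (leg_ext \<Delta> 2 p0 q0 z) (around 1 p q s (mone 1) t) \<in> NN \<sigma> p q \<and>
         mmult (around 1 p q s (mone 1) t) (leg_ext \<Delta> 2 p0 q0 z) \<in> NN \<sigma> p q"
          using D.leg_ext_NN_slot_right[OF \<sigma>M z n' s[unfolded 4] t] unfolding 4 q .
      qed
    qed
  qed
qed

lemma codegeneracy_multipliers0:
  assumes j: "j \<le> n" and z: "z \<in> multipliers0 \<sigma> (n + 1)"
  shows "codeg n j z \<in> multipliers0 \<sigma> n"
proof -
  note zM = multipliers0_multipliers[OF \<sigma>M z]
  define q0 where "q0 = n - j"
  have q0: "n = j + q0" using j by (simp add: q0_def)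
  show ?thesis
  proof (rule multipliers0I[OF \<sigma>M codegeneracy_multipliers[OF j zM]])
    fix p q and s t :: "'a tensor" assume n: "n = p + (1 + q)" and s: "s \<in> tpow p" and t: "t \<in> tpow q"
    \<comment> \<open>The slot is counted in the target, where the removed factor is gone. So it
      never coincides with that factor: p < j puts it in front, and otherwise it lies
      behind.\<close>
    have "j = p + (1 + (j - p - 1)) \<or> p = j + (0 + (p - j))" by arith
    then consider q1 where "j = p + (1 + q1)" | q1 where "p = j + (0 + q1)" by blast
    then show "mmult (codeg n j z) (around 1 p q s (mone 1) t) \<in> NN \<sigma> p q \<and>
         mmult (around 1 p q s (mone 1) t) (codeg n j z) \<in> NN \<sigma> p q"
      unfolding codeg_eq[OF zM q0 refl]
    proof cases
      case 1
      have q: "q = q1 + (0 + q0)" and n': "n + 1 = p + (1 + (q1 + (1 + q0)))" using n 1 q0 by simp_all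
      show "mmult (leg_ext counit_leg 0 j q0 z) (around 1 p q s (mone 1) t) \<in> NN \<sigma> p q \<and>
         mmult (around 1 p q s (mone 1) t) (leg_ext counit_leg 0 j q0 z) \<in> NN \<sigma> p q"
        using E.leg_ext_NN_slot_left[OF \<sigma>M z n' s t[unfolded q]] unfolding 1 q .
    next
      case 2
      have q: "q0 = q1 + (1 + q)" and n': "n + 1 = j + (1 + (q1 + (1 + q)))" using n 2 q0 by simp_all
      show "mmult (leg_ext counit_leg 0 j q0 z) (around 1 p q s (mone 1) t) \<in> NN \<sigma> p q \<and>
         mmult (around 1 p q s (mone 1) t) (leg_ext counit_leg 0 j q0 z) \<in> NN \<sigma> p q"
        using E.leg_ext_NN_slot_right[OF \<sigma>M z n' s[unfolded 2] t] unfolding 2 q .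
    qed
  qed
qed

text \<open>Linearity and the identities are inherited from the full multiplier algebras; only
  closure under the maps is new.\<close>

lemma cosimplicial_multipliers0:
  "cosimplicial_vector_space (multipliers0 \<sigma>) (coface \<Delta> \<sigma>) (\<lambda>n j. codegeneracy \<Delta> (n + 1) (j + 1))"
proof -
  have sub: "x \<in> multipliers n" if "x \<in> multipliers0 \<sigma> n" for x n using multipliers0_multipliers[OF \<sigma>M that] .
  have lin: "linear_on (multipliers0 \<sigma> n) f" if "linear_on (multipliers n) f" for n and f :: "'a multiplier \<Rightarrow> 'a multiplier"
    using that sub by (simp add: linear_on_def)
  show ?thesis unfolding cosimplicial_vector_space_def
    by (intro conjI allI impI ballI image_subsetI; (elim conjE)?)
      (assumption | rule subspace_multipliers0[OF \<sigma>M] lin coface_linear coface_multipliers0 codegeneracy_linear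
        codegeneracy_multipliers0 coface_coface codeg_coface_less codeg_coface_same codeg_coface_greater codeg_codeg sub)+
qed

end

theorem proposition4p6:
  fixes \<Delta> :: "'h::complex_algebra \<Rightarrow> 'h multiplier"
    and \<delta> :: "'h \<Rightarrow> complex"
    and \<sigma> :: "'h multiplier"
  assumes "regular_multiplier_hopf_algebra \<Delta>"
    and "modular_pair_in_involution \<Delta> \<delta> \<sigma>"
  shows "cosimplicial_vector_space (multipliers0 \<sigma>)
           (coface \<Delta> \<sigma>) (\<lambda>n j. codegeneracy \<Delta> (n + 1) (j + 1)) \<and>
         cosimplicial_vector_space multipliers
           (coface \<Delta> \<sigma>) (\<lambda>n j. codegeneracy \<Delta> (n + 1) (j + 1))"
proof -
  have \<delta>: "is_character \<delta>" and one: "character_ext \<delta> \<sigma> = 1"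
    using assms(2) by (simp_all add: modular_pair_in_involution_def)
  \<comment> \<open>This element serves twice: it shows that H is not zero, and below it makes the
    scalar defining the extension of \<delta> unique.\<close>
  obtain a where a: "\<delta> a \<noteq> 0" using \<delta> by (auto simp: is_character_def)
  have \<delta>0: "\<delta> 0 = 0" using \<delta> linear_on_zero[of UNIV \<delta>] by (simp add: is_character_def)
  have "a \<noteq> 0" using a \<delta>0 by auto
  moreover have "\<sigma> \<noteq> 0"
  proof
    assume "\<sigma> = 0"
    have tval0: "tval 0 = (0 :: 'h)" using tval_pure[of "0 :: 'h"] by simp
    \<comment> \<open>The scalar c must satisfy c \<delta>(a) = \<delta>(0) = 0 with \<delta>(a)
      \<noteq> 0, so the extension takes the value 0 at the zero multiplier, not 1.\<close>
    have "character_ext \<delta> \<sigma> = 0" unfolding character_ext_def \<open>\<sigma> = 0\<close>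
      by (rule the_equality) (use a \<delta>0 tval0 in auto)
    then show False using one by simp
  qed
  ultimately interpret regular_grouplike \<Delta> \<sigma>
    using assms by unfold_locales (auto simp: regular_multiplier_hopf_algebra_def modular_pair_in_involution_def)
  show ?thesis using cosimplicial_multipliers0 cosimplicial_multipliers by blast
qed

end
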